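(* Let $P$ be an ergodic $\Xi$-invariant probability measure on $\widetilde\Omega$ such that $\int_{\widetilde\Omega}N_1(\tilde\omega)\,dP(\tilde\omega)<\infty$. Assume that $\mathbf F$ is a family of iterated function systems consisting of similarities on $\mathbb R^D$ and that $0<\underline\sigma\le\overline\sigma<\tfrac12$. Then for $P$-almost all $\tilde\omega\in\widetilde\Omega$, $$\dim_{\mathrm H}(A_{\mathbf a}^{\tilde\omega})=\min\{\alpha_0,D\}\quad\text{for }\mathcal L^{D\mathcal A}\text{-almost all }\mathbf a\in\mathbb R^{D\mathcal A},$$ where $\alpha_0$ is the ($P$-almost surely unique and non-random) zero of the pressure $\alpha\mapsto p^{\tilde\omega}(\alpha)$.
   Context: $\mathbb N=\{1,2,\dots\}$, $D\in\mathbb N$; $\dim_{\mathrm H}$ is Hausdorff dimension. Code trees. Let $\Lambda$ be an index set and for each $\lambda\in\Lambda$ let $M_\lambda\in\mathbb N$, with $M=\sup_\lambda M_\lambda<\infty$. For $\lambda\in\Lambda$, $1\le i\le M_\lambda$ let $T_i^\lambda:\mathbb R^D\to\mathbb R^D$ be a fixed non-singular linear map. The numbers $\underline\sigma\le\overline\sigma$ satisfy $\underline\sigma\le\sigma_D(T_i^\lambda)\le\sigma_1(T_i^\lambda)\le\overline\sigma$ for all $\lambda,i$, where $\sigma_1(T)\ge\dots\ge\sigma_D(T)$ denote the singular values of $T$. Let $I=\{1,\dots,M\}$; $I^0$ consists of the empty word $\emptyset$; $|\tau|=k$ for $\tau\in I^k$. For a function $\omega:\bigcup_{k\ge0}I^k\to\Lambda$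 let $\Sigma_*^\omega\subset\bigcup_{k\ge0}I^k$ be the unique set such that $\emptyset\in\Sigma_*^\omega$; if $i_1\cdots i_k\in\Sigma_*^\omega$ and $\omega(i_1\cdots i_k)=\lambda$ then $i_1\cdots i_kl\in\Sigma_*^\omega$ if and only if $l\le M_\lambda$; and if $i_1\cdots i_k\notin\Sigma_*^\omega$ then $i_1\cdots i_kl\notin\Sigma_*^\omega$ for all $l$. The restriction of $\omega$ to $\Sigma_*^\omega$ is called a code tree; $\Omega$ is the set of all code trees. $\Sigma^\omega=\{\mathbf i=i_1i_2\cdots\in I^{\mathbb N}: i_1\cdots i_n\in\Sigma_*^\omega\ \forall n\}$. For $\mathbf i_k=i_1\cdots i_k\in\Sigma_*^\omega$ put $T_{\mathbf i_k}^\omega=T_{i_1}^{\omega(\emptyset)}T_{i_2}^{\omega(i_1)}\cdots T_{i_k}^{\omega(i_1\cdots i_{k-1})}$. Translations. The set $\widehat\Lambda=\{(\lambda,i):\lambda\in\Lambda,1\le i\le M_\lambda\}$ carries an equivalence relation $\sim$ with finitely many classes, their number being $\mathcal A$, such that for every $\lambda$, $(\lambda,i)\sim(\lambda,j)$ iff $i=j$. A vector $\mathbf a\in(\mathbb R^D)^{\mathcal A}=\mathbb R^{D\mathcal A}$ assigns a vector in $\mathbb R^D$ to each class; $a_i^\lambda$ is the vector assigned to the class of $(\lambda,i)$, $f_i^\lambda(x)=T_i^\lambda(x)+a_i^\lambda$, $F^\lambda=\{f_1^\lambda,\dots,f_{M_\lambda}^\lambda\}$ and $\mathbf F=\{F^\lambda:\lambda\in\Lambda\}$.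 That $\mathbf F$ consists of similarities means every $f_i^\lambda$ is a similarity (all singular values of $T_i^\lambda$ are equal). Put $Z_{\mathbf a}^\omega(\mathbf i)=\lim_{k\to\infty}f_{i_1}^{\omega(\emptyset)}\circ\cdots\circ f_{i_k}^{\omega(i_1\cdots i_{k-1})}(0)$ for $\mathbf i\in\Sigma^\omega$ and $A_{\mathbf a}^\omega=\{Z_{\mathbf a}^\omega(\mathbf i):\mathbf i\in\Sigma^\omega\}$. $\mathcal L^{D\mathcal A}$ is Lebesgue measure on $\mathbb R^{D\mathcal A}$. Pressure. For a non-singular linear $T$ with singular values $\sigma_1\ge\dots\ge\sigma_D>0$ let $\Phi^\alpha(T)=\sigma_1\cdots\sigma_{m-1}\sigma_m^{\alpha-m+1}$ if $0\le\alpha<D$, where $m$ is the integer with $m-1\le\alpha<m$, and $\Phi^\alpha(T)=\sigma_1\cdots\sigma_{D-1}\sigma_D^{\alpha-D+1}$ if $\alpha\ge D$ (so $\Phi^\alpha(T)=s^\alpha$ if all singular values equal $s$). For $k\in\mathbb N$, $\alpha\ge0$ let $S^\omega(k,\alpha)=\sum\Phi^\alpha(T_{\mathbf i_k}^\omega)$, the sum over all words $\mathbf i_k\in\Sigma_*^\omega$ of length $k$, and $p^\omega(\alpha)=\lim_{k\to\infty}\frac1k\log S^\omega(k,\alpha)$ (the pressure), when the limit exists. Whenever $P$ (defined on the space $\widetilde\Omega$ below) is ergodic, $\Xi$-invariant and $\int N_1\,dP<\infty$, for $P$-almost all $\tilde\omega$ the pressure $p^{\tilde\omega}(\alpha)$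 exists for all $\alpha\ge0$, does not depend on $\tilde\omega$, is strictly decreasing in $\alpha$, and has a unique zero, denoted $\alpha_0$. Neck levels. $\widetilde\Omega$ is the set of $\tilde\omega=(\omega,N)\in\Omega\times\mathbb N^{\mathbb N}$ such that $N_m<N_{m+1}$ for all $m$, and whenever $\mathbf i,\mathbf i'$ are words of length $N_m$ and $\mathbf j$ is a finite (possibly empty) word with $\mathbf i\mathbf j,\mathbf i'\in\Sigma_*^\omega$, then $\mathbf i'\mathbf j\in\Sigma_*^\omega$ and $\omega(\mathbf i\mathbf j)=\omega(\mathbf i'\mathbf j)$. $N_m(\tilde\omega)=N_m$ for $\tilde\omega=(\omega,N)$. The shift $\Xi:\widetilde\Omega\to\widetilde\Omega$ is $\Xi(\omega,N)=(\hat\omega,\hat N)$ with $\hat N_m=N_{m+1}-N_1$ and $\hat\omega(\mathbf j)=\omega(\mathbf i\mathbf j)$ for any $\mathbf i\in\Sigma_*^\omega$ with $|\mathbf i|=N_1$. $\widetilde\Omega$ has the topology generated by the cylinders $[(\omega,N)_m]=\{(\hat\omega,\hat N)\in\widetilde\Omega:\hat N_i=N_i\ \forall i\le m,\ \hat\omega(\tau)=\omega(\tau)\text{ for all }\tau\text{ with }|\tau|<N_m\}$, $m\in\mathbb N$, and the corresponding Borel $\sigma$-algebra. For $\tilde\omega=(\omega,N)$, $A_{\mathbf a}^{\tilde\omega}=A_{\mathbf a}^\omega$ and $p^{\tilde\omega}=p^\omega$. *)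

theory Defs
  imports "HOL-Probability.Probability"
begin

section \<open>Hausdorff dimension\<close>

text \<open>The convention is \<open>diam(U)^0 = 1\<close> for nonempty \<open>U\<close>, whereas \<open>0 powr 0 = 0\<close>.\<close>

definition diam_power :: "real \<Rightarrow> 'a::metric_space set \<Rightarrow> ennreal" where
  "diam_power s U =
     (if U = {} then 0 else if s = 0 then 1 else ennreal (diameter U powr s))"

text \<open>Boundedness is required because \<^const>\<open>diameter\<close> is meaningless on unbounded sets.\<close>

definition hausdorff_premeasure :: "real \<Rightarrow> real \<Rightarrow> 'a::metric_space set \<Rightarrow> ennreal" where
  "hausdorff_premeasure s \<delta> A =
     (INF U \<in> {U :: nat \<Rightarrow> 'a set. A \<subseteq> (\<Union>n. U n) \<and> (\<forall>n. bounded (U n) \<and> diameter (U n) \<le> \<delta>)}.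
        \<Sum>n. diam_power s (U n))"

definition hausdorff_measure :: "real \<Rightarrow> 'a::metric_space set \<Rightarrow> ennreal" where
  "hausdorff_measure s A = (SUP \<delta> \<in> {0<..}. hausdorff_premeasure s \<delta> A)"

definition hausdorff_dim :: "'a::metric_space set \<Rightarrow> ereal" where
  "hausdorff_dim A = Inf {ereal s | s. 0 \<le> s \<and> hausdorff_measure s A = 0}"

section \<open>Singular values and the singular value function\<close>

text \<open>The square roots of the eigenvalues of \<open>T\<^sup>* T\<close>, in decreasing order and each repeated
  according to its (geometric) multiplicity.\<close>

definition singular_values :: "('a::euclidean_space \<Rightarrow> 'a) \<Rightarrow> real list" where
  "singular_values T =
     rev (concat (map (\<lambda>t. replicate (dim {x. adjoint T (T x) = t *\<^sub>R x}) (sqrt t))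
       (sorted_list_of_set {t. \<exists>x. x \<noteq> 0 \<and> adjoint T (T x) = t *\<^sub>R x})))"

text \<open>Indexed from \<open>1\<close> to the dimension.\<close>

definition singular_value :: "nat \<Rightarrow> ('a::euclidean_space \<Rightarrow> 'a) \<Rightarrow> real" where
  "singular_value i T = singular_values T ! (i - 1)"

definition singular_value_function :: "real \<Rightarrow> ('a::euclidean_space \<Rightarrow> 'a) \<Rightarrow> real" where
  "singular_value_function \<alpha> T =
     (let m = (if \<alpha> < real DIM('a) then nat \<lfloor>\<alpha>\<rfloor> + 1 else DIM('a))
      in (\<Prod>i\<in>{1..<m}. singular_value i T) * singular_value m T powr (\<alpha> - real m + 1))"

definition similarity :: "('a::metric_space \<Rightarrow> 'a) \<Rightarrow> bool" where
  "similarity f \<longleftrightarrow> (\<exists>r>0. \<forall>x y. dist (f x) (f y) = r * dist x y)"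

section \<open>Code trees\<close>

text \<open>Letters are natural numbers starting from \<open>1\<close>; the index set is the type \<open>'l\<close>, and \<open>M l\<close> is the
  number of maps of the system with index \<open>l\<close>.\<close>

inductive_set tree_words :: "('l \<Rightarrow> nat) \<Rightarrow> (nat list \<Rightarrow> 'l) \<Rightarrow> nat list set"
  for M :: "'l \<Rightarrow> nat" and \<omega> :: "nat list \<Rightarrow> 'l" where
  empty: "[] \<in> tree_words M \<omega>"
| extend: "\<tau> \<in> tree_words M \<omega> \<Longrightarrow> 1 \<le> l \<Longrightarrow> l \<le> M (\<omega> \<tau>) \<Longrightarrow> \<tau> @ [l] \<in> tree_words M \<omega>"

text \<open>A restricted function is \<open>undefined\<close> outside its tree, so that two code trees are equal
  iff they agree as partial functions. The tree of the restriction is that of the function.\<close>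

definition code_trees :: "('l \<Rightarrow> nat) \<Rightarrow> (nat list \<Rightarrow> 'l) set" where
  "code_trees M = range (\<lambda>\<omega>. restrict \<omega> (tree_words M \<omega>))"

text \<open>The letter \<open>i\<^sub>k\<close> of an infinite word is \<open>u (k - 1)\<close>.\<close>

definition tree_boundary :: "('l \<Rightarrow> nat) \<Rightarrow> (nat list \<Rightarrow> 'l) \<Rightarrow> (nat \<Rightarrow> nat) set" where
  "tree_boundary M \<omega> = {u. \<forall>n. map u [0..<n] \<in> tree_words M \<omega>}"

text \<open>\<open>comp_along g \<omega> \<rho> [i\<^sub>1, \<dots>, i\<^sub>k]\<close> is the composition of the maps
  \<open>g (\<omega> (\<rho> @ [i\<^sub>1, \<dots>, i\<^sub>j\<^sub>-\<^sub>1])) i\<^sub>j\<close> over \<open>j = 1, \<dots>, k\<close>, with \<open>j = k\<close> applied first.\<close>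

primrec comp_along ::
    "('l \<Rightarrow> nat \<Rightarrow> 'a \<Rightarrow> 'a) \<Rightarrow> (nat list \<Rightarrow> 'l) \<Rightarrow> nat list \<Rightarrow> nat list \<Rightarrow> 'a \<Rightarrow> 'a" where
  "comp_along g \<omega> \<rho> [] = id"
| "comp_along g \<omega> \<rho> (i # \<tau>) = g (\<omega> \<rho>) i \<circ> comp_along g \<omega> (\<rho> @ [i]) \<tau>"

section \<open>Translations and attractors\<close>

definition map_indices :: "('l \<Rightarrow> nat) \<Rightarrow> ('l \<times> nat) set" where
  "map_indices M = (SIGMA l:UNIV. {1..M l})"

text \<open>A translation vector assigns a vector to each equivalence class of \<open>R\<close>, i.e. it is an element
  of a product of copies of \<open>\<real>\<^sup>D\<close> indexed by the classes.\<close>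

type_synonym ('l, 'a) translation = "('l \<times> nat) set \<Rightarrow> 'a"

definition ifs_map :: "('l \<Rightarrow> nat \<Rightarrow> 'a \<Rightarrow> 'a) \<Rightarrow> ('l \<times> nat) rel \<Rightarrow> ('l, 'a) translation
    \<Rightarrow> 'l \<Rightarrow> nat \<Rightarrow> 'a::euclidean_space \<Rightarrow> 'a" where
  "ifs_map T R a l i x = T l i x + a (R `` {(l, i)})"

definition translation_lebesgue ::
    "('l \<Rightarrow> nat) \<Rightarrow> ('l \<times> nat) rel \<Rightarrow> ('l, 'a::euclidean_space) translation measure" where
  "translation_lebesgue M R = completion (\<Pi>\<^sub>M c \<in> map_indices M // R. lborel)"

definition projection :: "('l \<Rightarrow> nat \<Rightarrow> 'a \<Rightarrow> 'a) \<Rightarrow> ('l \<times> nat) rel \<Rightarrow> ('l, 'a) translation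
    \<Rightarrow> (nat list \<Rightarrow> 'l) \<Rightarrow> (nat \<Rightarrow> nat) \<Rightarrow> 'a::euclidean_space" where
  "projection T R a \<omega> u = lim (\<lambda>k. comp_along (ifs_map T R a) \<omega> [] (map u [0..<k]) 0)"

definition attractor :: "('l \<Rightarrow> nat) \<Rightarrow> ('l \<Rightarrow> nat \<Rightarrow> 'a \<Rightarrow> 'a) \<Rightarrow> ('l \<times> nat) rel
    \<Rightarrow> ('l, 'a) translation \<Rightarrow> (nat list \<Rightarrow> 'l) \<Rightarrow> 'a::euclidean_space set" where
  "attractor M T R a \<omega> = projection T R a \<omega> ` tree_boundary M \<omega>"

section \<open>Pressure\<close>

definition level_sum :: "('l \<Rightarrow> nat) \<Rightarrow> ('l \<Rightarrow> nat \<Rightarrow> 'a \<Rightarrow> 'a::euclidean_space)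
    \<Rightarrow> (nat list \<Rightarrow> 'l) \<Rightarrow> nat \<Rightarrow> real \<Rightarrow> real" where
  "level_sum M T \<omega> k \<alpha> =
     (\<Sum>\<tau> \<in> {\<tau> \<in> tree_words M \<omega>. length \<tau> = k}.
        singular_value_function \<alpha> (comp_along T \<omega> [] \<tau>))"

definition pressure_exists :: "('l \<Rightarrow> nat) \<Rightarrow> ('l \<Rightarrow> nat \<Rightarrow> 'a \<Rightarrow> 'a::euclidean_space)
    \<Rightarrow> (nat list \<Rightarrow> 'l) \<Rightarrow> real \<Rightarrow> bool" where
  "pressure_exists M T \<omega> \<alpha> \<longleftrightarrow> convergent (\<lambda>k. ln (level_sum M T \<omega> k \<alpha>) / real k)"

definition pressure :: "('l \<Rightarrow> nat) \<Rightarrow> ('l \<Rightarrow> nat \<Rightarrow> 'a \<Rightarrow> 'a::euclidean_space)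
    \<Rightarrow> (nat list \<Rightarrow> 'l) \<Rightarrow> real \<Rightarrow> real" where
  "pressure M T \<omega> \<alpha> = lim (\<lambda>k. ln (level_sum M T \<omega> k \<alpha>) / real k)"

section \<open>Neck levels\<close>

text \<open>Sequences of neck levels \<open>N\<^sub>1 < N\<^sub>2 < \<dots>\<close> of positive integers are extended by \<open>N\<^sub>0 = 0\<close>, so that
  the function argument is the index and positivity is part of strict monotonicity.\<close>

type_synonym 'l necked = "(nat list \<Rightarrow> 'l) \<times> (nat \<Rightarrow> nat)"

definition necked_trees :: "('l \<Rightarrow> nat) \<Rightarrow> 'l necked set" where
  "necked_trees M = {(\<omega>, N). \<omega> \<in> code_trees M \<and> N 0 = 0 \<and> strict_mono N \<and>
     (\<forall>m\<ge>1. \<forall>\<tau> \<tau>' \<rho>. length \<tau> = N m \<and> length \<tau>' = N m \<and>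
        \<tau> @ \<rho> \<in> tree_words M \<omega> \<and> \<tau>' \<in> tree_words M \<omega> \<longrightarrow>
        \<tau>' @ \<rho> \<in> tree_words M \<omega> \<and> \<omega> (\<tau> @ \<rho>) = \<omega> (\<tau>' @ \<rho>))}"

definition neck_shift :: "('l \<Rightarrow> nat) \<Rightarrow> 'l necked \<Rightarrow> 'l necked" where
  "neck_shift M = (\<lambda>(\<omega>, N).
     (\<lambda>\<rho>. \<omega> ((SOME \<tau>. \<tau> \<in> tree_words M \<omega> \<and> length \<tau> = N 1) @ \<rho>), \<lambda>m. N (m + 1) - N 1))"

definition neck_cylinder :: "('l \<Rightarrow> nat) \<Rightarrow> 'l necked \<Rightarrow> nat \<Rightarrow> 'l necked set" where
  "neck_cylinder M = (\<lambda>(\<omega>, N) m. {(\<omega>', N') \<in> necked_trees M.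
     (\<forall>i. 1 \<le> i \<and> i \<le> m \<longrightarrow> N' i = N i) \<and> (\<forall>\<tau>. length \<tau> < N m \<longrightarrow> \<omega>' \<tau> = \<omega> \<tau>)})"

definition neck_topology :: "('l \<Rightarrow> nat) \<Rightarrow> 'l necked topology" where
  "neck_topology M =
     topology_generated_by {neck_cylinder M x m | x m. x \<in> necked_trees M \<and> 1 \<le> m}"

definition neck_borel :: "('l \<Rightarrow> nat) \<Rightarrow> 'l necked measure" where
  "neck_borel M = sigma (necked_trees M) {U. openin (neck_topology M) U}"

section \<open>Invariant and ergodic measures\<close>

definition invariant_measure :: "'a measure \<Rightarrow> ('a \<Rightarrow> 'a) \<Rightarrow> bool" where
  "invariant_measure P f \<longleftrightarrow> (\<forall>A \<in> sets P. emeasure P (f -` A \<inter> space P) = emeasure P A)"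

definition ergodic_measure :: "'a measure \<Rightarrow> ('a \<Rightarrow> 'a) \<Rightarrow> bool" where
  "ergodic_measure P f \<longleftrightarrow>
     (\<forall>A \<in> sets P. f -` A \<inter> space P = A \<longrightarrow> emeasure P A = 0 \<or> emeasure P (space P - A) = 0)"

end

theory Submission
  imports Defs
begin

text \<open>
  For similarities the singular value function is a power of the contraction ratio, so level sums
  are multiplicative across neck levels. Birkhoff's theorem, applied to \<open>N\<^sub>1\<close> and to the logarithm of the
  first block sum, then gives the pressure for almost every tree, as a quotient of two expectations.

  The upper bound on the dimension comes from covering by the cylinders of a fixed level. For the
  lower bound, below the zero of the pressure, choose the blocks between successive necks
  independently, each with probability proportional to its ratio to the power \<open>t\<close>. The energy of
  the projected measure, averaged over a bounded set of translations, is finite: necks are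
  sparse enough (\<open>N\<^sub>m\<^sub>+\<^sub>1 - N\<^sub>m = o(m)\<close>) to be absorbed by the exponential growth of the level
  sums, and the averaging uses transversality. For two words separating at some level, the
  difference of the projections depends on the translations of the two separating classes; as the
  ratios are below \<open>1/2\<close>, later occurrences of these classes perturb the two derivatives by
  amounts of total norm less than \<open>2\<close>. One of the two derivatives is therefore perturbed by
  less than \<open>1\<close> and is invertible, with a uniform bound.
\<close>

text \<open>The index set may be uncountable, so labels carry no useful measurable structure. The
  ergodic theorem still applies because \<open>N 1\<close> and the first block sum are constant on
  cylinders of one neck level, so that preimages of arbitrary sets are open.

  Null sets shape the rest. The ergodic theorem gives one null set per exponent, so it is used for
  rational exponents only; weights at level k lie between \<open>lo ^ k\<close> and
  \<open>hi ^ k\<close>, and the resulting Lipschitz dependence on the exponent extends the limits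
  to all exponents at once. The same bounds make the limit strictly decreasing. For the
  translations, countably many dimensions and countably many boxes suffice.

  The lower bound uses exponents s < t below both the zero and D: t governs the measure and the
  transversality estimate, while the gap between s and t makes the dyadic energy series converge.
  Two words part somewhere inside a block, and the loss of \<open>lo powr (- t)\<close> for each
  level of that block must be summable against the level sums. There the integrability of
  \<open>N 1\<close> enters a second time.\<close>

section \<open>The ergodic theorem\<close>

lemma distr_invariant:
  assumes f: "f \<in> measurable P P" and inv: "invariant_measure P f"
  shows "distr P P f = P"
proof (rule measure_eqI)
  fix A assume "A \<in> sets (distr P P f)"
  with f inv show "emeasure (distr P P f) A = emeasure P A"
    by (simp add: emeasure_distr invariant_measure_def)
qed simp

context
  fixes P :: "'a measure" and f :: "'a \<Rightarrow> 'a"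
  assumes prob: "prob_space P"
    and f [measurable]: "f \<in> measurable P P"
    and inv: "invariant_measure P f"
    and erg: "ergodic_measure P f"
begin

lemma birkhoff_sum_measurable:
  assumes [measurable]: "(g::'a \<Rightarrow> real) \<in> borel_measurable P"
  shows "(\<lambda>x. \<Sum>i<n. g ((f ^^ i) x)) \<in> borel_measurable P"
proof -
  have [measurable]: "f ^^ i \<in> measurable P P" for i
    by (induction i) (auto intro: measurable_comp[OF _ f])
  show ?thesis by measurable
qed

lemma birkhoff_sum_Suc: "(\<Sum>i<Suc n. g ((f ^^ i) x)) = g x + (\<Sum>i<n. g ((f ^^ i) (f x)))" for g :: "'a \<Rightarrow> real"
  by (simp only: sum.lessThan_Suc_shift funpow_Suc_right o_apply funpow_0 power_0 id_apply)


text \<open>This is the maximum of the Birkhoff sums of lengths 0, ..., n. The recursion moves the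
  base point to \<open>f x\<close>, so the identity behind the maximal ergodic theorem holds by
  definition.\<close>

fun running_max :: "('a \<Rightarrow> real) \<Rightarrow> nat \<Rightarrow> 'a \<Rightarrow> real" where
  "running_max g 0 x = 0"
| "running_max g (Suc n) x = max 0 (g x + running_max g n (f x))"

lemma running_max_mono: "running_max g n x \<le> running_max g (Suc n) x"
proof (induction n arbitrary: x)
  case (Suc n)
  show ?case using Suc[of "f x"] by simp
qed simp

lemma running_max_nonneg: "0 \<le> running_max g n x"
  by (cases n) auto

lemma birkhoff_sum_le_running_max: "(\<Sum>i<n. g ((f ^^ i) x)) \<le> running_max g n x"
proof (induction n arbitrary: x)
  case (Suc n)
  show ?case using Suc[of "f x"] by (simp only: birkhoff_sum_Suc) simp
qed simp

lemma integrable_running_max: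
  assumes g: "integrable P g"
  shows "integrable P (running_max g n)"
proof (induction n)
  case 0
  then show ?case by simp
next
  case (Suc n)
  have "integrable (distr P P f) (running_max g n)"
    using Suc by (simp add: distr_invariant[OF f inv])
  then have "integrable P (\<lambda>x. running_max g n (f x))"
    by (subst (asm) integrable_distr_eq) (use Suc in auto)
  then have "integrable P (\<lambda>x. max 0 (g x + running_max g n (f x)))"
    using g by (intro integrable_max) auto
  then show ?case by (simp add: fun_eq_iff[symmetric] cong: integrable_cong)
qed

text \<open>The set where the sums are unbounded is invariant; were it of full measure, then
  \<open>running_max g (n + 1) - running_max g n \<circ> f\<close>, whose integral is nonnegative, would converge
  dominatedly to \<open>g\<close>.\<close>

lemma birkhoff_sums_bounded_above:
  fixes g :: "'a \<Rightarrow> real"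
  assumes g: "integrable P g" and neg: "integral\<^sup>L P g < 0"
  shows "AE x in P. \<exists>B. \<forall>n. (\<Sum>i<n. g ((f ^^ i) x)) \<le> B"
proof -
  interpret prob_space P by (rule prob)
  have [measurable]: "g \<in> borel_measurable P" using g by simp
  define S where "S n x = (\<Sum>i<n. g ((f ^^ i) x))" for n x
  have [measurable]: "S n \<in> borel_measurable P" for n
    unfolding S_def by (rule birkhoff_sum_measurable) simp
  define A where "A = {x \<in> space P. \<forall>b::nat. \<exists>n. real b < S n x}"
  have A_sets [measurable]: "A \<in> sets P" unfolding A_def by measurable
  have SSuc: "S (Suc n) x = g x + S n (f x)" for n x
    unfolding S_def by (rule birkhoff_sum_Suc)
  have A_iff: "f x \<in> A \<longleftrightarrow> x \<in> A" if x: "x \<in> space P" for x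
  proof
    have fx: "f x \<in> space P" by (rule measurable_space[OF f x])
    show "x \<in> A" if "f x \<in> A"
    proof -
      have "\<exists>n. real b < S n x" for b
      proof -
        obtain b' :: nat where "real b - g x < real b'" using reals_Archimedean2 by blast
        moreover from that obtain n where "real b' < S n (f x)" unfolding A_def by blast
        ultimately have "real b < S (Suc n) x" by (simp add: SSuc)
        then show ?thesis by blast
      qed
      with x show ?thesis by (simp add: A_def)
    qed
    show "f x \<in> A" if "x \<in> A"
    proof -
      have "\<exists>n. real b < S n (f x)" for b
      proof -
        obtain b' :: nat where b': "real b + \<bar>g x\<bar> < real b'" using reals_Archimedean2 by blast
        moreover from that obtain n where n: "real b' < S n x" unfolding A_def by blast
        then obtain k where "n = Suc k" by (cases n) (auto simp: S_def)
        ultimately have "real b < S k (f x)" using n by (simp add: SSuc)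
        then show ?thesis by blast
      qed
      with fx show ?thesis by (simp add: A_def)
    qed
  qed
  have "f -` A \<inter> space P = A"
    using A_iff by (auto simp: A_def)
  then have "emeasure P A = 0 \<or> emeasure P (space P - A) = 0"
    using erg A_sets unfolding ergodic_measure_def by blast
  moreover have False if "emeasure P (space P - A) = 0"
  proof -
    let ?D = "\<lambda>n x. indicator A x * (running_max g (Suc n) x - running_max g n (f x))"
    have rm: "integrable P (running_max g n)" for n by (rule integrable_running_max[OF g])
    have [measurable]: "running_max g n \<in> borel_measurable P" for n using rm by simp
    have irf: "integrable P (\<lambda>x. indicator A x * running_max g n (f x))"
      "integral\<^sup>L P (\<lambda>x. indicator A x * running_max g n (f x)) =
       integral\<^sup>L P (\<lambda>x. indicator A x * running_max g n x)" for n
    proof -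
      have i: "integrable P (\<lambda>x. indicator A x * running_max g n x)"
        using integrable_mult_indicator[OF A_sets rm[of n]] by simp
      then have "integrable (distr P P f) (\<lambda>x. indicator A x * running_max g n x)"
        by (simp add: distr_invariant[OF f inv])
      then have i': "integrable P (\<lambda>x. indicator A (f x) * running_max g n (f x))"
        by (subst (asm) integrable_distr_eq) auto
      have eq: "indicator A (f x) * running_max g n (f x)
          = indicator A x * running_max g n (f x)" if "x \<in> space P" for x
        using A_iff[OF that] by (simp add: indicator_def)
      show "integrable P (\<lambda>x. indicator A x * running_max g n (f x))"
        by (rule iffD1[OF Bochner_Integration.integrable_cong[OF refl eq] i'])
      have "integral\<^sup>L P (\<lambda>x. indicator A x * running_max g n x)
         = integral\<^sup>L (distr P P f) (\<lambda>x. indicator A x * running_max g n x)"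
        by (simp add: distr_invariant[OF f inv])
      also have "\<dots> = integral\<^sup>L P (\<lambda>x. indicator A (f x) * running_max g n (f x))"
        by (subst integral_distr) auto
      finally show "integral\<^sup>L P (\<lambda>x. indicator A x * running_max g n (f x)) =
       integral\<^sup>L P (\<lambda>x. indicator A x * running_max g n x)"
        using eq by (simp cong: Bochner_Integration.integral_cong)
    qed
    have nonneg: "0 \<le> integral\<^sup>L P (?D n)" for n
    proof -
      have i: "integrable P (\<lambda>x. indicator A x * running_max g n x)" for n
        using integrable_mult_indicator[OF A_sets rm[of n]] by simp
      have "integral\<^sup>L P (?D n) = integral\<^sup>L P (\<lambda>x. indicator A x * running_max g (Suc n) x)
        - integral\<^sup>L P (\<lambda>x. indicator A x * running_max g n (f x))"
        unfolding right_diff_distrib by (rule Bochner_Integration.integral_diff[OF i irf(1)])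
      \<comment> \<open>Invariance replaces \<open>running_max g n (f x)\<close> by
        \<open>running_max g n x\<close> under the integral over A, which leaves an increment of a
        monotone sequence.\<close>
      also have "\<dots> = integral\<^sup>L P (\<lambda>x. indicator A x * (running_max g (Suc n) x - running_max g n x))"
        unfolding irf(2) right_diff_distrib by (rule Bochner_Integration.integral_diff[symmetric, OF i i])
      also have "\<dots> \<ge> 0"
        using running_max_mono[of g n] by (intro integral_nonneg_AE AE_I2) (auto simp del: running_max.simps)
      finally show ?thesis .
    qed
    have lim: "(\<lambda>n. integral\<^sup>L P (?D n)) \<longlonglongrightarrow> integral\<^sup>L P (\<lambda>x. indicator A x * g x)"
    proof (rule integral_dominated_convergence[where w="\<lambda>x. \<bar>g x\<bar>"])
      show "AE x in P. (\<lambda>n. ?D n x) \<longlonglongrightarrow> indicator A x * g x"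
      proof (rule AE_I2)
        fix x assume x: "x \<in> space P"
        show "(\<lambda>n. ?D n x) \<longlonglongrightarrow> indicator A x * g x"
        proof (cases "x \<in> A")
          case True
          with A_iff[OF x] have "f x \<in> A" by simp
          obtain b :: nat where b: "- g x < real b" using reals_Archimedean2 by blast
          from \<open>f x \<in> A\<close> obtain n where "real b < S n (f x)" unfolding A_def by blast
          \<comment> \<open>Once the running maximum at \<open>f x\<close> exceeds
            \<open>- g x\<close>, the outer maximum with 0 is inactive and the difference equals
            \<open>g x\<close> exactly.\<close>
          then have n: "- g x < running_max g n (f x)"
            using birkhoff_sum_le_running_max[of g "f x" n] b by (simp add: S_def)
          have "- g x < running_max g m (f x)" if "n \<le> m" for m
            using lift_Suc_mono_le[of "\<lambda>n. running_max g n (f x)", OF running_max_mono that] n by linarith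
          then have "\<forall>\<^sub>F m in sequentially. ?D m x = indicator A x * g x"
            using True by (auto simp: eventually_sequentially intro!: exI[of _ n])
               (smt (verit))
          then show ?thesis by (rule tendsto_eventually)
        qed simp
      qed
      \<comment> \<open>If the maximum with 0 is active, then \<open>running_max g n (f x)\<close>
        is at most \<open>- g x\<close>, so the difference lies between \<open>g x\<close> and
        0.\<close>
      show "AE x in P. norm (?D n x) \<le> \<bar>g x\<bar>" for n
      proof (rule AE_I2)
        fix x show "norm (?D n x) \<le> \<bar>g x\<bar>"
          using running_max_nonneg[of g n "f x"] by (auto simp: indicator_def)
      qed
    qed (use g in auto)
    have "0 \<le> integral\<^sup>L P (\<lambda>x. indicator A x * g x)"
      by (rule LIMSEQ_le_const[OF lim]) (use nonneg in blast)
    also have "integral\<^sup>L P (\<lambda>x. indicator A x * g x) = integral\<^sup>L P g"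
    proof (rule integral_cong_AE)
      have "AE x in P. x \<in> A"
        by (rule AE_I'[of "space P - A"]) (use that in auto)
      then show "AE x in P. indicator A x * g x = g x" by eventually_elim simp
    qed auto
    finally show False using neg by simp
  qed
  ultimately have "emeasure P A = 0" by blast
  then have "AE x in P. x \<notin> A"
    by (intro AE_not_in) (simp add: null_sets_def)
  then show ?thesis
  proof (rule AE_mp, intro AE_I2 impI)
    fix x assume "x \<in> space P" "x \<notin> A"
    then have "\<exists>b::nat. \<forall>n. S n x \<le> real b" by (auto simp: A_def not_less)
    then show "\<exists>B. \<forall>n. (\<Sum>i<n. g ((f ^^ i) x)) \<le> B" unfolding S_def by blast
  qed
qed

text \<open>Subtracting a constant slightly above the mean gives a function of negative integral,
  whose sums are almost surely bounded above; division by n then bounds the averages. The mirrored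
  function bounds them from below. Margins of the form \<open>1 / Suc k\<close> keep the number of
  null sets countable.\<close>

theorem birkhoff_ergodic:
  fixes g :: "'a \<Rightarrow> real"
  assumes g: "integrable P g"
  shows "AE x in P. (\<lambda>n. (\<Sum>i<n. g ((f ^^ i) x)) / real n) \<longlonglongrightarrow> integral\<^sup>L P g"
proof -
  interpret prob_space P by (rule prob)
  define S where "S n x = (\<Sum>i<n. g ((f ^^ i) x))" for n x
  define I where "I = integral\<^sup>L P g"
  have up: "AE x in P. \<forall>k. \<exists>B. \<forall>n. S n x - real n * (I + 1 / Suc k) \<le> B"
  proof (subst AE_all_countable, rule allI)
    fix k
    have "AE x in P. \<exists>B. \<forall>n. (\<Sum>i<n. g ((f ^^ i) x) - (I + 1 / Suc k)) \<le> B"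
      using g by (intro birkhoff_sums_bounded_above) (auto simp: I_def prob_space)
    then show "AE x in P. \<exists>B. \<forall>n. S n x - real n * (I + 1 / Suc k) \<le> B"
      by (simp add: S_def sum_subtractf)
  qed
  have down: "AE x in P. \<forall>k. \<exists>B. \<forall>n. real n * (I - 1 / Suc k) - S n x \<le> B"
  proof (subst AE_all_countable, rule allI)
    fix k
    have "AE x in P. \<exists>B. \<forall>n. (\<Sum>i<n. (I - 1 / Suc k) - g ((f ^^ i) x)) \<le> B"
      using g by (intro birkhoff_sums_bounded_above) (auto simp: I_def prob_space)
    then show "AE x in P. \<exists>B. \<forall>n. real n * (I - 1 / Suc k) - S n x \<le> B"
      by (simp add: S_def sum_subtractf)
  qed
  from up down show ?thesis
  proof eventually_elim
    case (elim x)
    have "(\<lambda>n. S n x / real n) \<longlonglongrightarrow> I"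
    proof (rule LIMSEQ_I)
      fix e :: real assume "0 < e"
      then obtain k where k: "1 / Suc k < e / 2" using nat_approx_posE[of "e/2"] by auto
      obtain B where B: "\<And>n. S n x - real n * (I + 1 / Suc k) \<le> B" using elim(1) by blast
      obtain B' where B': "\<And>n. real n * (I - 1 / Suc k) - S n x \<le> B'" using elim(2) by blast
      obtain n0 :: nat where n0: "2 * max B B' / e < n0" using reals_Archimedean2 by blast
      have "norm (S n x / real n - I) < e" if n: "Suc n0 \<le> n" for n
      proof -
        have pos: "0 < real n" using n by linarith
        have "2 * max B B' / e < real n" using n n0 by linarith
        then have mB: "max B B' < real n * (e / 2)" using \<open>0 < e\<close> by (simp add: field_simps)
        have ke: "real n * (1 / Suc k) < real n * (e/2)" using k pos by (rule mult_strict_left_mono)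
        have "S n x - real n * I < real n * e"
          using B[of n] mB ke unfolding distrib_left right_diff_distrib by (simp add: distrib_left)
        moreover have "real n * I - S n x < real n * e"
          using B'[of n] mB ke unfolding distrib_left right_diff_distrib by (simp add: distrib_left)
        ultimately have "\<bar>S n x - real n * I\<bar> < real n * e" by linarith
        moreover have "S n x / real n - I = (S n x - real n * I) / real n"
          using pos by (simp add: field_simps)
        ultimately show ?thesis using pos by (simp add: field_simps abs_mult)
      qed
      then show "\<exists>no. \<forall>n\<ge>no. norm (S n x / real n - I) < e" by blast
    qed
    then show ?case by (simp add: S_def I_def)
  qed
qed

end

section \<open>Bounds on the Hausdorff dimension\<close>

lemma diam_power_empty [simp]: "diam_power s {} = 0"
  by (simp add: diam_power_def)

lemma hausdorff_premeasure_le_finite_cover: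
  assumes "finite I" "A \<subseteq> (\<Union>i\<in>I. U i)" "0 \<le> \<delta>"
    and U: "\<And>i. i \<in> I \<Longrightarrow> bounded (U i) \<and> diameter (U i) \<le> \<delta>"
  shows "hausdorff_premeasure s \<delta> A \<le> (\<Sum>i\<in>I. diam_power s (U i))"
proof -
  obtain h where h: "bij_betw h {0..<card I} I"
    using ex_bij_betw_nat_finite[OF \<open>finite I\<close>] by blast
  \<comment> \<open>Padding with empty sets contributes 0 for every exponent, including 0.\<close>
  define V where "V n = (if n < card I then U (h n) else {})" for n
  have hI: "h n \<in> I" if "n < card I" for n using h that by (auto simp: bij_betw_def)
  have "A \<subseteq> (\<Union>n. V n)"
  proof
    fix x assume "x \<in> A"
    then obtain i where "i \<in> I" "x \<in> U i" using assms(2) by blast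
    moreover then obtain n where "n < card I" "h n = i" using h by (force simp: bij_betw_def)
    ultimately show "x \<in> (\<Union>n. V n)" by (auto simp: V_def intro!: exI[of _ n])
  qed
  moreover have "bounded (V n) \<and> diameter (V n) \<le> \<delta>" for n
    using U[OF hI] \<open>0 \<le> \<delta>\<close> by (simp add: V_def)
  ultimately have "hausdorff_premeasure s \<delta> A \<le> (\<Sum>n. diam_power s (V n))"
    unfolding hausdorff_premeasure_def by (intro INF_lower) auto
  also have "\<dots> = (\<Sum>n\<in>{0..<card I}. diam_power s (V n))"
    by (rule suminf_finite) (auto simp: V_def)
  also have "\<dots> = (\<Sum>n\<in>{0..<card I}. diam_power s (U (h n)))"
    by (rule sum.cong) (auto simp: V_def)
  also have "\<dots> = (\<Sum>i\<in>I. diam_power s (U i))"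
    by (rule sum.reindex_bij_betw[OF h])
  finally show ?thesis .
qed

lemma hausdorff_measure_eq_0I:
  assumes "\<And>\<delta> \<epsilon>. 0 < \<delta> \<Longrightarrow> 0 < \<epsilon> \<Longrightarrow> hausdorff_premeasure s \<delta> A \<le> ennreal \<epsilon>"
  shows "hausdorff_measure s A = 0"
proof -
  have "hausdorff_premeasure s \<delta> A = 0" if "0 < \<delta>" for \<delta>
  proof -
    have "hausdorff_premeasure s \<delta> A \<le> 0"
      by (rule ennreal_le_epsilon) (use assms[OF that] in auto)
    then show ?thesis by simp
  qed
  then show ?thesis by (simp add: hausdorff_measure_def)
qed

lemma hausdorff_dim_leI:
  assumes "\<And>s. t < s \<Longrightarrow> hausdorff_measure s A = 0" "0 \<le> t"
  shows "hausdorff_dim A \<le> ereal t"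
proof (rule ereal_le_epsilon2)
  fix e :: real assume "0 < e"
  then show "hausdorff_dim A \<le> ereal t + ereal e"
    unfolding hausdorff_dim_def using assms by (intro Inf_lower) auto
qed

lemma diam_power_le:
  assumes "bounded U" "diameter U \<le> d" "0 < s"
  shows "diam_power s U \<le> ennreal (d powr s)"
  using powr_mono2[OF _ diameter_ge_0[OF assms(1)] assms(2), of s] assms(3)
  by (simp add: diam_power_def ennreal_leI)

text \<open>A grid of mesh 1/n covers the set by at most a constant times n^D cells. Each has
  diameter at most D/n, by comparison with the l1 norm, and the total n^(D - s) tends to 0.\<close>

lemma hausdorff_measure_bounded_eq_0:
  fixes A :: "'a::euclidean_space set"
  assumes A: "bounded A" and s: "real DIM('a) < s"
  shows "hausdorff_measure s A = 0"
proof (rule hausdorff_measure_eq_0I)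
  fix \<delta> \<epsilon> :: real assume "0 < \<delta>" "0 < \<epsilon>"
  let ?D = "DIM('a)"
  have s0: "0 < s" using s by linarith
  obtain R0 where R0: "\<And>x. x \<in> A \<Longrightarrow> norm x \<le> R0" using A by (auto simp: bounded_iff)
  obtain R :: nat where R: "max 1 R0 < real R" using reals_Archimedean2 by blast
  have nR: "norm x \<le> real R" if "x \<in> A" for x using R0[OF that] R by linarith
  have R1: "1 \<le> R" using R by linarith
  define cell :: "nat \<Rightarrow> ('a \<Rightarrow> int) \<Rightarrow> 'a set"
    where "cell n g = {x \<in> A. \<forall>b\<in>Basis. \<lfloor>real n * (x \<bullet> b)\<rfloor> = g b}" for n g
  define G where "G n = (PiE (Basis::'a set) (\<lambda>_. {- int (n * R)..int (n * R)}))" for n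
  have fin: "finite (G n)" for n unfolding G_def by (intro finite_PiE) auto
  have card: "real (card (G n)) \<le> (3 * real n * real R) powr ?D" if "1 \<le> n" for n
  proof -
    have "1 \<le> n * R" using that R1 by (simp add: Suc_le_eq)
    then have le: "2 * (n * R) + 1 \<le> 3 * (n * R)" by linarith
    have "card (G n) = (2 * (n * R) + 1) ^ ?D"
      unfolding G_def by (subst card_PiE) (auto simp: nat_add_distrib nat_mult_distrib mult.commute[of R])
    also have "\<dots> \<le> (3 * (n * R)) ^ ?D" using le by (rule power_mono) simp
    finally have "real (card (G n)) \<le> real ((3 * (n * R)) ^ ?D)" by (rule of_nat_mono)
    also have "\<dots> = (3 * real n * real R) powr ?D"
      using that R1 by (subst powr_realpow) (auto simp: mult.assoc)
    finally show ?thesis .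
  qed
  have cover: "A \<subseteq> (\<Union>g\<in>G n. cell n g)" for n
  proof
    fix x assume x: "x \<in> A"
    define g where "g = (\<lambda>b\<in>Basis. \<lfloor>real n * (x \<bullet> b)\<rfloor>)"
    have "\<bar>real n * (x \<bullet> b)\<bar> \<le> real (n * R)" if "b \<in> Basis" for b
      using Basis_le_norm[OF that, of x] nR[OF x] by (simp add: abs_mult mult_left_mono)
    then have "\<lfloor>real n * (x \<bullet> b)\<rfloor> \<in> {- int (n * R)..int (n * R)}" if "b \<in> Basis" for b
    proof -
      assume *: "\<And>b. b \<in> Basis \<Longrightarrow> \<bar>real n * (x \<bullet> b)\<bar> \<le> real (n * R)"
      have "- real (n * R) \<le> real n * (x \<bullet> b)" "real n * (x \<bullet> b) \<le> real (n * R)"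
        using *[OF that] by linarith+
      then have "- int (n * R) \<le> \<lfloor>real n * (x \<bullet> b)\<rfloor>" "\<lfloor>real n * (x \<bullet> b)\<rfloor> \<le> int (n * R)"
        by (simp_all add: le_floor_iff floor_le_iff)
      then show ?thesis by simp
    qed
    then have "g \<in> G n" unfolding G_def g_def by (auto intro!: PiE_I)
    moreover have "x \<in> cell n g" using x by (simp add: cell_def g_def)
    ultimately show "x \<in> (\<Union>g\<in>G n. cell n g)" by blast
  qed
  have bdd: "bounded (cell n g)" for n g
    by (rule bounded_subset[OF A]) (auto simp: cell_def)
  have diam: "diameter (cell n g) \<le> ?D / real n" if "1 \<le> n" for n g
  proof (rule diameter_le)
    fix x y assume xy: "x \<in> cell n g" "y \<in> cell n g"
    have "\<bar>(x - y) \<bullet> b\<bar> \<le> 1 / real n" if b: "b \<in> Basis" for b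
    proof -
      have "\<lfloor>real n * (x \<bullet> b)\<rfloor> = \<lfloor>real n * (y \<bullet> b)\<rfloor>" using xy b by (simp add: cell_def)
      then have "\<bar>real n * (x \<bullet> b) - real n * (y \<bullet> b)\<bar> \<le> 1" by linarith
      then have "real n * \<bar>(x - y) \<bullet> b\<bar> \<le> 1"
        by (simp add: inner_diff_left right_diff_distrib[symmetric] abs_mult)
      then show ?thesis using \<open>1 \<le> n\<close> by (simp add: field_simps)
    qed
    then have "(\<Sum>b\<in>Basis. \<bar>(x - y) \<bullet> b\<bar>) \<le> (\<Sum>b\<in>(Basis::'a set). 1 / real n)"
      by (rule sum_mono)
    then show "norm (x - y) \<le> ?D / real n" using norm_le_l1[of "x - y"] by simp
  qed simp
  define C where "C = (3 * real R) powr ?D * real ?D powr s"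
  have C0: "0 \<le> C" by (simp add: C_def)
  have bound: "hausdorff_premeasure s \<delta> A \<le> ennreal (C * real n powr (?D - s))"
    if n: "1 \<le> n" "?D / real n \<le> \<delta>" for n
  proof -
    have "hausdorff_premeasure s \<delta> A \<le> (\<Sum>g\<in>G n. diam_power s (cell n g))"
      using \<open>0 < \<delta>\<close> bdd order_trans[OF diam[OF n(1)] n(2)]
      by (intro hausdorff_premeasure_le_finite_cover fin cover) auto
    also have "\<dots> \<le> (\<Sum>g\<in>G n. ennreal ((?D / real n) powr s))"
      using bdd diam[OF n(1)] s0 by (intro sum_mono diam_power_le)
    also have "\<dots> = ennreal (card (G n) * (?D / real n) powr s)"
      by (simp add: ennreal_mult ennreal_of_nat_eq_real_of_nat)
    also have "\<dots> \<le> ennreal ((3 * real n * real R) powr ?D * (?D / real n) powr s)"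
      using card[OF n(1)] by (intro ennreal_leI mult_right_mono) auto
    also have "(3 * real n * real R) powr ?D * (?D / real n) powr s = C * real n powr (?D - s)"
      using n(1) R1 by (simp add: C_def powr_mult powr_divide powr_diff)
    finally show ?thesis .
  qed
  have "(\<lambda>n. C * real n powr (?D - s)) \<longlonglongrightarrow> C * 0"
    using s by (intro tendsto_mult tendsto_const tendsto_neg_powr filterlim_real_sequentially) auto
  then have "\<forall>\<^sub>F n in sequentially. C * real n powr (?D - s) < \<epsilon>"
    using \<open>0 < \<epsilon>\<close> by (intro order_tendstoD(2)) auto
  moreover have "\<forall>\<^sub>F n in sequentially. ?D / real n \<le> \<delta>"
  proof -
    have "(\<lambda>n. ?D / real n) \<longlonglongrightarrow> 0" by (rule lim_const_over_n)
    then have "\<forall>\<^sub>F n in sequentially. ?D / real n < \<delta>" using \<open>0 < \<delta>\<close> by (rule order_tendstoD(2))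
    then show ?thesis by eventually_elim simp
  qed
  ultimately have "\<forall>\<^sub>F n in sequentially. C * real n powr (?D - s) < \<epsilon> \<and> ?D / real n \<le> \<delta> \<and> 1 \<le> n"
    using eventually_ge_at_top[of 1] by eventually_elim simp
  then obtain n where "C * real n powr (?D - s) < \<epsilon>" "?D / real n \<le> \<delta>" "1 \<le> n"
    using eventually_happens[of _ sequentially] by (auto simp: trivial_limit_sequentially)
  then show "hausdorff_premeasure s \<delta> A \<le> ennreal \<epsilon>"
    using bound[of n] by (meson ennreal_leI less_imp_le order_trans)
qed

text \<open>The double integral is a dyadic version of the \<open>s\<close>-energy of the image of \<open>\<nu>\<close> under \<open>Z\<close>.\<close>

lemma hausdorff_dim_ge_energy:
  fixes Z :: "'b \<Rightarrow> 'a::euclidean_space"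
  assumes "prob_space \<nu>" and Z [measurable]: "Z \<in> borel_measurable \<nu>"
    and ZA: "AE x in \<nu>. Z x \<in> A" and s: "0 < s"
    and energy: "(\<Sum>n. ennreal (2 powr (real n * s)) *
      (\<integral>\<^sup>+x. \<integral>\<^sup>+y. indicator {..(1/2)^n} (dist (Z x) (Z y)) \<partial>\<nu> \<partial>\<nu>)) < \<infinity>"
  shows "ereal s \<le> hausdorff_dim A"
proof -
  interpret prob_space \<nu> by fact
  define p where "p x d = measure \<nu> {y \<in> space \<nu>. dist (Z x) (Z y) \<le> d}" for x d
  define \<phi> where "\<phi> x = (\<Sum>n. ennreal (2 powr (real n * s)) *
      (\<integral>\<^sup>+y. indicator {..(1/2)^n} (dist (Z x) (Z y)) \<partial>\<nu>))" for x
  have [measurable]: "\<phi> \<in> borel_measurable \<nu>" unfolding \<phi>_def by measurable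
  have inner: "(\<integral>\<^sup>+y. indicator {..d} (dist (Z x) (Z y)) \<partial>\<nu>) = ennreal (p x d)" for x d
  proof -
    have "(\<integral>\<^sup>+y. indicator {..d} (dist (Z x) (Z y)) \<partial>\<nu>)
        = (\<integral>\<^sup>+y. indicator {y \<in> space \<nu>. dist (Z x) (Z y) \<le> d} y \<partial>\<nu>)"
      by (rule nn_integral_cong) (simp add: indicator_def)
    also have "\<dots> = emeasure \<nu> {y \<in> space \<nu>. dist (Z x) (Z y) \<le> d}"
      by (rule nn_integral_indicator) measurable
    finally show ?thesis by (simp add: p_def emeasure_eq_measure)
  qed
  have "(\<integral>\<^sup>+x. \<phi> x \<partial>\<nu>) < \<infinity>"
  proof -
    have "(\<integral>\<^sup>+x. \<phi> x \<partial>\<nu>) = (\<Sum>n. \<integral>\<^sup>+x. ennreal (2 powr (real n * s)) *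
      (\<integral>\<^sup>+y. indicator {..(1/2)^n} (dist (Z x) (Z y)) \<partial>\<nu>) \<partial>\<nu>)"
      unfolding \<phi>_def by (rule nn_integral_suminf) measurable
    also have "\<dots> = (\<Sum>n. ennreal (2 powr (real n * s)) *
      (\<integral>\<^sup>+x. \<integral>\<^sup>+y. indicator {..(1/2)^n} (dist (Z x) (Z y)) \<partial>\<nu> \<partial>\<nu>))"
      by (subst nn_integral_cmult) auto
    finally show ?thesis using energy by simp
  qed
  then have \<phi>fin: "AE x in \<nu>. \<phi> x \<noteq> \<infinity>" by (intro nn_integral_PInf_AE) auto
  obtain N where N: "N \<in> null_sets \<nu>" "{x \<in> space \<nu>. Z x \<notin> A} \<subseteq> N"
    using AE_E[OF ZA] by (metis (no_types, lifting) null_setsI)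
  have [measurable]: "N \<in> sets \<nu>" using N by auto
  \<comment> \<open>On \<open>E K\<close> the potential is at most K, which controls the mass near
    \<open>Z x\<close> at every dyadic scale; removing N discards the points mapped outside A. Since
    the potential is almost surely finite, some \<open>E K\<close> has positive mass.\<close>
  define E where "E K = {x \<in> space \<nu>. \<phi> x \<le> of_nat K} - N" for K :: nat
  have [measurable]: "E K \<in> sets \<nu>" for K unfolding E_def by measurable
  have "\<exists>K. E K \<notin> null_sets \<nu>"
  proof (rule ccontr)
    assume "\<not> ?thesis"
    then have "(\<Union>K. E K) \<in> null_sets \<nu>" by auto
    then have "AE x in \<nu>. x \<notin> (\<Union>K. E K)" by (rule AE_not_in)
    with \<phi>fin AE_not_in[OF N(1)] AE_space have "AE x in \<nu>. False"
    proof eventually_elim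
      case (elim x)
      obtain r where "\<phi> x = ennreal r" "0 \<le> r" using elim(1) by (cases "\<phi> x") auto
      moreover obtain K :: nat where "r \<le> real K" using real_arch_simple by blast
      ultimately have "\<phi> x \<le> of_nat K" by (simp add: ennreal_of_nat_eq_real_of_nat)
      with elim show False by (auto simp: E_def)
    qed
    then show False by simp
  qed
  then obtain K where K: "emeasure \<nu> (E K) \<noteq> 0" by (auto simp: null_sets_def)
  have p_dyadic: "2 powr (real n * s) * p x ((1/2)^n) \<le> real K" if "x \<in> E K" for x n
  proof -
    have "ennreal (2 powr (real n * s)) * ennreal (p x ((1/2)^n)) \<le> \<phi> x"
      unfolding \<phi>_def inner
      using sum_le_suminf[OF summableI, of "{n}" "\<lambda>n. ennreal (2 powr (real n * s)) * ennreal (p x ((1/2)^n))"]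
      by simp
    also have "\<dots> \<le> ennreal (real K)" using that by (simp add: E_def ennreal_of_nat_eq_real_of_nat)
    finally show ?thesis by (simp add: ennreal_mult[symmetric] p_def)
  qed
  have pow_half: "2 powr (real n * s) = ((1/2)^n) powr (- s)" for n
    by (simp add: powr_realpow[symmetric] powr_powr powr_divide powr_minus_divide power_one_over)
  have p_mono: "p x d \<le> p x d'" if "d \<le> d'" for x d d'
    unfolding p_def by (rule finite_measure_mono) (use that in auto)
  \<comment> \<open>A radius d is rounded up to a power of 1/2 that is below \<open>2 * d\<close>,
    at the cost of a factor \<open>2 powr s\<close>.\<close>
  define C where "C = real K * 2 powr s"
  have C0: "0 \<le> C" by (simp add: C_def)
  have p_le: "p x d \<le> C * d powr s" if x: "x \<in> E K" and d: "0 \<le> d" "d \<le> 1" for x d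
  proof (cases "d = 0")
    case True
    have "p x 0 \<le> 0"
    proof (rule LIMSEQ_le_const)
      show "(\<lambda>n. real K * ((1/2)^n) powr s) \<longlonglongrightarrow> 0"
        using s by (auto intro!: tendsto_mult_right_zero tendsto_zero_powrI[where b=s] LIMSEQ_power_zero)
      have "p x 0 \<le> real K * ((1/2)^n) powr s" for n
        using p_mono[of 0 "(1/2)^n" x] p_dyadic[OF x, of n] unfolding pow_half
        by (simp add: powr_minus field_simps)
      then show "\<exists>N. \<forall>n\<ge>N. p x 0 \<le> real K * ((1/2)^n) powr s" by blast
    qed
    then show ?thesis using True by simp
  next
    case False
    with d have "0 < d" by simp
    have "\<exists>n. (1/2::real)^n < d" using real_arch_pow_inv[OF \<open>0 < d\<close>, of "1/2"] by simp
    then have lt: "(1/2::real)^(LEAST n. (1/2::real)^n < d) < d" by (rule LeastI_ex)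
    then have "(LEAST n. (1/2::real)^n < d) \<noteq> 0" using d by (intro notI) simp
    then obtain n where n: "(LEAST n. (1/2::real)^n < d) = Suc n" by (meson not0_implies_Suc)
    have le: "d \<le> (1/2)^n" using not_less_Least[of n "\<lambda>n. (1/2::real)^n < d"] n by simp
    have "p x d \<le> p x ((1/2)^n)" by (rule p_mono[OF le])
    also have "\<dots> \<le> real K * ((1/2)^n) powr s"
      using p_dyadic[OF x, of n] unfolding pow_half by (simp add: powr_minus field_simps)
    also have "\<dots> \<le> real K * (2 * d) powr s"
      using lt s unfolding n by (intro mult_left_mono powr_mono2) auto
    finally show ?thesis using d by (simp add: C_def powr_mult mult.assoc)
  qed
  have nonzero: "hausdorff_measure s' A \<noteq> 0" if s': "0 \<le> s'" "s' \<le> s" for s'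
  proof
    assume H0: "hausdorff_measure s' A = 0"
    have "emeasure \<nu> (E K) \<le> ennreal C * (\<Sum>n. diam_power s' (U n))"
      if U: "A \<subseteq> (\<Union>n. U n)" "\<forall>n. bounded (U n) \<and> diameter (U n) \<le> 1" for U :: "nat \<Rightarrow> 'a set"
    proof -
      define J where "J = {n. \<exists>x\<in>E K. Z x \<in> U n}"
      \<comment> \<open>The density bound holds only at points of \<open>E K\<close>. Each covering
        set that meets the image of \<open>E K\<close> is therefore replaced by a ball centred at
        such an image point, with the diameter of the covering set as its radius.\<close>
      define c where "c n = (SOME x. x \<in> E K \<and> Z x \<in> U n)" for n
      have c: "c n \<in> E K" "Z (c n) \<in> U n" if "n \<in> J" for n
        using someI_ex[of "\<lambda>x. x \<in> E K \<and> Z x \<in> U n"] that by (auto simp: J_def c_def)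
      define V where "V n = (if n \<in> J then {y \<in> space \<nu>. dist (Z (c n)) (Z y) \<le> diameter (U n)} else {})" for n
      have [measurable]: "V n \<in> sets \<nu>" for n by (cases "n \<in> J") (simp_all add: V_def)
      have "E K \<subseteq> (\<Union>n. V n)"
      proof
        fix x assume x: "x \<in> E K"
        then have "Z x \<in> A" "x \<in> space \<nu>" using N(2) by (auto simp: E_def)
        then obtain n where n: "Z x \<in> U n" using U(1) by blast
        with x have "n \<in> J" by (auto simp: J_def)
        with n U(2) c(2)[of n] have "dist (Z (c n)) (Z x) \<le> diameter (U n)"
          by (auto intro: diameter_bounded_bound)
        with \<open>n \<in> J\<close> \<open>x \<in> space \<nu>\<close> show "x \<in> (\<Union>n. V n)" by (auto simp: V_def intro!: exI[of _ n])
      qed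
      then have "emeasure \<nu> (E K) \<le> emeasure \<nu> (\<Union>n. V n)" by (rule emeasure_mono) measurable
      also have "\<dots> \<le> (\<Sum>n. emeasure \<nu> (V n))" by (rule emeasure_subadditive_countably) auto
      also have "\<dots> \<le> (\<Sum>n. ennreal C * diam_power s' (U n))"
      proof (rule suminf_le[OF _ summableI summableI])
        fix n
        show "emeasure \<nu> (V n) \<le> ennreal C * diam_power s' (U n)"
        proof (cases "n \<in> J")
          case True
          have d: "0 \<le> diameter (U n)" "diameter (U n) \<le> 1" using U(2) diameter_ge_0 by auto
          have ne: "U n \<noteq> {}" using c[OF True] by auto
          have "emeasure \<nu> (V n) = ennreal (p (c n) (diameter (U n)))"
            using True by (simp add: V_def p_def emeasure_eq_measure)
          also have "\<dots> \<le> ennreal (C * diameter (U n) powr s)"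
            by (intro ennreal_leI p_le c True d)
          also have "\<dots> = ennreal C * ennreal (diameter (U n) powr s)" using C0 by (simp add: ennreal_mult)
          also have "\<dots> \<le> ennreal C * diam_power s' (U n)"
          proof (rule mult_left_mono)
            have "diameter (U n) powr s \<le> (if s' = 0 then 1 else diameter (U n) powr s')"
              using d s s' by (cases "diameter (U n) = 0") (auto intro!: powr_le1 powr_mono')
            then show "ennreal (diameter (U n) powr s) \<le> diam_power s' (U n)"
              using ne by (auto simp: diam_power_def ennreal_leI)
          qed simp
          finally show ?thesis .
        qed (simp add: V_def)
      qed
      finally show ?thesis by simp
    qed
    note cover = this
    define q where "q = measure \<nu> (E K)"
    have q: "emeasure \<nu> (E K) = ennreal q" "0 < q"
      using K by (auto simp: q_def emeasure_eq_measure zero_less_measure_iff)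
    have "hausdorff_premeasure s' 1 A \<le> hausdorff_measure s' A"
      unfolding hausdorff_measure_def by (rule SUP_upper) simp
    \<comment> \<open>A cover with this small a sum would give q <= C * q / (C + 1) < q. The added 1
      keeps the quotient meaningful for C = 0.\<close>
    then have "hausdorff_premeasure s' 1 A < ennreal (q / (C + 1))"
      using H0 q C0 by (auto simp: ennreal_less_iff)
    then obtain U where U: "A \<subseteq> (\<Union>n. U n)" "\<forall>n. bounded (U n) \<and> diameter (U n) \<le> 1"
      and sum: "(\<Sum>n. diam_power s' (U n)) < ennreal (q / (C + 1))"
      unfolding hausdorff_premeasure_def INF_less_iff by blast
    have "ennreal q \<le> ennreal C * (\<Sum>n. diam_power s' (U n))" using cover[OF U] q by simp
    also have "\<dots> \<le> ennreal C * ennreal (q / (C + 1))"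
      using sum by (intro mult_left_mono) auto
    also have "\<dots> = ennreal (C * (q / (C + 1)))" using C0 q by (subst ennreal_mult) auto
    finally have "q \<le> C * (q / (C + 1))" using C0 q by (simp add: ennreal_le_iff)
    then show False using C0 q by (simp add: field_simps)
  qed
  show ?thesis
    unfolding hausdorff_dim_def
  proof (rule Inf_greatest)
    fix z assume "z \<in> {ereal s |s. 0 \<le> s \<and> hausdorff_measure s A = 0}"
    then show "ereal s \<le> z" using nonzero by (force simp: not_le)
  qed
qed

section \<open>Similarities and their singular values\<close>

text \<open>Polarization: norms of sums determine inner products.\<close>

lemma inner_linear_similarity:
  fixes S :: "'a::euclidean_space \<Rightarrow> 'a"
  assumes S: "linear S" and norm: "\<And>x. norm (S x) = c * norm x"
  shows "S x \<bullet> S y = c\<^sup>2 * (x \<bullet> y)"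
proof -
  have "(norm (S (x + y)))\<^sup>2 = c\<^sup>2 * (norm (x + y))\<^sup>2" for x y
    by (simp add: norm power_mult_distrib)
  then have "(S x + S y) \<bullet> (S x + S y) = c\<^sup>2 * ((x + y) \<bullet> (x + y))" for x y
    by (simp add: power2_norm_eq_inner linear_add[OF S])
  from this[of x y] this[of x 0] this[of y 0] show ?thesis
    using linear_0[OF S] by (simp add: inner_add inner_commute algebra_simps)
qed

text \<open>Composing S with its adjoint gives multiplication by c^2, so c^2 is the only eigenvalue
  and its eigenspace is everything.\<close>

lemma singular_values_similarity:
  fixes S :: "'a::euclidean_space \<Rightarrow> 'a"
  assumes S: "linear S" and norm: "\<And>x. norm (S x) = c * norm x" and c: "0 < c"
  shows "singular_values S = replicate DIM('a) c"
proof -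
  have adj: "adjoint S (S x) = c\<^sup>2 *\<^sub>R x" for x
  proof -
    have "adjoint S (S x) \<bullet> y = (c\<^sup>2 *\<^sub>R x) \<bullet> y" for y
      using adjoint_works[OF S, of y "S x"] inner_linear_similarity[OF S norm, of x y]
      by (simp add: inner_commute)
    then show ?thesis by (rule iffD1[OF vector_eq_rdot, OF allI])
  qed
  obtain x0 :: 'a where x0: "x0 \<noteq> 0" using nonempty_Basis nonzero_Basis by blast
  have "{t. \<exists>x. x \<noteq> 0 \<and> adjoint S (S x) = t *\<^sub>R x} = {c\<^sup>2}"
    using x0 by (auto simp: adj)
  moreover have "{x. adjoint S (S x) = c\<^sup>2 *\<^sub>R x} = UNIV" by (simp add: adj)
  ultimately show ?thesis using c by (simp add: singular_values_def)
qed

lemma singular_value_similarity: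
  fixes S :: "'a::euclidean_space \<Rightarrow> 'a"
  assumes "linear S" "\<And>x. norm (S x) = c * norm x" "0 < c" "1 \<le> i" "i \<le> DIM('a)"
  shows "singular_value i S = c"
  using assms singular_values_similarity[OF assms(1-3)] by (simp add: singular_value_def)

lemma singular_value_function_similarity:
  fixes S :: "'a::euclidean_space \<Rightarrow> 'a"
  assumes S: "linear S" and norm: "\<And>x. norm (S x) = c * norm x" and c: "0 < c"
  shows "singular_value_function \<alpha> S = c powr \<alpha>"
proof -
  define m where "m = (if \<alpha> < real DIM('a) then nat \<lfloor>\<alpha>\<rfloor> + 1 else DIM('a))"
  \<comment> \<open>The index has to stay within 1, ..., D, since the list lookup in
    \<open>singular_value\<close> says nothing outside this range.\<close>
  have "nat \<lfloor>\<alpha>\<rfloor> + 1 \<le> DIM('a)" if "\<alpha> < real DIM('a)"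
  proof -
    have "\<lfloor>\<alpha>\<rfloor> < int DIM('a)" using that by (simp add: floor_less_iff)
    then show ?thesis using DIM_positive[where 'a='a] by linarith
  qed
  then have m: "1 \<le> m" "m \<le> DIM('a)"
    using DIM_positive[where 'a='a] by (auto simp: m_def Suc_le_eq)
  have "singular_value_function \<alpha> S = (\<Prod>i\<in>{1..<m}. singular_value i S) * singular_value m S powr (\<alpha> - real m + 1)"
    by (simp add: singular_value_function_def m_def Let_def)
  also have "(\<Prod>i\<in>{1..<m}. singular_value i S) = (\<Prod>i\<in>{1..<m}. c)"
    using m by (intro prod.cong refl singular_value_similarity[OF S norm c]) auto
  also have "singular_value m S = c" by (rule singular_value_similarity[OF S norm c m])
  also have "(\<Prod>i\<in>{1..<m}. c) = c powr (real m - 1)"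
    using m c by (simp add: powr_realpow[symmetric] of_nat_diff)
  finally show ?thesis using c by (simp add: powr_add[symmetric])
qed

section \<open>Code trees and necks\<close>

definition subtree :: "(nat list \<Rightarrow> 'l) \<Rightarrow> nat list \<Rightarrow> nat list \<Rightarrow> 'l" where
  "subtree \<omega> \<rho> = (\<lambda>\<tau>. \<omega> (\<rho> @ \<tau>))"

lemma subtree_Nil [simp]: "subtree \<omega> [] = \<omega>"
  by (simp add: subtree_def)

lemma subtree_subtree: "subtree (subtree \<omega> \<rho>) \<tau> = subtree \<omega> (\<rho> @ \<tau>)"
  by (simp add: subtree_def)

lemma subtree_at_Nil [simp]: "subtree \<omega> \<rho> [] = \<omega> \<rho>"
  by (simp add: subtree_def)

lemma tree_words_snoc: "\<tau> @ [l] \<in> tree_words M \<omega> \<longleftrightarrow> \<tau> \<in> tree_words M \<omega> \<and> l \<in> {1..M (\<omega> \<tau>)}"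
  by (auto elim: tree_words.cases intro: tree_words.extend)

lemma tree_words_append:
  "\<rho> @ \<tau> \<in> tree_words M \<omega> \<longleftrightarrow> \<rho> \<in> tree_words M \<omega> \<and> \<tau> \<in> tree_words M (subtree \<omega> \<rho>)"
proof (induction \<tau> rule: rev_induct)
  case Nil
  then show ?case by (simp add: tree_words.empty)
next
  case (snoc l \<tau>)
  have "\<rho> @ \<tau> @ [l] \<in> tree_words M \<omega> \<longleftrightarrow> \<rho> @ \<tau> \<in> tree_words M \<omega> \<and> l \<in> {1..M (\<omega> (\<rho> @ \<tau>))}"
    using tree_words_snoc[of "\<rho> @ \<tau>"] by simp
  with snoc show ?case by (auto simp: tree_words_snoc subtree_def)
qed

lemma tree_words_Cons:
  "i # \<tau> \<in> tree_words M \<omega> \<longleftrightarrow> i \<in> {1..M (\<omega> [])} \<and> \<tau> \<in> tree_words M (subtree \<omega> [i])"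
  using tree_words_append[of "[i]" \<tau> M \<omega>] tree_words_snoc[of "[]" i M \<omega>]
  by (simp add: tree_words.empty)

definition level :: "('l \<Rightarrow> nat) \<Rightarrow> (nat list \<Rightarrow> 'l) \<Rightarrow> nat \<Rightarrow> nat list set" where
  "level M \<omega> k = {\<tau> \<in> tree_words M \<omega>. length \<tau> = k}"

lemma level_0 [simp]: "level M \<omega> 0 = {[]}"
  by (auto simp: level_def tree_words.empty)

lemma level_append: "\<rho> \<in> level M \<omega> n \<Longrightarrow> \<tau> \<in> level M (subtree \<omega> \<rho>) k \<Longrightarrow> \<rho> @ \<tau> \<in> level M \<omega> (n + k)"
  by (simp add: level_def tree_words_append)

lemma level_appendE:
  assumes "\<tau> \<in> level M \<omega> (n + k)"
  obtains \<rho> \<sigma> where "\<tau> = \<rho> @ \<sigma>" "\<rho> \<in> level M \<omega> n" "\<sigma> \<in> level M (subtree \<omega> \<rho>) k"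
proof (rule that)
  show "\<tau> = take n \<tau> @ drop n \<tau>" by simp
  then have "take n \<tau> @ drop n \<tau> \<in> tree_words M \<omega>" using assms by (simp add: level_def)
  then show "take n \<tau> \<in> level M \<omega> n" "drop n \<tau> \<in> level M (subtree \<omega> (take n \<tau>)) k"
    using assms unfolding tree_words_append by (auto simp: level_def)
qed

lemma level_Suc: "level M \<omega> (Suc k) = (\<Union>i\<in>{1..M (\<omega> [])}. (#) i ` level M (subtree \<omega> [i]) k)"
  by (auto simp: level_def tree_words_Cons length_Suc_conv image_iff)

lemma finite_level [simp]: "finite (level M \<omega> k)"
  by (induction k arbitrary: \<omega>) (auto simp: level_Suc)

lemma card_level_le:
  assumes "\<And>l. M l \<le> B"
  shows "card (level M \<omega> k) \<le> B ^ k"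
proof (induction k arbitrary: \<omega>)
  case (Suc k)
  have "card (level M \<omega> (Suc k)) \<le> (\<Sum>i\<in>{1..M (\<omega> [])}. card ((#) i ` level M (subtree \<omega> [i]) k))"
    unfolding level_Suc by (rule card_UN_le) simp
  also have "\<dots> \<le> (\<Sum>i\<in>{1..M (\<omega> [])}. B ^ k)"
    by (intro sum_mono order_trans[OF card_image_le[OF finite_level] Suc])
  also have "\<dots> \<le> B ^ Suc k" using assms[of "\<omega> []"] by simp
  finally show ?case .
qed simp

lemma level_nonempty:
  assumes "\<And>l. 1 \<le> M l"
  shows "level M \<omega> k \<noteq> {}"
proof (induction k arbitrary: \<omega>)
  case (Suc k)
  have "1 \<in> {1..M (\<omega> [])}" using assms[of "\<omega> []"] by simp
  with Suc show ?case unfolding level_Suc by blast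
qed simp

text \<open>Trades the prefix argument of \<open>comp_along\<close> for a subtree, so that
  inductions along words only have to generalize the tree.\<close>

lemma comp_along_subtree: "comp_along g \<omega> (\<rho> @ \<rho>') \<tau> = comp_along g (subtree \<omega> \<rho>) \<rho>' \<tau>"
  by (induction \<tau> arbitrary: \<rho>') (simp_all add: subtree_def)

lemma comp_along_Cons:
  "comp_along g \<omega> [] (i # \<tau>) = g (\<omega> []) i \<circ> comp_along g (subtree \<omega> [i]) [] \<tau>"
  using comp_along_subtree[of g \<omega> "[i]" "[]" \<tau>] by simp

lemma comp_along_append:
  "comp_along g \<omega> [] (\<rho> @ \<tau>) = comp_along g \<omega> [] \<rho> \<circ> comp_along g (subtree \<omega> \<rho>) [] \<tau>"
proof (induction \<rho> arbitrary: \<omega>)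
  case (Cons i \<rho>)
  show ?case by (simp del: comp_along.simps add: comp_along_Cons Cons subtree_subtree comp_assoc)
qed simp

text \<open>When \<open>r\<close> gives the contraction ratios, this is the ratio of the composed
  similarity (\<open>comp_along_similarity\<close>), and the level sums become sums of its
  powers.\<close>

primrec weight :: "('l \<Rightarrow> nat \<Rightarrow> real) \<Rightarrow> (nat list \<Rightarrow> 'l) \<Rightarrow> nat list \<Rightarrow> real" where
  "weight r \<omega> [] = 1"
| "weight r \<omega> (i # \<tau>) = r (\<omega> []) i * weight r (subtree \<omega> [i]) \<tau>"

lemma weight_append: "weight r \<omega> (\<rho> @ \<tau>) = weight r \<omega> \<rho> * weight r (subtree \<omega> \<rho>) \<tau>"
  by (induction \<rho> arbitrary: \<omega>) (simp_all add: subtree_subtree)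

text \<open>Only labels at shorter words decide membership. With \<open>weight_cong\<close> this
  makes the data of the first block constant on cylinders.\<close>

lemma tree_words_cong:
  assumes "\<tau> \<in> tree_words M \<omega>" "\<And>\<rho>. length \<rho> < length \<tau> \<Longrightarrow> \<omega> \<rho> = \<omega>' \<rho>"
  shows "\<tau> \<in> tree_words M \<omega>'"
  using assms
proof (induction rule: tree_words.induct)
  case (extend \<tau> l)
  then have "\<omega> \<tau> = \<omega>' \<tau>" "\<tau> \<in> tree_words M \<omega>'" by auto
  with extend show ?case by (auto intro: tree_words.extend)
qed (rule tree_words.empty)

lemma weight_cong:
  "(\<And>\<rho>. length \<rho> < length \<tau> \<Longrightarrow> \<omega> \<rho> = \<omega>' \<rho>) \<Longrightarrow> weight r \<omega> \<tau> = weight r \<omega>' \<tau>"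
proof (induction \<tau> arbitrary: \<omega> \<omega>')
  case (Cons i \<tau>)
  have "\<omega> [] = \<omega>' []" by (rule Cons.prems) simp
  moreover have "weight r (subtree \<omega> [i]) \<tau> = weight r (subtree \<omega>' [i]) \<tau>"
    by (rule Cons.IH) (simp add: subtree_def Cons.prems)
  ultimately show ?case by simp
qed simp

lemma tree_words_restrict: "tree_words M (restrict \<omega> (tree_words M \<omega>)) = tree_words M \<omega>"
proof (intro set_eqI iffI)
  fix \<tau> show "\<tau> \<in> tree_words M \<omega>" if "\<tau> \<in> tree_words M (restrict \<omega> (tree_words M \<omega>))"
    using that by induction (auto intro: tree_words.intros)
  show "\<tau> \<in> tree_words M (restrict \<omega> (tree_words M \<omega>))" if "\<tau> \<in> tree_words M \<omega>"
    using that by induction (auto intro: tree_words.intros)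
qed

lemma code_trees_iff: "\<omega> \<in> code_trees M \<longleftrightarrow> (\<forall>\<tau>. \<tau> \<notin> tree_words M \<omega> \<longrightarrow> \<omega> \<tau> = undefined)"
proof
  show "\<forall>\<tau>. \<tau> \<notin> tree_words M \<omega> \<longrightarrow> \<omega> \<tau> = undefined" if "\<omega> \<in> code_trees M"
    using that by (auto simp: code_trees_def tree_words_restrict)
  assume "\<forall>\<tau>. \<tau> \<notin> tree_words M \<omega> \<longrightarrow> \<omega> \<tau> = undefined"
  then have "\<omega> = restrict \<omega> (tree_words M \<omega>)" by (auto simp: fun_eq_iff)
  then show "\<omega> \<in> code_trees M" unfolding code_trees_def by blast
qed

text \<open>The common subtree below the m-th neck. The choice of the word is immaterial by
  \<open>subtree_neck_eq\<close>, and at m = 0 the whole tree is recovered.\<close>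

definition neck_tail :: "('l \<Rightarrow> nat) \<Rightarrow> (nat list \<Rightarrow> 'l) \<Rightarrow> (nat \<Rightarrow> nat) \<Rightarrow> nat \<Rightarrow> nat list \<Rightarrow> 'l" where
  "neck_tail M \<omega> N m = subtree \<omega> (SOME \<tau>. \<tau> \<in> level M \<omega> (N m))"

lemma neck_shift_eq: "neck_shift M (\<omega>, N) = (neck_tail M \<omega> N 1, \<lambda>m. N (m + 1) - N 1)"
  by (simp add: neck_shift_def neck_tail_def level_def subtree_def)

context
  fixes M :: "'l \<Rightarrow> nat" and \<omega> N
  assumes necked: "(\<omega>, N) \<in> necked_trees M"
begin

lemma necked_N: "N 0 = 0" "strict_mono N" "\<omega> \<in> code_trees M"
  using necked by (auto simp: necked_trees_def)

lemma necked_N_le: "N m \<le> N (m + j)"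
  using necked_N(2) by (simp add: strict_mono_less_eq)

lemma neck_exchange:
  assumes "1 \<le> m" "length \<tau> = N m" "length \<tau>' = N m"
    and "\<tau> @ \<rho> \<in> tree_words M \<omega>" "\<tau>' \<in> tree_words M \<omega>"
  shows "\<tau>' @ \<rho> \<in> tree_words M \<omega> \<and> \<omega> (\<tau> @ \<rho>) = \<omega> (\<tau>' @ \<rho>)"
proof -
  have "\<forall>m\<ge>1. \<forall>\<tau> \<tau>' \<rho>. length \<tau> = N m \<and> length \<tau>' = N m \<and>
        \<tau> @ \<rho> \<in> tree_words M \<omega> \<and> \<tau>' \<in> tree_words M \<omega> \<longrightarrow>
        \<tau>' @ \<rho> \<in> tree_words M \<omega> \<and> \<omega> (\<tau> @ \<rho>) = \<omega> (\<tau>' @ \<rho>)"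
    using necked unfolding necked_trees_def mem_Collect_eq prod.case by (elim conjE)
  from this[rule_format, of m \<tau> \<tau>' \<rho>] assms show ?thesis by blast
qed

lemma subtree_neck_eq:
  assumes \<tau>: "\<tau> \<in> level M \<omega> (N m)" and \<tau>': "\<tau>' \<in> level M \<omega> (N m)"
  shows "subtree \<omega> \<tau> = subtree \<omega> \<tau>'"
proof (cases "m = 0")
  case True
  then show ?thesis using \<tau> \<tau>' necked_N by simp
next
  case False
  then have *: "\<tau>2 @ \<rho> \<in> tree_words M \<omega> \<and> \<omega> (\<tau>1 @ \<rho>) = \<omega> (\<tau>2 @ \<rho>)"
    if "\<tau>1 @ \<rho> \<in> tree_words M \<omega>" "\<tau>1 \<in> level M \<omega> (N m)" "\<tau>2 \<in> level M \<omega> (N m)" for \<tau>1 \<tau>2 \<rho>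
    using that by (intro neck_exchange[of m]) (auto simp: level_def)
  have "\<omega> (\<tau> @ \<rho>) = \<omega> (\<tau>' @ \<rho>)" for \<rho>
  proof (cases "\<tau> @ \<rho> \<in> tree_words M \<omega>")
    case True
    then show ?thesis using *[of \<tau> \<rho> \<tau>'] \<tau> \<tau>' by blast
  next
    case False
    \<comment> \<open>Off the tree both labels are \<open>undefined\<close>; hence the two subtrees
      agree as total functions and not just on their words.\<close>
    then have "\<tau>' @ \<rho> \<notin> tree_words M \<omega>" using *[of \<tau>' \<rho> \<tau>] \<tau> \<tau>' by blast
    with False show ?thesis using necked_N(3) by (simp add: code_trees_iff)
  qed
  then show ?thesis by (simp add: subtree_def)
qed

lemma subtree_neck: "\<tau> \<in> level M \<omega> (N m) \<Longrightarrow> subtree \<omega> \<tau> = neck_tail M \<omega> N m"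
  unfolding neck_tail_def by (rule subtree_neck_eq, assumption, erule someI)

lemma neck_tail_0: "neck_tail M \<omega> N 0 = \<omega>"
  using subtree_neck[of "[]" 0] necked_N by simp

lemma subtree_neck_tail:
  assumes "\<And>l. 1 \<le> M l" and \<tau>: "\<tau> \<in> level M (neck_tail M \<omega> N m) (N (m + j) - N m)"
  shows "subtree (neck_tail M \<omega> N m) \<tau> = neck_tail M \<omega> N (m + j)"
proof -
  obtain \<rho> where \<rho>: "\<rho> \<in> level M \<omega> (N m)" using level_nonempty[of M] assms(1) by blast
  then have eq: "neck_tail M \<omega> N m = subtree \<omega> \<rho>" by (simp add: subtree_neck)
  have "\<rho> @ \<tau> \<in> level M \<omega> (N m + (N (m + j) - N m))"
    using \<rho> \<tau> unfolding eq by (rule level_append)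
  then have "\<rho> @ \<tau> \<in> level M \<omega> (N (m + j))" using necked_N_le by simp
  then show ?thesis by (simp add: eq subtree_subtree subtree_neck)
qed

text \<open>Reads the orbit of the shift as the sequence of neck tails of one tree, so that Birkhoff
  sums become sums over its consecutive blocks.\<close>

lemma neck_shift_funpow:
  assumes "\<And>l. 1 \<le> M l"
  shows "(neck_shift M ^^ m) (\<omega>, N) = (neck_tail M \<omega> N m, \<lambda>j. N (m + j) - N m)"
proof (induction m)
  case 0
  then show ?case using neck_tail_0 necked_N by simp
next
  case (Suc m)
  obtain \<tau> where \<tau>: "\<tau> \<in> level M (neck_tail M \<omega> N m) (N (m + 1) - N m)"
    using level_nonempty[of M] assms by blast
  then have "(SOME \<tau>. \<tau> \<in> level M (neck_tail M \<omega> N m) (N (m + 1) - N m))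
      \<in> level M (neck_tail M \<omega> N m) (N (m + 1) - N m)" by (rule someI)
  from subtree_neck_tail[OF assms this]
  have "neck_tail M (neck_tail M \<omega> N m) (\<lambda>j. N (m + j) - N m) 1 = neck_tail M \<omega> N (Suc m)"
    by (simp add: neck_tail_def)
  moreover have "N (Suc (m + j)) - N m - (N (Suc m) - N m) = N (Suc (m + j)) - N (Suc m)" for j
    using necked_N_le[of m 1] by simp
  ultimately show ?case using Suc by (simp add: neck_shift_eq)
qed

lemma neck_shift_in_necked_trees:
  assumes M: "\<And>l. 1 \<le> M l"
  shows "neck_shift M (\<omega>, N) \<in> necked_trees M"
proof -
  obtain \<tau> where \<tau>: "\<tau> \<in> level M \<omega> (N 1)" using level_nonempty[of M] M by blast
  then have eq: "neck_tail M \<omega> N 1 = subtree \<omega> \<tau>" by (rule subtree_neck[symmetric])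
  have tw: "\<tau> \<in> tree_words M \<omega>" "length \<tau> = N 1" using \<tau> by (auto simp: level_def)
  have 1: "subtree \<omega> \<tau> \<in> code_trees M"
    using necked_N(3) tw tree_words_append[of \<tau> _ M \<omega>] by (auto simp: code_trees_iff subtree_def)
  have 2: "strict_mono (\<lambda>m. N (m + 1) - N 1)"
  proof (rule strict_monoI)
    fix a b :: nat assume "a < b"
    then have "N (a + 1) < N (b + 1)" using necked_N(2) by (simp add: strict_mono_less)
    then show "N (a + 1) - N 1 < N (b + 1) - N 1"
      using necked_N_le[of 1 a] by (simp add: add.commute)
  qed
  have 3: "\<rho>' @ \<sigma> \<in> tree_words M (subtree \<omega> \<tau>) \<and> subtree \<omega> \<tau> (\<rho> @ \<sigma>) = subtree \<omega> \<tau> (\<rho>' @ \<sigma>)"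
    if "1 \<le> m" "length \<rho> = N (m + 1) - N 1" "length \<rho>' = N (m + 1) - N 1"
      "\<rho> @ \<sigma> \<in> tree_words M (subtree \<omega> \<tau>)" "\<rho>' \<in> tree_words M (subtree \<omega> \<tau>)" for m \<rho> \<rho>' \<sigma>
  proof -
    have len: "length (\<tau> @ \<rho>) = N (m + 1)" "length (\<tau> @ \<rho>') = N (m + 1)"
      using that tw necked_N_le[of 1 m] by (simp_all add: add.commute)
    have "(\<tau> @ \<rho>) @ \<sigma> \<in> tree_words M \<omega>" "\<tau> @ \<rho>' \<in> tree_words M \<omega>"
      using that tw tree_words_append[of \<tau> _ M \<omega>] by auto
    then have "(\<tau> @ \<rho>') @ \<sigma> \<in> tree_words M \<omega> \<and> \<omega> ((\<tau> @ \<rho>) @ \<sigma>) = \<omega> ((\<tau> @ \<rho>') @ \<sigma>)"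
      using len by (intro neck_exchange[of "m + 1"]) auto
    then show ?thesis
      using tree_words_append[of \<tau> "\<rho>' @ \<sigma>" M \<omega>] by (simp add: subtree_def)
  qed
  show ?thesis unfolding neck_shift_eq eq necked_trees_def mem_Collect_eq prod.case
    by (intro conjI allI impI 1 2) (use 3 in auto)
qed

end

section \<open>The Borel structure of the space of necked trees\<close>

lemma neck_cylinder_iff: "y \<in> neck_cylinder M x m \<longleftrightarrow> y \<in> necked_trees M \<and>
    (\<forall>i. 1 \<le> i \<and> i \<le> m \<longrightarrow> snd y i = snd x i) \<and> (\<forall>\<tau>. length \<tau> < snd x m \<longrightarrow> fst y \<tau> = fst x \<tau>)"
  by (cases x; cases y) (simp add: neck_cylinder_def)

lemma neck_cylinder_antimono:
  assumes y: "y \<in> neck_cylinder M x m" "1 \<le> m" and "m \<le> n"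
  shows "neck_cylinder M y n \<subseteq> neck_cylinder M x m"
proof
  fix z assume z: "z \<in> neck_cylinder M y n"
  have "strict_mono (snd y)" using y(1) by (auto simp: neck_cylinder_iff necked_trees_def)
  then have "snd y m \<le> snd y n" using \<open>m \<le> n\<close> by (simp add: strict_mono_less_eq)
  moreover have "snd y m = snd x m" using y by (simp add: neck_cylinder_iff)
  ultimately show "z \<in> neck_cylinder M x m"
    using y z \<open>m \<le> n\<close> by (auto simp: neck_cylinder_iff)
qed

text \<open>A cylinder contains a cylinder around each of its points, and cylinders around one point
  shrink as the level grows. They therefore form a base of neighbourhoods, and openness can be
  tested pointwise.\<close>

lemma openin_neck_topology_iff:
  "openin (neck_topology M) U \<longleftrightarrow>
     U \<subseteq> necked_trees M \<and> (\<forall>x\<in>U. \<exists>m\<ge>1. neck_cylinder M x m \<subseteq> U)"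
proof
  let ?B = "{neck_cylinder M x m | x m. x \<in> necked_trees M \<and> 1 \<le> m}"
  assume "openin (neck_topology M) U"
  then have "generate_topology_on ?B U"
    by (simp add: neck_topology_def openin_topology_generated_by)
  then show "U \<subseteq> necked_trees M \<and> (\<forall>x\<in>U. \<exists>m\<ge>1. neck_cylinder M x m \<subseteq> U)"
  proof induction
    case (Int a b)
    have "\<exists>m\<ge>1. neck_cylinder M x m \<subseteq> a \<inter> b" if x: "x \<in> a \<inter> b" for x
    proof -
      obtain m n where mn: "1 \<le> m" "neck_cylinder M x m \<subseteq> a" "1 \<le> n" "neck_cylinder M x n \<subseteq> b"
        using Int x by blast
      have "x \<in> neck_cylinder M x k" for k using Int x by (auto simp: neck_cylinder_iff)
      then have "neck_cylinder M x (max m n) \<subseteq> a \<inter> b"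
        using neck_cylinder_antimono[of x M x _ "max m n"] mn by (meson Int_greatest max.cobounded1 max.cobounded2 order_trans)
      then show ?thesis using mn by (intro exI[of _ "max m n"]) auto
    qed
    with Int show ?case by blast
  next
    case (UN K)
    then show ?case by (meson Sup_least UnionE Union_upper order_trans)
  next
    case (Basis s)
    then obtain x m where s: "s = neck_cylinder M x m" "1 \<le> m" by blast
    have "s \<subseteq> necked_trees M" unfolding s by (auto simp: neck_cylinder_iff)
    moreover have "\<exists>m\<ge>1. neck_cylinder M y m \<subseteq> s" if "y \<in> s" for y
      using neck_cylinder_antimono[of y M x m m] s that by auto
    ultimately show ?case by blast
  qed simp
next
  let ?B = "{neck_cylinder M x m | x m. x \<in> necked_trees M \<and> 1 \<le> m}"
  assume *: "U \<subseteq> necked_trees M \<and> (\<forall>x\<in>U. \<exists>m\<ge>1. neck_cylinder M x m \<subseteq> U)"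
  define K where "K = {V \<in> ?B. V \<subseteq> U}"
  have "x \<in> \<Union>K" if x: "x \<in> U" for x
  proof -
    obtain m where m: "1 \<le> m" "neck_cylinder M x m \<subseteq> U" using * x by blast
    have "x \<in> neck_cylinder M x m" using * x by (auto simp: neck_cylinder_iff)
    moreover have "neck_cylinder M x m \<in> K" using m * x unfolding K_def by blast
    ultimately show ?thesis by blast
  qed
  then have "U = \<Union>K" by (auto simp: K_def)
  moreover have "openin (neck_topology M) (\<Union>K)"
    unfolding neck_topology_def
    by (rule openin_Union) (auto simp: K_def intro!: topology_generated_by_Basis)
  ultimately show "openin (neck_topology M) U" by simp
qed

lemma space_neck_borel [simp]: "space (neck_borel M) = necked_trees M"
  unfolding neck_borel_def by (rule space_measure_of) (auto simp: openin_neck_topology_iff)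

lemma sets_neck_borel: "sets (neck_borel M) = sigma_sets (necked_trees M) {U. openin (neck_topology M) U}"
  unfolding neck_borel_def by (rule sets_measure_of) (auto simp: openin_neck_topology_iff)

lemma openin_sets_neck_borel: "openin (neck_topology M) U \<Longrightarrow> U \<in> sets (neck_borel M)"
  by (simp add: sets_neck_borel sigma_sets.Basic)

text \<open>The preimage of any set whatsoever is open, so the target sigma-algebra does not matter.
  This covers \<open>N 1\<close> and the first block sum for an arbitrary index set.\<close>

lemma measurable_neck_borel_locally_constant:
  assumes "\<And>x. x \<in> necked_trees M \<Longrightarrow> f x \<in> space N"
    and "\<And>x y. x \<in> necked_trees M \<Longrightarrow> y \<in> neck_cylinder M x 1 \<Longrightarrow> f y = f x"
  shows "f \<in> measurable (neck_borel M) N"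
proof (rule measurableI)
  fix A
  have "openin (neck_topology M) (f -` A \<inter> necked_trees M)"
    unfolding openin_neck_topology_iff
  proof (intro conjI ballI exI[of _ 1])
    fix x assume x: "x \<in> f -` A \<inter> necked_trees M"
    then have "y \<in> f -` A \<inter> necked_trees M" if "y \<in> neck_cylinder M x 1" for y
      using assms(2)[of x y] that by (auto simp: neck_cylinder_iff)
    then show "neck_cylinder M x 1 \<subseteq> f -` A \<inter> necked_trees M" by blast
  qed auto
  then show "f -` A \<inter> space (neck_borel M) \<in> sets (neck_borel M)"
    by (simp add: openin_sets_neck_borel)
qed (use assms in simp)

lemma level_cong:
  assumes "\<And>\<rho>. length \<rho> < k \<Longrightarrow> \<omega> \<rho> = \<omega>' \<rho>"
  shows "level M \<omega> k = level M \<omega>' k"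
  unfolding level_def using assms by (auto intro: tree_words_cong)

lemma neck_tail_cong:
  assumes "x \<in> necked_trees M" "y \<in> neck_cylinder M x (m + 1)" "length \<tau> < snd x (m + 1) - snd x 1"
    and M: "\<And>l. 1 \<le> M l"
  shows "neck_tail M (fst y) (snd y) 1 \<tau> = neck_tail M (fst x) (snd x) 1 \<tau>"
proof -
  have "strict_mono (snd x)" using assms(1) by (auto simp: necked_trees_def)
  then have le: "snd x 1 \<le> snd x (m + 1)" by (simp add: strict_mono_less_eq)
  have N1: "snd y 1 = snd x 1" using assms(2) by (auto simp: neck_cylinder_iff)
  \<comment> \<open>Equal levels force the two \<open>SOME\<close> choices in
    \<open>neck_tail\<close> to pick the same word.\<close>
  have "level M (fst y) (snd y 1) = level M (fst x) (snd x 1)"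
    unfolding N1 by (rule level_cong) (use assms(2) le in \<open>auto simp: neck_cylinder_iff\<close>)
  then show ?thesis
  proof (simp add: neck_tail_def subtree_def)
    let ?\<sigma> = "SOME \<sigma>. \<sigma> \<in> level M (fst x) (snd x (Suc 0))"
    show "fst y (?\<sigma> @ \<tau>) = fst x (?\<sigma> @ \<tau>)"
    proof -
      obtain \<sigma> where "\<sigma> \<in> level M (fst x) (snd x (Suc 0))" using level_nonempty[of M] M by blast
      then have "?\<sigma> \<in> level M (fst x) (snd x (Suc 0))" by (rule someI)
      then have "length (?\<sigma> @ \<tau>) < snd x (m + 1)" using assms(3) le by (simp add: level_def)
      then show ?thesis using assms(2) unfolding neck_cylinder_iff by blast
    qed
  qed
qed

text \<open>The shift is continuous: it forgets one block, so m + 1 necks of the argument determine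
  m necks of the image.\<close>

lemma measurable_neck_shift:
  assumes M: "\<And>l. 1 \<le> M l"
  shows "neck_shift M \<in> measurable (neck_borel M) (neck_borel M)"
  unfolding neck_borel_def[of M]
proof (rule measurable_measure_of)
  have in_necked: "neck_shift M x \<in> necked_trees M" if "x \<in> necked_trees M" for x
    using neck_shift_in_necked_trees[of "fst x" "snd x"] M that by simp
  then show "neck_shift M \<in> space (sigma (necked_trees M) {U. openin (neck_topology M) U}) \<rightarrow> necked_trees M"
    using space_neck_borel[of M] unfolding neck_borel_def by blast
  fix U assume "U \<in> {U. openin (neck_topology M) U}"
  then have U: "openin (neck_topology M) U" by simp
  have "openin (neck_topology M) (neck_shift M -` U \<inter> necked_trees M)"
    unfolding openin_neck_topology_iff
  proof (intro conjI ballI)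
    fix x assume x: "x \<in> neck_shift M -` U \<inter> necked_trees M"
    then obtain m where m: "1 \<le> m" "neck_cylinder M (neck_shift M x) m \<subseteq> U"
      using U unfolding openin_neck_topology_iff by blast
    have "neck_shift M y \<in> neck_cylinder M (neck_shift M x) m" if y: "y \<in> neck_cylinder M x (m + 1)" for y
    proof -
      have yn: "y \<in> necked_trees M" using y by (simp add: neck_cylinder_iff)
      have s: "neck_shift M z = (neck_tail M (fst z) (snd z) 1, \<lambda>m. snd z (m + 1) - snd z 1)" for z
        using neck_shift_eq[of M "fst z" "snd z"] by simp
      show ?thesis
        unfolding neck_cylinder_iff
      proof (intro conjI allI impI)
        show "neck_shift M y \<in> necked_trees M" by (rule in_necked[OF yn])
        show "snd (neck_shift M y) i = snd (neck_shift M x) i" if "1 \<le> i \<and> i \<le> m" for i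
          using y that by (simp add: s neck_cylinder_iff)
        show "fst (neck_shift M y) \<tau> = fst (neck_shift M x) \<tau>"
          if "length \<tau> < snd (neck_shift M x) m" for \<tau>
          using neck_tail_cong[of x M y m \<tau>] x y that M by (simp add: s)
      qed
    qed
    moreover have "neck_cylinder M x (m + 1) \<subseteq> necked_trees M" by (auto simp: neck_cylinder_iff)
    ultimately have "neck_cylinder M x (m + 1) \<subseteq> neck_shift M -` U \<inter> necked_trees M"
      using m(2) by blast
    then show "\<exists>m\<ge>1. neck_cylinder M x m \<subseteq> neck_shift M -` U \<inter> necked_trees M"
      by (intro exI[of _ "m + 1"]) simp
  qed auto
  then show "neck_shift M -` U \<inter> space (sigma (necked_trees M) {U. openin (neck_topology M) U})
      \<in> sets (sigma (necked_trees M) {U. openin (neck_topology M) U})"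
    using openin_sets_neck_borel[of M] space_neck_borel[of M] unfolding neck_borel_def by simp
qed (auto simp: openin_neck_topology_iff)

section \<open>Level sums of similarities\<close>

locale similarity_tree =
  fixes M :: "'l \<Rightarrow> nat" and T :: "'l \<Rightarrow> nat \<Rightarrow> 'a::euclidean_space \<Rightarrow> 'a"
    and r :: "'l \<Rightarrow> nat \<Rightarrow> real" and B :: nat and lo hi :: real
  assumes M_pos: "1 \<le> M l" and M_le: "M l \<le> B"
    and T_linear: "i \<in> {1..M l} \<Longrightarrow> linear (T l i)"
    and T_norm: "i \<in> {1..M l} \<Longrightarrow> norm (T l i x) = r l i * norm x"
    and r_ge: "i \<in> {1..M l} \<Longrightarrow> lo \<le> r l i" and r_le: "i \<in> {1..M l} \<Longrightarrow> r l i \<le> hi"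
    and lo_pos: "0 < lo" and lo_le_hi: "lo \<le> hi" and hi_less: "hi < 1 / 2"
begin

lemma hi_pos: "0 < hi" using lo_pos lo_le_hi by simp

lemma comp_along_similarity:
  "\<tau> \<in> tree_words M \<omega> \<Longrightarrow> linear (comp_along T \<omega> [] \<tau>) \<and>
    (\<forall>x. norm (comp_along T \<omega> [] \<tau> x) = weight r \<omega> \<tau> * norm x)"
proof (induction \<tau> arbitrary: \<omega>)
  case Nil
  then show ?case by (simp add: id_def linear_id[unfolded id_def])
next
  case (Cons i \<tau>)
  then have i: "i \<in> {1..M (\<omega> [])}" and "\<tau> \<in> tree_words M (subtree \<omega> [i])" by (simp_all only: tree_words_Cons)
  with Cons.IH have IH: "linear (comp_along T (subtree \<omega> [i]) [] \<tau>)"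
    "norm (comp_along T (subtree \<omega> [i]) [] \<tau> x) = weight r (subtree \<omega> [i]) \<tau> * norm x" for x
    by auto
  have "linear (T (\<omega> []) i \<circ> comp_along T (subtree \<omega> [i]) [] \<tau>)"
    using IH(1) T_linear[OF i] by (rule linear_compose)
  then show ?case
    by (simp del: comp_along.simps add: comp_along_Cons T_norm[OF i] IH(2) o_def)
qed

lemma weight_bounds:
  "\<tau> \<in> tree_words M \<omega> \<Longrightarrow> lo ^ length \<tau> \<le> weight r \<omega> \<tau> \<and> weight r \<omega> \<tau> \<le> hi ^ length \<tau>"
proof (induction \<tau> arbitrary: \<omega>)
  case (Cons i \<tau>)
  then have i: "i \<in> {1..M (\<omega> [])}" and "\<tau> \<in> tree_words M (subtree \<omega> [i])" by (simp_all only: tree_words_Cons)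
  with Cons.IH have IH: "lo ^ length \<tau> \<le> weight r (subtree \<omega> [i]) \<tau>" "weight r (subtree \<omega> [i]) \<tau> \<le> hi ^ length \<tau>"
    by auto
  have "0 \<le> lo ^ length \<tau>" using lo_pos by simp
  then have "0 \<le> weight r (subtree \<omega> [i]) \<tau>" using IH(1) by linarith
  then show ?case
    using IH r_ge[OF i] r_le[OF i] lo_pos hi_pos by (auto intro!: mult_mono)
qed simp

lemma weight_pos: "\<tau> \<in> tree_words M \<omega> \<Longrightarrow> 0 < weight r \<omega> \<tau>"
  using weight_bounds[of \<tau> \<omega>] lo_pos zero_less_power[OF lo_pos, of "length \<tau>"] by linarith

lemma weight_le_1: "\<tau> \<in> tree_words M \<omega> \<Longrightarrow> weight r \<omega> \<tau> \<le> 1"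
  using weight_bounds[of \<tau> \<omega>] power_le_one[of hi "length \<tau>"] hi_pos hi_less by linarith

lemma level_sum_eq: "level_sum M T \<omega> k \<alpha> = (\<Sum>\<tau>\<in>level M \<omega> k. weight r \<omega> \<tau> powr \<alpha>)"
  unfolding level_sum_def level_def
  by (intro sum.cong refl singular_value_function_similarity)
    (auto simp: comp_along_similarity weight_pos)

lemma level_sum_pos: "0 < level_sum M T \<omega> k \<alpha>"
  unfolding level_sum_eq
  by (rule sum_pos[OF finite_level level_nonempty[OF M_pos]]) (auto simp: level_def dest: weight_pos)

text \<open>Every word of length n is followed by the same tree, so concatenation identifies pairs
  of words with words of length n + k, and weights multiply. Necks provide exactly this
  hypothesis.\<close>

lemma level_sum_add:
  assumes "\<And>\<tau>. \<tau> \<in> level M \<omega> n \<Longrightarrow> subtree \<omega> \<tau> = \<omega>'"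
  shows "level_sum M T \<omega> (n + k) \<alpha> = level_sum M T \<omega> n \<alpha> * level_sum M T \<omega>' k \<alpha>"
proof -
  have "level M \<omega> (n + k) = (\<lambda>(\<rho>, \<sigma>). \<rho> @ \<sigma>) ` (level M \<omega> n \<times> level M \<omega>' k)"
    using assms by (force elim: level_appendE intro: level_append)
  moreover have "inj_on (\<lambda>(\<rho>, \<sigma>). \<rho> @ \<sigma>) (level M \<omega> n \<times> level M \<omega>' k)"
    by (auto simp: inj_on_def level_def)
  ultimately have "level_sum M T \<omega> (n + k) \<alpha> =
      (\<Sum>(\<rho>, \<sigma>)\<in>level M \<omega> n \<times> level M \<omega>' k. weight r \<omega> (\<rho> @ \<sigma>) powr \<alpha>)"
    unfolding level_sum_eq by (simp add: sum.reindex case_prod_unfold)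
  also have "\<dots> = (\<Sum>(\<rho>, \<sigma>)\<in>level M \<omega> n \<times> level M \<omega>' k. weight r \<omega> \<rho> powr \<alpha> * weight r \<omega>' \<sigma> powr \<alpha>)"
  proof (rule sum.cong[OF refl], clarify)
    fix \<rho> \<sigma> assume "\<rho> \<in> level M \<omega> n" "\<sigma> \<in> level M \<omega>' k"
    then show "weight r \<omega> (\<rho> @ \<sigma>) powr \<alpha> = weight r \<omega> \<rho> powr \<alpha> * weight r \<omega>' \<sigma> powr \<alpha>"
      using assms weight_pos[of \<rho> \<omega>] weight_pos[of \<sigma> \<omega>']
      by (simp add: weight_append level_def powr_mult less_imp_le)
  qed
  finally show ?thesis
    by (simp add: level_sum_eq sum_product sum.cartesian_product)
qed

lemma level_sum_ge: "0 \<le> \<alpha> \<Longrightarrow> (lo ^ k) powr \<alpha> \<le> level_sum M T \<omega> k \<alpha>"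
proof -
  assume "0 \<le> \<alpha>"
  obtain \<tau> where \<tau>: "\<tau> \<in> level M \<omega> k" using level_nonempty[of M \<omega> k, OF M_pos] by blast
  then have "(lo ^ k) powr \<alpha> \<le> weight r \<omega> \<tau> powr \<alpha>"
    using weight_bounds[of \<tau> \<omega>] lo_pos \<open>0 \<le> \<alpha>\<close> by (intro powr_mono2) (auto simp: level_def)
  also have "\<dots> \<le> level_sum M T \<omega> k \<alpha>"
    unfolding level_sum_eq by (rule member_le_sum[OF \<tau>]) auto
  finally show ?thesis .
qed

lemma level_sum_le: "0 \<le> \<alpha> \<Longrightarrow> level_sum M T \<omega> k \<alpha> \<le> real B ^ k"
proof -
  assume "0 \<le> \<alpha>"
  have "level_sum M T \<omega> k \<alpha> \<le> (\<Sum>\<tau>\<in>level M \<omega> k. 1)"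
    unfolding level_sum_eq
    by (rule sum_mono) (use weight_le_1 weight_pos \<open>0 \<le> \<alpha>\<close> in \<open>auto simp: level_def less_imp_le intro!: powr_le1\<close>)
  also have "\<dots> \<le> real B ^ k"
    using card_level_le[of M B \<omega> k] M_le by (simp flip: of_nat_power)
  finally show ?thesis .
qed

text \<open>The logarithm of a level sum, per level, lies between \<open>\<alpha> * ln lo\<close>
  and \<open>ln (real B)\<close>. For nonnegative exponents the two moduli added give one bound for
  both sides.\<close>

definition growth_bound :: "real \<Rightarrow> real" where
  "growth_bound \<alpha> = ln (real B) - \<alpha> * ln lo"

lemma B_pos: "1 \<le> B" using M_pos M_le order_trans by blast

lemma ln_lo_neg: "ln lo < 0" using lo_pos lo_le_hi hi_less by simp

lemma ln_hi_neg: "ln hi < 0" using hi_pos hi_less by simp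

lemma abs_ln_level_sum_le:
  assumes "0 \<le> \<alpha>"
  shows "\<bar>ln (level_sum M T \<omega> k \<alpha>)\<bar> \<le> growth_bound \<alpha> * real k"
proof -
  have "ln (level_sum M T \<omega> k \<alpha>) \<le> ln (real B ^ k)"
    using level_sum_le[OF assms] level_sum_pos B_pos by (subst ln_le_cancel_iff) auto
  moreover have "ln ((lo ^ k) powr \<alpha>) \<le> ln (level_sum M T \<omega> k \<alpha>)"
    using level_sum_ge[OF assms] level_sum_pos lo_pos by (subst ln_le_cancel_iff) auto
  moreover have "ln (real B ^ k) = real k * ln (real B)" "ln ((lo ^ k) powr \<alpha>) = real k * (\<alpha> * ln lo)"
    using B_pos lo_pos by (auto simp: ln_realpow ln_powr)
  moreover have "0 \<le> real k * ln (real B)" "real k * (\<alpha> * ln lo) \<le> 0"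
    using B_pos ln_lo_neg assms by (auto simp: mult_nonneg_nonpos)
  moreover have "growth_bound \<alpha> * real k = real k * ln (real B) - real k * (\<alpha> * ln lo)"
    by (simp add: growth_bound_def algebra_simps)
  ultimately show ?thesis by linarith
qed

text \<open>Raising the exponent multiplies each summand by a power of a weight between
  \<open>lo ^ k\<close> and \<open>hi ^ k\<close>. The lower estimate yields Lipschitz dependence on
  the exponent, the upper one strict decrease.\<close>

lemma ln_level_sum_diff:
  assumes "\<alpha> \<le> \<beta>"
  shows "real k * ((\<beta> - \<alpha>) * ln lo) \<le> ln (level_sum M T \<omega> k \<beta>) - ln (level_sum M T \<omega> k \<alpha>)"
    and "ln (level_sum M T \<omega> k \<beta>) - ln (level_sum M T \<omega> k \<alpha>) \<le> real k * ((\<beta> - \<alpha>) * ln hi)"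
proof -
  have eq: "weight r \<omega> \<tau> powr \<beta> = weight r \<omega> \<tau> powr \<alpha> * weight r \<omega> \<tau> powr (\<beta> - \<alpha>)" for \<tau>
    by (simp add: powr_add[symmetric])
  have b: "(lo ^ k) powr (\<beta> - \<alpha>) \<le> weight r \<omega> \<tau> powr (\<beta> - \<alpha>)"
    "weight r \<omega> \<tau> powr (\<beta> - \<alpha>) \<le> (hi ^ k) powr (\<beta> - \<alpha>)" if "\<tau> \<in> level M \<omega> k" for \<tau>
    using weight_bounds[of \<tau> \<omega>] weight_pos[of \<tau> \<omega>] lo_pos assms that
    by (auto simp: level_def intro!: powr_mono2)
  have "level_sum M T \<omega> k \<alpha> * (lo ^ k) powr (\<beta> - \<alpha>) \<le> level_sum M T \<omega> k \<beta>"
    unfolding level_sum_eq sum_distrib_right eq using b by (intro sum_mono mult_left_mono) auto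
  then have "ln (level_sum M T \<omega> k \<alpha> * (lo ^ k) powr (\<beta> - \<alpha>)) \<le> ln (level_sum M T \<omega> k \<beta>)"
    using level_sum_pos lo_pos by (subst ln_le_cancel_iff) auto
  then show "real k * ((\<beta> - \<alpha>) * ln lo) \<le> ln (level_sum M T \<omega> k \<beta>) - ln (level_sum M T \<omega> k \<alpha>)"
    using level_sum_pos[of \<omega> k \<alpha>] lo_pos by (simp add: ln_mult ln_powr ln_realpow algebra_simps)
  have "level_sum M T \<omega> k \<beta> \<le> level_sum M T \<omega> k \<alpha> * (hi ^ k) powr (\<beta> - \<alpha>)"
    unfolding level_sum_eq sum_distrib_right eq using b by (intro sum_mono mult_left_mono) auto
  then have "ln (level_sum M T \<omega> k \<beta>) \<le> ln (level_sum M T \<omega> k \<alpha> * (hi ^ k) powr (\<beta> - \<alpha>))"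
    using level_sum_pos hi_pos by (subst ln_le_cancel_iff) auto
  then show "ln (level_sum M T \<omega> k \<beta>) - ln (level_sum M T \<omega> k \<alpha>) \<le> real k * ((\<beta> - \<alpha>) * ln hi)"
    using level_sum_pos[of \<omega> k \<alpha>] hi_pos by (simp add: ln_mult ln_powr ln_realpow algebra_simps)
qed

lemma ln_level_sum_neck_add:
  assumes "(\<omega>, N) \<in> necked_trees M"
  shows "ln (level_sum M T \<omega> (N m + k) \<alpha>) =
    ln (level_sum M T \<omega> (N m) \<alpha>) + ln (level_sum M T (neck_tail M \<omega> N m) k \<alpha>)"
  using level_sum_add[of \<omega> "N m" "neck_tail M \<omega> N m" k \<alpha>] subtree_neck[OF assms]
    level_sum_pos[of \<omega> "N m" \<alpha>] level_sum_pos[of "neck_tail M \<omega> N m" k \<alpha>]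
  by (simp add: ln_mult)

lemma ln_level_sum_neck:
  assumes "(\<omega>, N) \<in> necked_trees M"
  shows "ln (level_sum M T \<omega> (N m) \<alpha>) =
    (\<Sum>j<m. ln (level_sum M T (neck_tail M \<omega> N j) (N (j + 1) - N j) \<alpha>))"
proof (induction m)
  case 0
  then show ?case using necked_N[OF assms] by (simp add: level_sum_eq)
next
  case (Suc m)
  then show ?case
    using ln_level_sum_neck_add[OF assms, of m "N (m + 1) - N m"] necked_N_le[OF assms, of m 1] by simp
qed

end

text \<open>Both \<open>N (m + 1) / m\<close> and \<open>N m / m\<close> tend to the same limit.
  This is the precise form in which necks are not too far apart.\<close>

lemma gap_tendsto_0:
  assumes lim_N: "(\<lambda>m. real (N m) / real m) \<longlonglongrightarrow> \<nu>"
  shows "(\<lambda>m. (real (N (m + 1)) - real (N m)) / real m) \<longlonglongrightarrow> 0"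
proof -
  have "(\<lambda>j. real (N (Suc j)) / real (Suc j) * (real (Suc j) / real j)) \<longlonglongrightarrow> \<nu> * 1"
    by (intro tendsto_mult LIMSEQ_Suc[OF lim_N] LIMSEQ_Suc_n_over_n)
  moreover have "real (N (Suc j)) / real (Suc j) * (real (Suc j) / real j) = real (N (Suc j)) / real j" for j
    by simp
  ultimately have "(\<lambda>j. real (N (Suc j)) / real j) \<longlonglongrightarrow> \<nu>" by (simp only: mult_1_right)
  from tendsto_diff[OF this lim_N] show ?thesis by (simp add: diff_divide_distrib)
qed

text \<open>With \<open>m k\<close> the index of the block containing k, both
  \<open>b k / m k\<close> and \<open>k / m k\<close> differ from their values at the preceding neck
  by at most a multiple of the relative gap, which vanishes. The claim is the quotient of their
  limits.\<close>

lemma limit_along_blocks: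
  fixes b :: "nat \<Rightarrow> real"
  assumes N0: "N 0 = 0" and N: "strict_mono N"
    and lim_N: "(\<lambda>m. real (N m) / real m) \<longlonglongrightarrow> \<nu>" and "0 < \<nu>"
    and lim_b: "(\<lambda>m. b (N m) / real m) \<longlonglongrightarrow> g"
    and step: "\<And>m k. N m \<le> k \<Longrightarrow> k \<le> N (m + 1) \<Longrightarrow> \<bar>b k - b (N m)\<bar> \<le> C * (real (N (m + 1)) - real (N m))"
  shows "(\<lambda>k. b k / real k) \<longlonglongrightarrow> g / \<nu>"
proof -
  have "\<exists>m. N m \<le> k \<and> k < N (m + 1)" for k
  proof -
    have "k < N (Suc k)" using strict_mono_imp_increasing[OF N, of "Suc k"] by linarith
    then have *: "k < N (LEAST j. k < N j)" by (rule LeastI)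
    then have "(LEAST j. k < N j) \<noteq> 0" using N0 by (intro notI) simp
    then obtain m where m: "(LEAST j. k < N j) = Suc m" by (meson not0_implies_Suc)
    then have "\<not> k < N m" using not_less_Least[of m "\<lambda>j. k < N j"] by simp
    with * m show ?thesis by (intro exI[of _ m]) simp
  qed
  then obtain m where m: "\<And>k. N (m k) \<le> k" "\<And>k. k < N (m k + 1)" by metis
  have m_top: "filterlim m at_top sequentially"
    unfolding filterlim_at_top
  proof
    fix A
    have "A \<le> m k" if "N A \<le> k" for k
    proof (rule ccontr)
      assume "\<not> A \<le> m k"
      then have "N (m k + 1) \<le> N A" using N by (simp add: strict_mono_less_eq)
      with m(2)[of k] that show False by simp
    qed
    then show "\<forall>\<^sub>F k in sequentially. A \<le> m k" unfolding eventually_sequentially by blast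
  qed
  define d where "d j = (real (N (j + 1)) - real (N j)) / real j" for j
  have d0: "d \<longlonglongrightarrow> 0" unfolding d_def by (rule gap_tendsto_0[OF lim_N])
  note dm = filterlim_compose[OF d0 m_top]
  have 1: "(\<lambda>k. b k / real (m k)) \<longlonglongrightarrow> g"
  proof (rule Lim_transform[OF filterlim_compose[OF lim_b m_top]])
    have Cd: "(\<lambda>k. C * d (m k)) \<longlonglongrightarrow> 0" using tendsto_mult_left[OF dm, of C] by simp
    show "(\<lambda>k. b k / real (m k) - b (N (m k)) / real (m k)) \<longlonglongrightarrow> 0"
    proof (rule Lim_null_comparison[OF _ Cd])
      have "norm (b k / real (m k) - b (N (m k)) / real (m k)) \<le> C * d (m k)" for k
      proof -
        have "norm (b k / real (m k) - b (N (m k)) / real (m k)) = \<bar>b k - b (N (m k))\<bar> / real (m k)"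
          by (simp add: diff_divide_distrib[symmetric] abs_minus_commute)
        also have "\<dots> \<le> (C * (real (N (m k + 1)) - real (N (m k)))) / real (m k)"
          using step[of "m k" k] m(1)[of k] less_imp_le[OF m(2)[of k]] by (intro divide_right_mono) auto
        finally show ?thesis by (simp add: d_def)
      qed
      then show "\<forall>\<^sub>F k in sequentially. norm (b k / real (m k) - b (N (m k)) / real (m k)) \<le> C * d (m k)"
        by simp
    qed
  qed
  have 2: "(\<lambda>k. real k / real (m k)) \<longlonglongrightarrow> \<nu>"
  proof (rule Lim_transform[OF filterlim_compose[OF lim_N m_top]])
    show "(\<lambda>k. real k / real (m k) - real (N (m k)) / real (m k)) \<longlonglongrightarrow> 0"
    proof (rule Lim_null_comparison[OF _ dm])
      have "norm (real k / real (m k) - real (N (m k)) / real (m k)) \<le> d (m k)" for k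
        using m(1)[of k] m(2)[of k]
        by (auto simp: d_def diff_divide_distrib[symmetric] intro!: divide_right_mono)
      then show "\<forall>\<^sub>F k in sequentially. norm (real k / real (m k) - real (N (m k)) / real (m k)) \<le> d (m k)"
        by simp
    qed
  qed
  have "(\<lambda>k. (b k / real (m k)) / (real k / real (m k))) \<longlonglongrightarrow> g / \<nu>"
    using \<open>0 < \<nu>\<close> by (intro tendsto_divide 1 2) simp
  moreover have "\<forall>\<^sub>F k in sequentially. (b k / real (m k)) / (real k / real (m k)) = b k / real k"
  proof -
    have "\<forall>\<^sub>F k in sequentially. 1 \<le> m k" using m_top unfolding filterlim_at_top by blast
    then show ?thesis by eventually_elim simp
  qed
  ultimately show ?thesis by (rule Lim_transform_eventually)
qed

section \<open>Almost sure growth of level sums\<close>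

text \<open>A common Lipschitz constant in the parameter transfers convergence from a dense set to
  all parameters. It allows the ergodic theorem to be invoked only countably often.\<close>

lemma tendsto_of_equicontinuous_rationals:
  fixes h :: "real \<Rightarrow> nat \<Rightarrow> real"
  assumes rat: "\<And>q. q \<in> \<rat> \<Longrightarrow> 0 \<le> q \<Longrightarrow> h q \<longlonglongrightarrow> g q"
    and h: "\<And>\<alpha> \<beta> m. 0 \<le> \<alpha> \<Longrightarrow> \<alpha> \<le> \<beta> \<Longrightarrow> \<bar>h \<beta> m - h \<alpha> m\<bar> \<le> K * (\<beta> - \<alpha>)"
    and g: "\<And>\<alpha> \<beta>. 0 \<le> \<alpha> \<Longrightarrow> \<alpha> \<le> \<beta> \<Longrightarrow> \<bar>g \<beta> - g \<alpha>\<bar> \<le> K * (\<beta> - \<alpha>)"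
    and "0 \<le> K" "0 \<le> \<alpha>"
  shows "h \<alpha> \<longlonglongrightarrow> g \<alpha>"
proof (rule LIMSEQ_I)
  fix e :: real assume "0 < e"
  then obtain q where q: "q \<in> \<rat>" "\<alpha> < q" "q < \<alpha> + e / (3 * (K + 1))"
    using Rats_dense_in_real[of \<alpha> "\<alpha> + e / (3 * (K + 1))"] \<open>0 \<le> K\<close> by auto
  then have "(K + 1) * (q - \<alpha>) < e / 3" using \<open>0 \<le> K\<close> by (simp add: field_simps)
  then have K: "K * (q - \<alpha>) < e / 3" using q(2) by (simp add: algebra_simps)
  obtain n where n: "\<And>m. n \<le> m \<Longrightarrow> norm (h q m - g q) < e / 3"
    using LIMSEQ_D[OF rat, of q "e / 3"] q \<open>0 \<le> \<alpha>\<close> \<open>0 < e\<close> by auto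
  have "norm (h \<alpha> m - g \<alpha>) < e" if "n \<le> m" for m
    using n[OF that] h[OF \<open>0 \<le> \<alpha>\<close> less_imp_le[OF q(2)], of m] g[OF \<open>0 \<le> \<alpha>\<close> less_imp_le[OF q(2)]] K
    unfolding real_norm_def by linarith
  then show "\<exists>n. \<forall>m\<ge>n. norm (h \<alpha> m - g \<alpha>) < e" by blast
qed

context similarity_tree
begin

text \<open>Collects what the ergodic theorem provides almost surely. The dimension arguments below
  treat one fixed tree with this property.\<close>

definition regular_tree :: "real \<Rightarrow> (real \<Rightarrow> real) \<Rightarrow> (nat list \<Rightarrow> 'l) \<Rightarrow> (nat \<Rightarrow> nat) \<Rightarrow> bool" where
  "regular_tree \<nu> g \<omega> N \<longleftrightarrow> (\<omega>, N) \<in> necked_trees M \<and> (\<lambda>m. real (N m) / real m) \<longlonglongrightarrow> \<nu> \<and>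
     (\<forall>\<alpha>\<ge>0. (\<lambda>m. ln (level_sum M T \<omega> (N m) \<alpha>) / real m) \<longlonglongrightarrow> g \<alpha>)"

text \<open>The logarithm of the first block sum is dominated by a multiple of \<open>N 1\<close>,
  hence integrable, and its Birkhoff sums telescope to the logarithms of the level sums at necks.
  The limits are the expectations of these two functions of the first block.\<close>

lemma AE_regular_tree:
  assumes "prob_space P" and P_sets: "sets P = sets (neck_borel M)"
    and inv: "invariant_measure P (neck_shift M)" and erg: "ergodic_measure P (neck_shift M)"
    and fin: "(\<integral>\<^sup>+ (\<omega>, N). ennreal (real (N 1)) \<partial>P) < \<infinity>"
  obtains \<nu> g where "1 \<le> \<nu>" "0 \<le> g 0"
    "\<And>\<alpha> \<beta>. \<alpha> \<le> \<beta> \<Longrightarrow> \<nu> * ((\<beta> - \<alpha>) * ln lo) \<le> g \<beta> - g \<alpha> \<and> g \<beta> - g \<alpha> \<le> \<nu> * ((\<beta> - \<alpha>) * ln hi)"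
    "AE (\<omega>, N) in P. regular_tree \<nu> g \<omega> N"
proof -
  interpret prob_space P by fact
  have space_P: "space P = necked_trees M" using sets_eq_imp_space_eq[OF P_sets] by simp
  have meas_eq: "measurable P P = measurable (neck_borel M) (neck_borel M)"
    "borel_measurable P = borel_measurable (neck_borel M)"
    using P_sets by (auto cong: measurable_cong_sets)
  have shift: "neck_shift M \<in> measurable P P"
    unfolding meas_eq by (rule measurable_neck_shift[OF M_pos])
  define f1 where "f1 x = real (snd x 1)" for x :: "'l necked"
  define f where "f \<alpha> x = ln (level_sum M T (fst x) (snd x 1) \<alpha>)" for \<alpha> and x :: "'l necked"
  have f1_meas: "f1 \<in> borel_measurable P"
    unfolding meas_eq
    by (rule measurable_neck_borel_locally_constant) (auto simp: f1_def neck_cylinder_iff)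
  have f_meas: "f \<alpha> \<in> borel_measurable P" for \<alpha>
    unfolding meas_eq
  proof (rule measurable_neck_borel_locally_constant)
    fix x y assume "y \<in> neck_cylinder M x 1"
    then have N: "snd y 1 = snd x 1" and \<omega>: "\<And>\<rho>. length \<rho> < snd x 1 \<Longrightarrow> fst y \<rho> = fst x \<rho>"
      by (auto simp: neck_cylinder_iff)
    have "level M (fst y) (snd x 1) = level M (fst x) (snd x 1)" by (rule level_cong) (rule \<omega>)
    moreover have "weight r (fst y) \<tau> = weight r (fst x) \<tau>" if "\<tau> \<in> level M (fst x) (snd x 1)" for \<tau>
      by (rule weight_cong) (use that \<omega> in \<open>simp add: level_def\<close>)
    ultimately show "f \<alpha> y = f \<alpha> x" unfolding f_def level_sum_eq N by simp
  qed simp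
  have f1_int: "integrable P f1"
  proof (rule integrableI_nonneg[OF f1_meas])
    show "(\<integral>\<^sup>+x. ennreal (f1 x) \<partial>P) < \<infinity>" using fin by (simp add: f1_def case_prod_unfold)
  qed (simp add: f1_def)
  have f_bound: "\<bar>f \<alpha> x\<bar> \<le> growth_bound \<alpha> * f1 x" if "0 \<le> \<alpha>" for \<alpha> x
    unfolding f_def f1_def by (rule abs_ln_level_sum_le[OF that])
  have f_int0: "integrable P (f \<alpha>)" if "0 \<le> \<alpha>" for \<alpha>
  proof (rule Bochner_Integration.integrable_bound[where f="\<lambda>x. growth_bound \<alpha> * f1 x"])
    show "AE x in P. norm (f \<alpha> x) \<le> norm (growth_bound \<alpha> * f1 x)"
    proof (rule AE_I2)
      fix x show "norm (f \<alpha> x) \<le> norm (growth_bound \<alpha> * f1 x)"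
        using f_bound[OF that, of x] unfolding real_norm_def by linarith
    qed
  qed (use f1_int f_meas in auto)
  have f_diff: "f1 x * ((\<beta> - \<alpha>) * ln lo) \<le> f \<beta> x - f \<alpha> x" "f \<beta> x - f \<alpha> x \<le> f1 x * ((\<beta> - \<alpha>) * ln hi)"
    if "\<alpha> \<le> \<beta>" for \<alpha> \<beta> x
    unfolding f_def f1_def by (rule ln_level_sum_diff[OF that])+
  \<comment> \<open>The bound by \<open>growth_bound\<close> covers nonnegative exponents only.
    Negative ones are compared with exponent 0, so that \<open>g\<close> is defined by an integrable
    function, and monotone, on the whole line.\<close>
  have f_int: "integrable P (f \<alpha>)" for \<alpha>
  proof (cases "0 \<le> \<alpha>")
    case False
    have "integrable P (\<lambda>x. f \<alpha> x - f 0 x)"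
    proof (rule Bochner_Integration.integrable_bound[where f="\<lambda>x. f1 x * ((0 - \<alpha>) * ln lo)"])
      show "AE x in P. norm (f \<alpha> x - f 0 x) \<le> norm (f1 x * ((0 - \<alpha>) * ln lo))"
      proof (rule AE_I2)
        fix x
        have "f1 x * ((0 - \<alpha>) * ln hi) \<le> 0"
          using False ln_hi_neg by (intro mult_nonneg_nonpos) (auto simp: f1_def mult_nonneg_nonpos mult_nonpos_nonpos)
        then show "norm (f \<alpha> x - f 0 x) \<le> norm (f1 x * ((0 - \<alpha>) * ln lo))"
          using f_diff[of \<alpha> 0 x] False unfolding real_norm_def by linarith
      qed
    qed (use f1_int f_meas in auto)
    from Bochner_Integration.integrable_add[OF this f_int0[of 0]] show ?thesis by simp
  qed (rule f_int0)
  define \<nu> where "\<nu> = integral\<^sup>L P f1"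
  define g where "g \<alpha> = integral\<^sup>L P (f \<alpha>)" for \<alpha>
  have "1 \<le> \<nu>"
  proof -
    have "integral\<^sup>L P (\<lambda>x. 1) \<le> \<nu>"
      unfolding \<nu>_def
    proof (rule integral_mono_AE[OF _ f1_int AE_I2])
      fix x assume "x \<in> space P"
      then have "(fst x, snd x) \<in> necked_trees M" by (simp add: space_P)
      from necked_N(2)[OF this] have "snd x 0 < snd x 1" by (rule strict_monoD) simp
      then show "1 \<le> f1 x" by (simp add: f1_def)
    qed simp
    then show ?thesis by (simp add: prob_space)
  qed
  have "0 \<le> g 0"
    unfolding g_def
  proof (rule integral_nonneg_AE[OF AE_I2])
    fix x :: "'l necked"
    have "1 \<le> level_sum M T (fst x) (snd x 1) 0" using level_sum_ge[of 0 "snd x 1" "fst x"] lo_pos by simp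
    then show "0 \<le> f 0 x" by (simp add: f_def)
  qed
  have g_diff: "\<nu> * ((\<beta> - \<alpha>) * ln lo) \<le> g \<beta> - g \<alpha> \<and> g \<beta> - g \<alpha> \<le> \<nu> * ((\<beta> - \<alpha>) * ln hi)"
    if "\<alpha> \<le> \<beta>" for \<alpha> \<beta>
  proof -
    have eq: "g \<beta> - g \<alpha> = integral\<^sup>L P (\<lambda>x. f \<beta> x - f \<alpha> x)"
      using f_int by (simp add: g_def)
    have c: "\<nu> * c = integral\<^sup>L P (\<lambda>x. f1 x * c)" for c by (simp add: \<nu>_def)
    show ?thesis
      unfolding eq c using f_int f1_int by (intro conjI integral_mono f_diff[OF that]) auto
  qed
  have erg1: "AE x in P. (\<lambda>n. (\<Sum>i<n. f1 ((neck_shift M ^^ i) x)) / real n) \<longlonglongrightarrow> \<nu>"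
    unfolding \<nu>_def by (rule birkhoff_ergodic[OF \<open>prob_space P\<close> shift inv erg f1_int])
  have erg2: "AE x in P. \<forall>q\<in>\<rat> \<inter> {0..}. (\<lambda>n. (\<Sum>i<n. f q ((neck_shift M ^^ i) x)) / real n) \<longlonglongrightarrow> g q"
    unfolding g_def
    by (subst AE_ball_countable)
      (auto intro!: birkhoff_ergodic[OF \<open>prob_space P\<close> shift inv erg f_int] countable_Int1 countable_rat)
  have "AE (\<omega>, N) in P. regular_tree \<nu> g \<omega> N"
    using erg1 erg2 AE_space
  proof eventually_elim
    case (elim x)
    obtain \<omega> N where x: "x = (\<omega>, N)" by (cases x)
    then have nt: "(\<omega>, N) \<in> necked_trees M" using elim(3) space_P by simp
    note sh = neck_shift_funpow[OF nt M_pos]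
    have "(\<Sum>i<n. f1 ((neck_shift M ^^ i) x)) = real (N n)" for n
    proof (induction n)
      case 0
      then show ?case using necked_N[OF nt] by simp
    next
      case (Suc n)
      then show ?case using necked_N_le[OF nt, of n 1] by (simp add: x sh f1_def of_nat_diff)
    qed
    with elim(1) have 1: "(\<lambda>n. real (N n) / real n) \<longlonglongrightarrow> \<nu>" by simp
    have "(\<Sum>i<n. f q ((neck_shift M ^^ i) x)) = ln (level_sum M T \<omega> (N n) q)" for n q
      unfolding ln_level_sum_neck[OF nt] by (simp add: x sh f_def)
    with elim(2) have 2: "(\<lambda>n. ln (level_sum M T \<omega> (N n) q) / real n) \<longlonglongrightarrow> g q" if "q \<in> \<rat>" "0 \<le> q" for q
      using that by simp
    obtain K0 where "0 < K0" and K0': "\<And>n. norm (real (N n) / real n) \<le> K0"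
      using convergent_imp_Bseq[OF convergentI[OF 1]] by (auto simp: Bseq_def)
    have K0: "real (N n) / real n \<le> K0" "0 \<le> real (N n) / real n" for n using K0'[of n] by simp_all
    \<comment> \<open>One Lipschitz constant for the approximants, whose slopes involve
      \<open>N n / n\<close>, and for the limit, whose slopes involve their limit.\<close>
    define K where "K = max K0 \<nu> * (- ln lo)"
    have "0 \<le> K" using \<open>0 < K0\<close> ln_lo_neg by (simp add: K_def mult_nonneg_nonpos)
    have bd: "\<bar>d\<bar> \<le> K * (\<beta> - \<alpha>)" if d: "c * ((\<beta> - \<alpha>) * ln lo) \<le> d" "d \<le> c * ((\<beta> - \<alpha>) * ln hi)"
      and c: "0 \<le> c" "c \<le> max K0 \<nu>" and "\<alpha> \<le> \<beta>" for c d \<alpha> \<beta>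
    proof -
      have "c * ((\<beta> - \<alpha>) * ln hi) \<le> 0"
        using c \<open>\<alpha> \<le> \<beta>\<close> ln_hi_neg by (intro mult_nonneg_nonpos) (auto simp: mult_nonneg_nonpos)
      moreover have "c * ((\<beta> - \<alpha>) * (- ln lo)) \<le> max K0 \<nu> * ((\<beta> - \<alpha>) * (- ln lo))"
        using c \<open>\<alpha> \<le> \<beta>\<close> ln_lo_neg by (intro mult_right_mono mult_nonneg_nonneg) auto
      ultimately show ?thesis using d by (simp add: K_def abs_le_iff algebra_simps)
    qed
    have "(\<lambda>n. ln (level_sum M T \<omega> (N n) \<alpha>) / real n) \<longlonglongrightarrow> g \<alpha>" if "0 \<le> \<alpha>" for \<alpha>
    proof (rule tendsto_of_equicontinuous_rationals[OF 2 _ _ \<open>0 \<le> K\<close> that])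
      fix \<alpha> \<beta> :: real and n assume "\<alpha> \<le> \<beta>"
      show "\<bar>g \<beta> - g \<alpha>\<bar> \<le> K * (\<beta> - \<alpha>)"
        using g_diff[OF \<open>\<alpha> \<le> \<beta>\<close>] \<open>1 \<le> \<nu>\<close> \<open>\<alpha> \<le> \<beta>\<close> by (intro bd[of \<nu>]) auto
      have "real (N n) / real n * ((\<beta> - \<alpha>) * ln lo)
          \<le> (ln (level_sum M T \<omega> (N n) \<beta>) - ln (level_sum M T \<omega> (N n) \<alpha>)) / real n"
        using divide_right_mono[OF ln_level_sum_diff(1)[OF \<open>\<alpha> \<le> \<beta>\<close>, of "N n" \<omega>], of "real n"] by simp
      moreover have "(ln (level_sum M T \<omega> (N n) \<beta>) - ln (level_sum M T \<omega> (N n) \<alpha>)) / real n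
          \<le> real (N n) / real n * ((\<beta> - \<alpha>) * ln hi)"
        using divide_right_mono[OF ln_level_sum_diff(2)[OF \<open>\<alpha> \<le> \<beta>\<close>, of \<omega> "N n"], of "real n"] by simp
      ultimately show "\<bar>ln (level_sum M T \<omega> (N n) \<beta>) / real n - ln (level_sum M T \<omega> (N n) \<alpha>) / real n\<bar> \<le> K * (\<beta> - \<alpha>)"
        unfolding diff_divide_distrib[symmetric]
        by (rule bd) (use K0[of n] \<open>\<alpha> \<le> \<beta>\<close> in auto)
    qed
    then show ?case using nt 1 by (simp add: x regular_tree_def)
  qed
  with \<open>1 \<le> \<nu>\<close> \<open>0 \<le> g 0\<close> g_diff show ?thesis by (rule that)
qed

text \<open>Growth is known per neck; dividing by the mean block length turns it into growth per
  level. Inside a block the logarithm changes by at most \<open>growth_bound\<close> times the block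
  length.\<close>

lemma regular_tree_pressure:
  assumes reg: "regular_tree \<nu> g \<omega> N" and "1 \<le> \<nu>" "0 \<le> \<alpha>"
  shows "(\<lambda>k. ln (level_sum M T \<omega> k \<alpha>) / real k) \<longlonglongrightarrow> g \<alpha> / \<nu>"
proof -
  have nt: "(\<omega>, N) \<in> necked_trees M" using reg by (simp add: regular_tree_def)
  show ?thesis
  proof (rule limit_along_blocks[where N=N and C="growth_bound \<alpha>"])
    fix m k assume k: "N m \<le> k" "k \<le> N (m + 1)"
    have "ln (level_sum M T \<omega> k \<alpha>) - ln (level_sum M T \<omega> (N m) \<alpha>)
        = ln (level_sum M T (neck_tail M \<omega> N m) (k - N m) \<alpha>)"
      using ln_level_sum_neck_add[OF nt, of m "k - N m" \<alpha>] k by simp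
    then have "\<bar>ln (level_sum M T \<omega> k \<alpha>) - ln (level_sum M T \<omega> (N m) \<alpha>)\<bar> \<le> growth_bound \<alpha> * real (k - N m)"
      using abs_ln_level_sum_le[OF \<open>0 \<le> \<alpha>\<close>] by simp
    moreover have "0 \<le> growth_bound \<alpha>"
    proof -
      have "0 \<le> ln (real B)" using B_pos by simp
      moreover have "\<alpha> * ln lo \<le> 0" using \<open>0 \<le> \<alpha>\<close> ln_lo_neg by (intro mult_nonneg_nonpos) auto
      ultimately show ?thesis by (simp add: growth_bound_def)
    qed
    then have "growth_bound \<alpha> * real (k - N m) \<le> growth_bound \<alpha> * (real (N (m + 1)) - real (N m))"
      using k by (intro mult_left_mono) auto
    ultimately show "\<bar>ln (level_sum M T \<omega> k \<alpha>) - ln (level_sum M T \<omega> (N m) \<alpha>)\<bar>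
        \<le> growth_bound \<alpha> * (real (N (m + 1)) - real (N m))" by linarith
  qed (use assms necked_N[OF nt] in \<open>auto simp: regular_tree_def\<close>)
qed

text \<open>The slopes of \<open>g\<close> lie between two negative constants. The steeper one gives
  continuity, the flatter one strict decrease and a point where \<open>g\<close> is no longer
  positive.\<close>

lemma zero_of_growth_rate:
  assumes "1 \<le> \<nu>" "0 \<le> g 0"
    and g: "\<And>\<alpha> \<beta>. \<alpha> \<le> \<beta> \<Longrightarrow> \<nu> * ((\<beta> - \<alpha>) * ln lo) \<le> g \<beta> - g \<alpha> \<and> g \<beta> - g \<alpha> \<le> \<nu> * ((\<beta> - \<alpha>) * ln hi)"
  obtains \<alpha>\<^sub>0 where "0 \<le> \<alpha>\<^sub>0" "g \<alpha>\<^sub>0 = 0" "\<And>\<alpha>. \<alpha> < \<alpha>\<^sub>0 \<Longrightarrow> 0 < g \<alpha>" "\<And>\<alpha>. \<alpha>\<^sub>0 < \<alpha> \<Longrightarrow> g \<alpha> < 0"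
proof -
  have "(\<nu> * - ln lo)-lipschitz_on UNIV g"
  proof (rule lipschitz_on_leI)
    fix x y :: real assume "x \<le> y"
    have "\<nu> * ((y - x) * ln hi) \<le> 0"
      using \<open>1 \<le> \<nu>\<close> \<open>x \<le> y\<close> ln_hi_neg by (intro mult_nonneg_nonpos) (auto simp: mult_nonneg_nonpos)
    with g[OF \<open>x \<le> y\<close>] show "dist (g x) (g y) \<le> \<nu> * - ln lo * dist x y"
      using \<open>x \<le> y\<close> by (simp add: dist_real_def abs_le_iff algebra_simps)
  qed (use \<open>1 \<le> \<nu>\<close> ln_lo_neg in \<open>simp add: mult_nonneg_nonpos\<close>)
  then have cont: "continuous_on {0..b} g" for b
    by (meson continuous_on_subset lipschitz_on_continuous_on subset_UNIV)
  \<comment> \<open>Here the line of slope \<open>\<nu> * ln hi\<close> through the value at 0,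
    which lies above \<open>g\<close> to the right of 0, reaches zero.\<close>
  define b where "b = g 0 / (\<nu> * - ln hi)"
  have pos: "0 < \<nu> * - ln hi" using \<open>1 \<le> \<nu>\<close> ln_hi_neg by (intro mult_pos_pos) auto
  have "0 \<le> b" unfolding b_def using \<open>0 \<le> g 0\<close> pos by (intro divide_nonneg_pos)
  moreover have "g b \<le> 0"
  proof -
    have "b * (\<nu> * - ln hi) = g 0" 
      by (rule iffD1[OF nonzero_divide_eq_eq[OF less_imp_neq[OF pos, symmetric]] b_def[symmetric], symmetric])
    then show ?thesis using g[OF \<open>0 \<le> b\<close>] by (simp add: algebra_simps)
  qed
  ultimately obtain \<alpha>\<^sub>0 where \<alpha>\<^sub>0: "0 \<le> \<alpha>\<^sub>0" "g \<alpha>\<^sub>0 = 0"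
    using IVT2'[of g b 0 0] \<open>0 \<le> g 0\<close> cont by auto
  have dec: "g \<beta> < g \<alpha>" if "\<alpha> < \<beta>" for \<alpha> \<beta>
  proof -
    have "\<nu> * ((\<beta> - \<alpha>) * ln hi) < 0"
      using \<open>1 \<le> \<nu>\<close> that ln_hi_neg by (intro mult_pos_neg) (auto simp: mult_pos_neg)
    with g[of \<alpha> \<beta>] that show ?thesis by linarith
  qed
  show ?thesis by (rule that[of \<alpha>\<^sub>0]) (use \<alpha>\<^sub>0 dec[of _ \<alpha>\<^sub>0] dec[of \<alpha>\<^sub>0] in auto)
qed

end

declare comp_along.simps(2) [simp del]

section \<open>The projection and its dependence on the translations\<close>

lemma prefix_split: "map u [0..<k + j] = map u [0..<k] @ map (\<lambda>n. u (n + k)) [0..<j]"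
  by (rule nth_equalityI) (auto simp: nth_append)

locale translated_tree = similarity_tree M T r B lo hi
  for M :: "'l \<Rightarrow> nat" and T :: "'l \<Rightarrow> nat \<Rightarrow> 'a::euclidean_space \<Rightarrow> 'a" and r B lo hi +
  fixes R :: "('l \<times> nat) rel"
  assumes R_equiv: "equiv (map_indices M) R"
    and R_finite: "finite (map_indices M // R)"
    and R_separates: "i \<in> {1..M l} \<Longrightarrow> j \<in> {1..M l} \<Longrightarrow> ((l, i), (l, j)) \<in> R \<longleftrightarrow> i = j"
begin

abbreviation classes :: "('l \<times> nat) set set" where
  "classes \<equiv> map_indices M // R"

abbreviation F :: "('l, 'a) translation \<Rightarrow> (nat list \<Rightarrow> 'l) \<Rightarrow> nat list \<Rightarrow> 'a \<Rightarrow> 'a" where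
  "F a \<omega> \<tau> \<equiv> comp_along (ifs_map T R a) \<omega> [] \<tau>"

lemma class_in: "i \<in> {1..M l} \<Longrightarrow> R `` {(l, i)} \<in> classes"
  by (auto simp: map_indices_def intro!: quotientI)

lemma class_neq:
  assumes "i \<in> {1..M l}" "j \<in> {1..M l}" "i \<noteq> j"
  shows "R `` {(l, i)} \<noteq> R `` {(l, j)}"
  using eq_equiv_class[OF _ R_equiv, of "(l, i)" "(l, j)"] R_separates[OF assms(1,2)] assms
  by (auto simp: map_indices_def)

lemma F_Cons: "F a \<omega> (i # \<tau>) x = T (\<omega> []) i (F a (subtree \<omega> [i]) \<tau> x) + a (R `` {(\<omega> [], i)})"
  by (simp add: comp_along_Cons ifs_map_def del: comp_along.simps)

lemma F_diff:
  "\<tau> \<in> tree_words M \<omega> \<Longrightarrow> F a \<omega> \<tau> x - F a \<omega> \<tau> y = comp_along T \<omega> [] \<tau> (x - y)"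
proof (induction \<tau> arbitrary: \<omega>)
  case (Cons i \<tau>)
  then have i: "i \<in> {1..M (\<omega> [])}" and "\<tau> \<in> tree_words M (subtree \<omega> [i])" by (simp_all only: tree_words_Cons)
  with Cons.IH have "F a (subtree \<omega> [i]) \<tau> x - F a (subtree \<omega> [i]) \<tau> y = comp_along T (subtree \<omega> [i]) [] \<tau> (x - y)"
    by blast
  then show ?case
    unfolding F_Cons unfolding comp_along_Cons by (simp add: linear_diff[OF T_linear[OF i], symmetric])
qed simp

lemma dist_F: "\<tau> \<in> tree_words M \<omega> \<Longrightarrow> dist (F a \<omega> \<tau> x) (F a \<omega> \<tau> y) = weight r \<omega> \<tau> * dist x y"
  by (simp add: dist_norm F_diff comp_along_similarity)

text \<open>The value at 0 depends linearly on the translations. Transversality thereby reduces to a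
  lower bound for a linear map.\<close>

lemma F_translation_diff:
  "\<tau> \<in> tree_words M \<omega> \<Longrightarrow> F (\<lambda>c. a c - b c) \<omega> \<tau> 0 = F a \<omega> \<tau> 0 - F b \<omega> \<tau> 0"
proof (induction \<tau> arbitrary: \<omega>)
  case (Cons i \<tau>)
  then have i: "i \<in> {1..M (\<omega> [])}" and "\<tau> \<in> tree_words M (subtree \<omega> [i])" by (simp_all only: tree_words_Cons)
  with Cons.IH show ?case
    unfolding F_Cons by (simp add: linear_diff[OF T_linear[OF i]])
qed simp

text \<open>\<open>2 * A\<close> is the fixed point of x -> x / 2 + A, and one step is bounded by
  this map because the ratios are below 1/2.\<close>

lemma norm_F_le:
  assumes A: "\<And>c. c \<in> classes \<Longrightarrow> norm (a c) \<le> A" "0 \<le> A"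
  shows "\<tau> \<in> tree_words M \<omega> \<Longrightarrow> norm (F a \<omega> \<tau> 0) \<le> 2 * A"
proof (induction \<tau> arbitrary: \<omega>)
  case Nil
  then show ?case using A(2) by simp
next
  case (Cons i \<tau>)
  then have i: "i \<in> {1..M (\<omega> [])}" and "\<tau> \<in> tree_words M (subtree \<omega> [i])" by (simp_all only: tree_words_Cons)
  with Cons.IH have IH: "norm (F a (subtree \<omega> [i]) \<tau> 0) \<le> 2 * A" by blast
  have "norm (F a \<omega> (i # \<tau>) 0) \<le> norm (T (\<omega> []) i (F a (subtree \<omega> [i]) \<tau> 0)) + norm (a (R `` {(\<omega> [], i)}))"
    unfolding F_Cons by (rule norm_triangle_ineq)
  also have "norm (a (R `` {(\<omega> [], i)})) \<le> A" by (rule A(1)[OF class_in[OF i]])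
  also have "norm (T (\<omega> []) i (F a (subtree \<omega> [i]) \<tau> 0)) \<le> 1 / 2 * (2 * A)"
    unfolding T_norm[OF i] using r_le[OF i] hi_less IH by (intro mult_mono) auto
  finally show ?case by simp
qed

section \<open>Convergence of the projection\<close>

definition trans_bound :: "('l, 'a) translation \<Rightarrow> real" where
  "trans_bound a = (\<Sum>c\<in>classes. norm (a c))"

lemma trans_bound: "c \<in> classes \<Longrightarrow> norm (a c) \<le> trans_bound a" "0 \<le> trans_bound a"
  unfolding trans_bound_def using R_finite by (auto intro!: member_le_sum sum_nonneg)

lemma boundary_level: "u \<in> tree_boundary M \<omega> \<Longrightarrow> map u [0..<k] \<in> level M \<omega> k"
  by (simp add: tree_boundary_def level_def)

lemma boundary_shift:
  assumes "u \<in> tree_boundary M \<omega>"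
  shows "(\<lambda>n. u (n + k)) \<in> tree_boundary M (subtree \<omega> (map u [0..<k]))"
  unfolding tree_boundary_def
proof (intro CollectI allI)
  fix j
  have "map u [0..<k] @ map (\<lambda>n. u (n + k)) [0..<j] \<in> tree_words M \<omega>"
    using assms unfolding tree_boundary_def prefix_split[symmetric] by blast
  then show "map (\<lambda>n. u (n + k)) [0..<j] \<in> tree_words M (subtree \<omega> (map u [0..<k]))"
    unfolding tree_words_append by blast
qed

text \<open>Whatever follows the prefix produces a point of norm at most
  \<open>2 * trans_bound a\<close>, which the prefix then scales by its weight. Convergence of the
  projection and the covers of the attractor both rest on this.\<close>

lemma F_prefix_dist:
  assumes u: "u \<in> tree_boundary M \<omega>"
  shows "dist (F a \<omega> (map u [0..<k + j]) 0) (F a \<omega> (map u [0..<k]) 0)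
    \<le> weight r \<omega> (map u [0..<k]) * (2 * trans_bound a)"
proof -
  have w: "map u [0..<k] \<in> tree_words M \<omega>" using boundary_level[OF u] by (simp add: level_def)
  have "map (\<lambda>n. u (n + k)) [0..<j] \<in> tree_words M (subtree \<omega> (map u [0..<k]))"
    using boundary_level[OF boundary_shift[OF u]] by (simp add: level_def)
  then have "norm (F a (subtree \<omega> (map u [0..<k])) (map (\<lambda>n. u (n + k)) [0..<j]) 0) \<le> 2 * trans_bound a"
    by (intro norm_F_le trans_bound)
  then show ?thesis
    unfolding prefix_split comp_along_append o_apply dist_F[OF w]
    using weight_pos[OF w] by (intro mult_left_mono) auto
qed

lemma projection_tendsto:
  assumes u: "u \<in> tree_boundary M \<omega>"
  shows "(\<lambda>k. F a \<omega> (map u [0..<k]) 0) \<longlonglongrightarrow> projection T R a \<omega> u"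
proof -
  have "Cauchy (\<lambda>k. F a \<omega> (map u [0..<k]) 0)"
  proof (rule metric_CauchyI)
    fix e :: real assume "0 < e"
    have "(\<lambda>k. hi ^ k * (2 * trans_bound a)) \<longlonglongrightarrow> 0"
      using hi_pos hi_less by (intro tendsto_mult_left_zero LIMSEQ_power_zero) auto
    then have "\<forall>\<^sub>F k in sequentially. hi ^ k * (2 * trans_bound a) < e / 2"
      using \<open>0 < e\<close> by (intro order_tendstoD(2)) auto
    then obtain k where k: "hi ^ k * (2 * trans_bound a) < e / 2"
      using eventually_happens[of _ sequentially] by (auto simp: trivial_limit_sequentially)
    have w: "map u [0..<k] \<in> tree_words M \<omega>" using boundary_level[OF u] by (simp add: level_def)
    have le: "dist (F a \<omega> (map u [0..<n]) 0) (F a \<omega> (map u [0..<k]) 0) < e / 2" if kn: "k \<le> n" for n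
    proof -
      obtain j where n: "n = k + j" using le_Suc_ex[OF kn] by blast
      have "dist (F a \<omega> (map u [0..<n]) 0) (F a \<omega> (map u [0..<k]) 0) \<le> weight r \<omega> (map u [0..<k]) * (2 * trans_bound a)"
        unfolding n by (rule F_prefix_dist[OF u])
      also have "\<dots> \<le> hi ^ k * (2 * trans_bound a)"
        using weight_bounds[OF w] trans_bound(2) by (intro mult_right_mono) auto
      finally show ?thesis using k by linarith
    qed
    have "dist (F a \<omega> (map u [0..<m]) 0) (F a \<omega> (map u [0..<n]) 0) < e" if "k \<le> m" "k \<le> n" for m n
      by (rule dist_triangle_half_l[OF le[OF that(1)] le[OF that(2)]])
    then show "\<exists>k. \<forall>m\<ge>k. \<forall>n\<ge>k. dist (F a \<omega> (map u [0..<m]) 0) (F a \<omega> (map u [0..<n]) 0) < e"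
      by blast
  qed
  then show ?thesis
    unfolding projection_def by (simp add: Cauchy_convergent_iff convergent_LIMSEQ_iff)
qed

lemma dist_projection_le:
  assumes u: "u \<in> tree_boundary M \<omega>"
  shows "dist (projection T R a \<omega> u) (F a \<omega> (map u [0..<k]) 0)
    \<le> weight r \<omega> (map u [0..<k]) * (2 * trans_bound a)"
proof (rule LIMSEQ_le_const2)
  show "(\<lambda>j. dist (F a \<omega> (map u [0..<j]) 0) (F a \<omega> (map u [0..<k]) 0))
      \<longlonglongrightarrow> dist (projection T R a \<omega> u) (F a \<omega> (map u [0..<k]) 0)"
    by (intro tendsto_dist projection_tendsto[OF u] tendsto_const)
  have "dist (F a \<omega> (map u [0..<j]) 0) (F a \<omega> (map u [0..<k]) 0)
      \<le> weight r \<omega> (map u [0..<k]) * (2 * trans_bound a)" if "k \<le> j" for j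
    using F_prefix_dist[OF u, of a k "j - k"] that by simp
  then show "\<exists>n. \<forall>j\<ge>n. dist (F a \<omega> (map u [0..<j]) 0) (F a \<omega> (map u [0..<k]) 0)
      \<le> weight r \<omega> (map u [0..<k]) * (2 * trans_bound a)" by blast
qed

lemma bounded_attractor: "bounded (attractor M T R a \<omega>)"
  unfolding attractor_def bounded_iff
proof (intro exI ballI)
  fix x assume "x \<in> projection T R a \<omega> ` tree_boundary M \<omega>"
  then show "norm x \<le> 2 * trans_bound a"
    using dist_projection_le[of _ \<omega> a 0] by auto
qed

section \<open>The covering bound for the attractor\<close>

lemma attractor_hausdorff_measure_eq_0:
  assumes s: "0 < s" and lim: "(\<lambda>k. level_sum M T \<omega> k s) \<longlonglongrightarrow> 0"
  shows "hausdorff_measure s (attractor M T R a \<omega>) = 0"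
proof (rule hausdorff_measure_eq_0I)
  fix \<delta> \<epsilon> :: real assume "0 < \<delta>" "0 < \<epsilon>"
  \<comment> \<open>The diameter of a ball of radius \<open>2 * trans_bound a\<close>, before
    scaling by the weight of a cylinder.\<close>
  define A where "A = 4 * trans_bound a"
  have "0 \<le> A" using trans_bound(2) by (simp add: A_def)
  define U where "U \<tau> = cball (F a \<omega> \<tau> 0) (weight r \<omega> \<tau> * (2 * trans_bound a))" for \<tau>
  have diam: "diameter (U \<tau>) = A * weight r \<omega> \<tau>" if "\<tau> \<in> tree_words M \<omega>" for \<tau>
    using weight_pos[OF that] trans_bound(2)[of a] by (simp add: U_def A_def mult_less_0_iff)
  have bound: "hausdorff_premeasure s \<delta> (attractor M T R a \<omega>) \<le> ennreal (A powr s * level_sum M T \<omega> k s)"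
    if k: "A * hi ^ k \<le> \<delta>" for k
  proof -
    have "attractor M T R a \<omega> \<subseteq> (\<Union>\<tau>\<in>level M \<omega> k. U \<tau>)"
    proof
      fix x assume "x \<in> attractor M T R a \<omega>"
      then obtain u where u: "u \<in> tree_boundary M \<omega>" "x = projection T R a \<omega> u"
        by (auto simp: attractor_def)
      then have "x \<in> U (map u [0..<k])"
        using dist_projection_le[OF u(1), of a k] by (simp add: U_def dist_commute)
      with boundary_level[OF u(1)] show "x \<in> (\<Union>\<tau>\<in>level M \<omega> k. U \<tau>)" by blast
    qed
    moreover have "bounded (U \<tau>) \<and> diameter (U \<tau>) \<le> \<delta>" if "\<tau> \<in> level M \<omega> k" for \<tau>
    proof -
      have \<tau>: "\<tau> \<in> tree_words M \<omega>" "length \<tau> = k" using that by (auto simp: level_def)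
      have "A * weight r \<omega> \<tau> \<le> A * hi ^ k"
        using weight_bounds[OF \<tau>(1)] \<tau>(2) \<open>0 \<le> A\<close> by (intro mult_left_mono) auto
      then show ?thesis using diam[OF \<tau>(1)] k by (simp add: U_def)
    qed
    ultimately have "hausdorff_premeasure s \<delta> (attractor M T R a \<omega>) \<le> (\<Sum>\<tau>\<in>level M \<omega> k. diam_power s (U \<tau>))"
      using \<open>0 < \<delta>\<close> by (intro hausdorff_premeasure_le_finite_cover) auto
    also have "\<dots> \<le> (\<Sum>\<tau>\<in>level M \<omega> k. ennreal ((A * weight r \<omega> \<tau>) powr s))"
      using s diam by (intro sum_mono diam_power_le) (auto simp: U_def level_def)
    also have "\<dots> = ennreal (\<Sum>\<tau>\<in>level M \<omega> k. (A * weight r \<omega> \<tau>) powr s)" by (rule sum_ennreal) (rule powr_ge_zero)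
    also have "(\<Sum>\<tau>\<in>level M \<omega> k. (A * weight r \<omega> \<tau>) powr s) = A powr s * level_sum M T \<omega> k s"
      unfolding level_sum_eq sum_distrib_left
      by (intro sum.cong refl powr_mult)
    finally show ?thesis .
  qed
  have "(\<lambda>k. A powr s * level_sum M T \<omega> k s) \<longlonglongrightarrow> 0" using lim by (rule tendsto_mult_right_zero)
  then have 1: "\<forall>\<^sub>F k in sequentially. A powr s * level_sum M T \<omega> k s < \<epsilon>"
    using \<open>0 < \<epsilon>\<close> by (rule order_tendstoD(2))
  have "(\<lambda>k. A * hi ^ k) \<longlonglongrightarrow> 0"
    using hi_pos hi_less by (intro tendsto_mult_right_zero LIMSEQ_power_zero) auto
  then have 2: "\<forall>\<^sub>F k in sequentially. A * hi ^ k < \<delta>" using \<open>0 < \<delta>\<close> by (rule order_tendstoD(2))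
  obtain k where "A powr s * level_sum M T \<omega> k s < \<epsilon>" "A * hi ^ k < \<delta>"
    using eventually_happens[OF eventually_conj[OF 1 2]] by (auto simp: trivial_limit_sequentially)
  then show "hausdorff_premeasure s \<delta> (attractor M T R a \<omega>) \<le> ennreal \<epsilon>"
    using bound[of k] by (meson ennreal_leI less_imp_le order_trans)
qed

section \<open>Transversality\<close>

text \<open>\<open>class_weight c \<omega> \<tau>\<close> bounds the operator norm of the derivative of \<open>F a \<omega> \<tau> 0\<close> with respect to
  \<open>a c\<close>.\<close>

primrec class_weight :: "('l \<times> nat) set \<Rightarrow> (nat list \<Rightarrow> 'l) \<Rightarrow> nat list \<Rightarrow> real" where
  "class_weight c \<omega> [] = 0"
| "class_weight c \<omega> (i # \<tau>) = (if R `` {(\<omega> [], i)} = c then 1 else 0) + r (\<omega> []) i * class_weight c (subtree \<omega> [i]) \<tau>"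

lemma norm_F_le_class_weight:
  assumes b: "\<And>c'. c' \<in> classes \<Longrightarrow> c' \<noteq> c \<Longrightarrow> b c' = 0"
  shows "\<tau> \<in> tree_words M \<omega> \<Longrightarrow> norm (F b \<omega> \<tau> 0) \<le> class_weight c \<omega> \<tau> * norm (b c)"
proof (induction \<tau> arbitrary: \<omega>)
  case (Cons i \<tau>)
  then have i: "i \<in> {1..M (\<omega> [])}" and "\<tau> \<in> tree_words M (subtree \<omega> [i])" by (simp_all only: tree_words_Cons)
  with Cons.IH have IH: "norm (F b (subtree \<omega> [i]) \<tau> 0) \<le> class_weight c (subtree \<omega> [i]) \<tau> * norm (b c)" by blast
  have "norm (F b \<omega> (i # \<tau>) 0) \<le> r (\<omega> []) i * norm (F b (subtree \<omega> [i]) \<tau> 0) + norm (b (R `` {(\<omega> [], i)}))"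
    unfolding F_Cons T_norm[OF i, symmetric] by (rule norm_triangle_ineq)
  also have "r (\<omega> []) i * norm (F b (subtree \<omega> [i]) \<tau> 0) \<le> r (\<omega> []) i * (class_weight c (subtree \<omega> [i]) \<tau> * norm (b c))"
    using IH r_ge[OF i] lo_pos by (intro mult_left_mono) auto
  also have "norm (b (R `` {(\<omega> [], i)})) = (if R `` {(\<omega> [], i)} = c then 1 else 0) * norm (b c)"
    using b[OF class_in[OF i]] by auto
  finally show ?case by (simp add: algebra_simps)
qed simp

text \<open>A letter belongs to at most one of the two classes, so each position is counted once in
  the sum. The geometric series in \<open>hi\<close> thus bounds both weights together, not merely
  each of them.\<close>

lemma class_weight_sum_le:
  assumes "c \<noteq> c'"
  shows "\<tau> \<in> tree_words M \<omega> \<Longrightarrow> class_weight c \<omega> \<tau> + class_weight c' \<omega> \<tau> \<le> 1 / (1 - hi)"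
proof (induction \<tau> arbitrary: \<omega>)
  case Nil
  then show ?case using hi_less by simp
next
  case (Cons i \<tau>)
  then have i: "i \<in> {1..M (\<omega> [])}" and "\<tau> \<in> tree_words M (subtree \<omega> [i])" by (simp_all only: tree_words_Cons)
  with Cons.IH have IH: "class_weight c (subtree \<omega> [i]) \<tau> + class_weight c' (subtree \<omega> [i]) \<tau> \<le> 1 / (1 - hi)" by blast
  have "class_weight c \<omega> (i # \<tau>) + class_weight c' \<omega> (i # \<tau>)
      \<le> 1 + r (\<omega> []) i * (class_weight c (subtree \<omega> [i]) \<tau> + class_weight c' (subtree \<omega> [i]) \<tau>)"
    using assms by (auto simp: algebra_simps)
  also have "r (\<omega> []) i * (class_weight c (subtree \<omega> [i]) \<tau> + class_weight c' (subtree \<omega> [i]) \<tau>) \<le> r (\<omega> []) i * (1 / (1 - hi))"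
    using IH r_ge[OF i] lo_pos by (intro mult_left_mono) auto
  also have "\<dots> \<le> hi * (1 / (1 - hi))"
    using r_le[OF i] hi_less by (intro mult_right_mono) auto
  also have "1 + hi * (1 / (1 - hi)) = 1 / (1 - hi)" using hi_less by (simp add: field_simps)
  finally show ?case by simp
qed

text \<open>What is left of an isometric derivative after a perturbation of norm at most
  \<open>hi / (1 - hi)\<close>. It is positive because \<open>hi < 1 / 2\<close>.\<close>

definition transversality_const :: real where
  "transversality_const = 1 - hi / (1 - hi)"

lemma transversality_const_pos: "0 < transversality_const"
  using hi_less by (simp add: transversality_const_def field_simps)

text \<open>The number \<open>E c\<close> bounds the contribution of class c after the first
  letters. Each of the two tails adds at most \<open>hi / (1 - hi)\<close> to the sum of
  \<open>E\<close> over the two classes, so the smaller value is at most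
  \<open>hi / (1 - hi)\<close>.\<close>

lemma F_expanding_in_one_class:
  assumes \<tau>: "i # \<tau> \<in> tree_words M \<omega>" and \<tau>': "j # \<tau>' \<in> tree_words M \<omega>" and "i \<noteq> j"
  shows "\<exists>c\<in>{R `` {(\<omega> [], i)}, R `` {(\<omega> [], j)}}. \<forall>b. (\<forall>c'\<in>classes. c' \<noteq> c \<longrightarrow> b c' = 0) \<longrightarrow>
    transversality_const * norm (b c) \<le> norm (F b \<omega> (i # \<tau>) 0 - F b \<omega> (j # \<tau>') 0)"
proof -
  define ci cj where "ci = R `` {(\<omega> [], i)}" and "cj = R `` {(\<omega> [], j)}"
  define E where "E c = r (\<omega> []) i * class_weight c (subtree \<omega> [i]) \<tau> + r (\<omega> []) j * class_weight c (subtree \<omega> [j]) \<tau>'" for c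
  have i: "i \<in> {1..M (\<omega> [])}" and ti: "\<tau> \<in> tree_words M (subtree \<omega> [i])"
    and j: "j \<in> {1..M (\<omega> [])}" and tj: "\<tau>' \<in> tree_words M (subtree \<omega> [j])"
    using \<tau> \<tau>' by (simp_all only: tree_words_Cons)
  have ne: "ci \<noteq> cj" unfolding ci_def cj_def by (rule class_neq[OF i j \<open>i \<noteq> j\<close>])
  have bound: "r (\<omega> []) i * x \<le> hi * (1 / (1 - hi))" if "i \<in> {1..M (\<omega> [])}" "x \<le> 1 / (1 - hi)" for i x
  proof -
    have "r (\<omega> []) i * x \<le> r (\<omega> []) i * (1 / (1 - hi))"
      using that r_ge[OF that(1)] lo_pos by (intro mult_left_mono) auto
    also have "\<dots> \<le> hi * (1 / (1 - hi))" using r_le[OF that(1)] hi_less by (intro mult_right_mono) auto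
    finally show ?thesis .
  qed
  have "E ci + E cj = r (\<omega> []) i * (class_weight ci (subtree \<omega> [i]) \<tau> + class_weight cj (subtree \<omega> [i]) \<tau>)
      + r (\<omega> []) j * (class_weight ci (subtree \<omega> [j]) \<tau>' + class_weight cj (subtree \<omega> [j]) \<tau>')"
    by (simp add: E_def algebra_simps)
  also have "\<dots> \<le> hi * (1 / (1 - hi)) + hi * (1 / (1 - hi))"
    by (intro add_mono bound i j class_weight_sum_le ne ti tj)
  finally have "E ci \<le> hi / (1 - hi) \<or> E cj \<le> hi / (1 - hi)" by auto
  then obtain c where c: "c \<in> {ci, cj}" "E c \<le> hi / (1 - hi)" by blast
  have "transversality_const * norm (b c) \<le> norm (F b \<omega> (i # \<tau>) 0 - F b \<omega> (j # \<tau>') 0)"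
    if b: "\<forall>c'\<in>classes. c' \<noteq> c \<longrightarrow> b c' = 0" for b
  proof -
    define X where "X = T (\<omega> []) i (F b (subtree \<omega> [i]) \<tau> 0)"
    define Y where "Y = T (\<omega> []) j (F b (subtree \<omega> [j]) \<tau>' 0)"
    have "norm X \<le> r (\<omega> []) i * (class_weight c (subtree \<omega> [i]) \<tau> * norm (b c))"
      unfolding X_def T_norm[OF i] using r_ge[OF i] lo_pos b
      by (intro mult_left_mono norm_F_le_class_weight ti) auto
    moreover have "norm Y \<le> r (\<omega> []) j * (class_weight c (subtree \<omega> [j]) \<tau>' * norm (b c))"
      unfolding Y_def T_norm[OF j] using r_ge[OF j] lo_pos b
      by (intro mult_left_mono norm_F_le_class_weight tj) auto
    ultimately have "norm X + norm Y \<le> E c * norm (b c)" by (simp add: E_def algebra_simps)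
    also have "\<dots> \<le> hi / (1 - hi) * norm (b c)" using c(2) by (intro mult_right_mono) auto
    finally have XY: "norm X + norm Y \<le> hi / (1 - hi) * norm (b c)" .
    have ij: "F b \<omega> (i # \<tau>) 0 - F b \<omega> (j # \<tau>') 0 = (b ci - b cj) + (X - Y)"
      unfolding F_Cons X_def Y_def ci_def cj_def by simp
    \<comment> \<open>As the classes differ and b vanishes off c, exactly one of the two terms
      survives, up to sign.\<close>
    have "norm (b ci - b cj) = norm (b c)"
      using c(1) ne b class_in[OF i] class_in[OF j] by (auto simp: ci_def cj_def)
    then have "norm (b c) - norm (X - Y) \<le> norm (F b \<omega> (i # \<tau>) 0 - F b \<omega> (j # \<tau>') 0)"
      unfolding ij using norm_diff_ineq[of "b ci - b cj" "X - Y"] by simp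
    then show ?thesis
      using norm_triangle_ineq4[of X Y] XY by (simp add: transversality_const_def left_diff_distrib)
  qed
  then show ?thesis using c(1) unfolding ci_def cj_def by blast
qed

text \<open>The common prefix cancels up to its weight, and the finite case is applied to the
  truncated tails before passing to the limit. The class depends on the two words but not on the
  translations, so its coordinate can be integrated with all others frozen.\<close>

lemma projection_transversality:
  assumes u: "u \<in> tree_boundary M \<omega>" and v: "v \<in> tree_boundary M \<omega>"
    and eq: "\<And>n. n < k \<Longrightarrow> u n = v n" and neq: "u k \<noteq> v k"
  shows "\<exists>c\<in>classes. \<forall>a a'. (\<forall>c'\<in>classes. c' \<noteq> c \<longrightarrow> a c' = a' c') \<longrightarrow>
    transversality_const * weight r \<omega> (map u [0..<k]) * norm (a c - a' c)
      \<le> norm ((projection T R a \<omega> u - projection T R a \<omega> v) - (projection T R a' \<omega> u - projection T R a' \<omega> v))"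
proof -
  define p where "p = map u [0..<k]"
  have pv: "p = map v [0..<k]" unfolding p_def using eq by (intro map_cong) auto
  have p: "p \<in> tree_words M \<omega>" using boundary_level[OF u] by (simp add: level_def p_def)
  define \<omega>' where "\<omega>' = subtree \<omega> p"
  have u': "(\<lambda>n. u (n + k)) \<in> tree_boundary M \<omega>'" using boundary_shift[OF u] by (simp add: \<omega>'_def p_def)
  have v': "(\<lambda>n. v (n + k)) \<in> tree_boundary M \<omega>'" using boundary_shift[OF v] by (simp add: \<omega>'_def pv)
  define W where "W w n = w k # map (\<lambda>n. w (Suc n + k)) [0..<n]" for w :: "nat \<Rightarrow> nat" and n
  have W: "W w n = map (\<lambda>n. w (n + k)) [0..<Suc n]" for w n
    unfolding W_def map_upt_Suc by simp
  have Wt: "W u n \<in> tree_words M \<omega>'" "W v n \<in> tree_words M \<omega>'" for n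
    using boundary_level[OF u', of "Suc n"] boundary_level[OF v', of "Suc n"] by (auto simp: W level_def)
  have pre: "map w [0..<Suc n + k] = map w [0..<k] @ W w n" for w n
    using prefix_split[of w k "Suc n"] by (simp add: W add.commute)
  define ci cj where "ci = R `` {(\<omega>' [], u k)}" and "cj = R `` {(\<omega>' [], v k)}"
  define good where "good c n \<longleftrightarrow> (\<forall>b. (\<forall>c'\<in>classes. c' \<noteq> c \<longrightarrow> b c' = 0) \<longrightarrow>
    transversality_const * norm (b c) \<le> norm (F b \<omega>' (W u n) 0 - F b \<omega>' (W v n) 0))" for c n
  have "good ci n \<or> good cj n" for n
    using F_expanding_in_one_class[OF Wt(1)[unfolded W_def] Wt(2)[unfolded W_def] neq]
    unfolding good_def ci_def cj_def W_def by auto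
  \<comment> \<open>The class supplied by the finite case may change with the truncation. One of the
    two candidates occurs infinitely often, which is enough for the limit.\<close>
  then have "\<exists>\<^sub>F n in sequentially. good ci n \<or> good cj n"
    by (intro eventually_frequently) (auto simp: trivial_limit_sequentially)
  then obtain c where c: "c \<in> {ci, cj}" "\<exists>\<^sub>F n in sequentially. good c n"
    by (auto simp: frequently_disj_iff)
  have "u k \<in> {1..M (\<omega>' [])}" "v k \<in> {1..M (\<omega>' [])}"
    using Wt[of 0] by (auto simp: W_def tree_words_Cons)
  with c(1) have cc: "c \<in> classes" using class_in by (auto simp: ci_def cj_def)
  moreover have "transversality_const * weight r \<omega> p * norm (a c - a' c)
      \<le> norm ((projection T R a \<omega> u - projection T R a \<omega> v) - (projection T R a' \<omega> u - projection T R a' \<omega> v))"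
    if aa: "\<forall>c'\<in>classes. c' \<noteq> c \<longrightarrow> a c' = a' c'" for a a'
  proof (rule ccontr)
    define X where "X n = norm ((F a \<omega> (map u [0..<n]) 0 - F a \<omega> (map v [0..<n]) 0)
      - (F a' \<omega> (map u [0..<n]) 0 - F a' \<omega> (map v [0..<n]) 0))" for n
    have lim: "X \<longlonglongrightarrow> norm ((projection T R a \<omega> u - projection T R a \<omega> v)
        - (projection T R a' \<omega> u - projection T R a' \<omega> v))"
      unfolding X_def by (intro tendsto_norm tendsto_diff projection_tendsto u v)
    assume "\<not> ?thesis"
    then have "\<forall>\<^sub>F n in sequentially. X n < transversality_const * weight r \<omega> p * norm (a c - a' c)"
      by (intro order_tendstoD(2)[OF lim]) simp
    then have "\<forall>\<^sub>F n in sequentially. X (n + Suc k) < transversality_const * weight r \<omega> p * norm (a c - a' c)"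
      by (rule eventually_sequentially_seg[THEN iffD2])
    from frequently_eventually_conj[OF c(2) this]
    obtain n where n: "good c n" "X (Suc n + k) < transversality_const * weight r \<omega> p * norm (a c - a' c)"
      by (auto dest!: frequently_ex)
    define b where "b = (\<lambda>c. a c - a' c)"
    have "X (Suc n + k) = norm ((F a \<omega> (p @ W u n) 0 - F a \<omega> (p @ W v n) 0)
      - (F a' \<omega> (p @ W u n) 0 - F a' \<omega> (p @ W v n) 0))"
      unfolding X_def pre p_def[symmetric] pv[symmetric] ..
    also have "\<dots> = norm (F b \<omega> (p @ W u n) 0 - F b \<omega> (p @ W v n) 0)"
      using p Wt[of n] by (simp add: b_def F_translation_diff tree_words_append \<omega>'_def algebra_simps)
    also have "\<dots> = weight r \<omega> p * norm (F b \<omega>' (W u n) 0 - F b \<omega>' (W v n) 0)"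
      using dist_F[OF p] by (simp add: comp_along_append dist_norm \<omega>'_def)
    also have "\<dots> \<ge> weight r \<omega> p * (transversality_const * norm (b c))"
    proof (rule mult_left_mono)
      have "\<forall>c'\<in>classes. c' \<noteq> c \<longrightarrow> b c' = 0" using aa by (simp add: b_def)
      with n(1) show "transversality_const * norm (b c) \<le> norm (F b \<omega>' (W u n) 0 - F b \<omega>' (W v n) 0)"
        unfolding good_def by blast
    qed (use weight_pos[OF p] in simp)
    finally show False using n(2) by (simp add: b_def algebra_simps)
  qed
  ultimately show ?thesis unfolding p_def by blast
qed

end

section \<open>Integration over the translations\<close>

text \<open>Points with both values of norm at most y are at distance at most
  \<open>2 * y / \<kappa>\<close>, so the set lies in a ball of that radius as well as in
  \<open>cball 0 \<rho>\<close>. The D-th power of the smaller radius is split as a (D - t)-th power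
  times a t-th power; the first is bounded by means of \<open>\<rho>\<close>, the second by means of
  \<open>2 * y / \<kappa>\<close>.\<close>

lemma nn_integral_expanding_le:
  fixes h :: "'a::euclidean_space \<Rightarrow> 'a" and t :: real
  assumes h [measurable]: "h \<in> borel_measurable borel"
    and expand: "\<And>x x'. \<kappa> * norm (x - x') \<le> norm (h x - h x')"
    and pos: "0 < \<kappa>" "0 < y" "0 < \<rho>" and t: "0 < t" "t < real DIM('a)"
  shows "(\<integral>\<^sup>+x. indicator (cball 0 \<rho>) x * indicator {..y} (norm (h x)) \<partial>lborel)
    \<le> ennreal (unit_ball_vol DIM('a) * \<rho> powr (real DIM('a) - t) * (2 * y / \<kappa>) powr t)"
proof -
  let ?D = "DIM('a)"
  define S where "S = {x \<in> space borel. x \<in> cball 0 \<rho> \<and> norm (h x) \<le> y}"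
  have S: "S \<in> sets lborel" unfolding S_def by simp
  have "(\<integral>\<^sup>+x. indicator (cball 0 \<rho>) x * indicator {..y} (norm (h x)) \<partial>lborel) = (\<integral>\<^sup>+x. indicator S x \<partial>lborel)"
    by (intro nn_integral_cong) (auto simp: S_def indicator_def)
  also have "\<dots> = emeasure lborel S" by (rule nn_integral_indicator[OF S])
  also have "\<dots> \<le> ennreal (unit_ball_vol ?D * \<rho> powr (real ?D - t) * (2 * y / \<kappa>) powr t)"
  proof (cases "S = {}")
    case False
    then obtain x0 where x0: "x0 \<in> S" by blast
    define z where "z = 2 * y / \<kappa>"
    have z: "0 < z" using pos by (simp add: z_def)
    have "S \<subseteq> cball x0 z"
    proof
      fix x assume x: "x \<in> S"
      have "\<kappa> * norm (x0 - x) \<le> norm (h x0 - h x)" by (rule expand)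
      also have "\<dots> \<le> 2 * y" using x x0 norm_triangle_ineq4[of "h x0" "h x"] by (simp add: S_def)
      finally show "x \<in> cball x0 z" using pos by (simp add: z_def dist_norm field_simps)
    qed
    then have "emeasure lborel S \<le> emeasure lborel (cball x0 z)" by (rule emeasure_mono) simp
    then have 1: "emeasure lborel S \<le> ennreal (unit_ball_vol ?D * z ^ ?D)" using z by (simp add: emeasure_cball)
    have "emeasure lborel S \<le> emeasure lborel (cball (0::'a) \<rho>)" by (rule emeasure_mono) (auto simp: S_def)
    then have 2: "emeasure lborel S \<le> ennreal (unit_ball_vol ?D * \<rho> ^ ?D)" using pos by (simp add: emeasure_cball)
    define q where "q = min z \<rho>"
    have q: "0 < q" using z pos by (simp add: q_def)
    have "emeasure lborel S \<le> ennreal (unit_ball_vol ?D * q ^ ?D)" using 1 2 by (simp add: q_def min_def)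
    also have "q ^ ?D = q powr (real ?D - t) * q powr t"
      using q by (simp add: powr_add[symmetric] powr_realpow)
    also have "unit_ball_vol ?D * (q powr (real ?D - t) * q powr t) \<le> unit_ball_vol ?D * (\<rho> powr (real ?D - t) * z powr t)"
      using q t by (intro mult_left_mono mult_mono powr_mono2) (auto simp: q_def)
    then have "ennreal (unit_ball_vol ?D * (q powr (real ?D - t) * q powr t)) \<le> ennreal (unit_ball_vol ?D * (\<rho> powr (real ?D - t) * z powr t))"
      by (rule ennreal_leI)
    finally show ?thesis by (simp add: z_def mult.assoc)
  qed simp
  finally show ?thesis .
qed

text \<open>The factor \<open>2 powr (real n * s)\<close> is beaten by the decay \<open>2 powr (- real n * t)\<close> since \<open>s < t\<close>.\<close>

lemma AE_dyadic_energy_finite: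
  fixes Z :: "'p \<Rightarrow> 'b \<Rightarrow> 'a::euclidean_space" and q :: "'p \<Rightarrow> ennreal"
  assumes "sigma_finite_measure \<Lambda>" "prob_space \<nu>"
    and Z [measurable]: "(\<lambda>(a, x). Z a x) \<in> borel_measurable (\<Lambda> \<Otimes>\<^sub>M \<nu>)"
    and q [measurable]: "q \<in> borel_measurable \<Lambda>"
    and est: "\<And>n. AE x in \<nu>. (\<integral>\<^sup>+y. \<integral>\<^sup>+a. q a * indicator {..(1/2)^n} (dist (Z a x) (Z a y)) \<partial>\<Lambda> \<partial>\<nu>)
        \<le> ennreal (K * 2 powr (- real n * t))"
    and "0 \<le> K" "s < t"
  shows "AE a in \<Lambda>. q a * (\<Sum>n. ennreal (2 powr (real n * s)) *
      (\<integral>\<^sup>+x. \<integral>\<^sup>+y. indicator {..(1/2)^n} (dist (Z a x) (Z a y)) \<partial>\<nu> \<partial>\<nu>)) \<noteq> \<infinity>"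
proof (rule nn_integral_PInf_AE)
  interpret L: sigma_finite_measure \<Lambda> by fact
  interpret N: prob_space \<nu> by fact
  interpret LN: pair_sigma_finite \<Lambda> \<nu> by unfold_locales
  let ?i = "\<lambda>n a x y. indicator {..(1/2::real)^n} (dist (Z a x) (Z a y)) :: ennreal"
  have Zm: "(\<lambda>x. Z (f x) (g x)) \<in> borel_measurable L" if "f \<in> measurable L \<Lambda>" "g \<in> measurable L \<nu>" for f g and L :: "'c measure"
    using measurable_compose[OF measurable_Pair[OF that] Z] by simp
  have [measurable]: "(\<lambda>((a, x), y). ?i n a x y) \<in> borel_measurable ((\<Lambda> \<Otimes>\<^sub>M \<nu>) \<Otimes>\<^sub>M \<nu>)" for n
    unfolding case_prod_unfold
    by (intro measurable_compose[OF _ borel_measurable_indicator] borel_measurable_dist Zm) measurable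
  show m: "(\<lambda>a. q a * (\<Sum>n. ennreal (2 powr (real n * s)) * (\<integral>\<^sup>+x. \<integral>\<^sup>+y. ?i n a x y \<partial>\<nu> \<partial>\<nu>))) \<in> borel_measurable \<Lambda>"
    by measurable
  \<comment> \<open>Two uses of Tonelli bring the integral over the translations innermost, where
    the estimate for fixed pairs is available.\<close>
  have swap: "(\<integral>\<^sup>+a. q a * (\<integral>\<^sup>+x. \<integral>\<^sup>+y. ?i n a x y \<partial>\<nu> \<partial>\<nu>) \<partial>\<Lambda>) = (\<integral>\<^sup>+x. \<integral>\<^sup>+y. \<integral>\<^sup>+a. q a * ?i n a x y \<partial>\<Lambda> \<partial>\<nu> \<partial>\<nu>)" for n
  proof -
    have "(\<integral>\<^sup>+a. q a * (\<integral>\<^sup>+x. \<integral>\<^sup>+y. ?i n a x y \<partial>\<nu> \<partial>\<nu>) \<partial>\<Lambda>) = (\<integral>\<^sup>+a. \<integral>\<^sup>+x. \<integral>\<^sup>+y. q a * ?i n a x y \<partial>\<nu> \<partial>\<nu> \<partial>\<Lambda>)"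
      by (intro nn_integral_cong) (simp add: nn_integral_cmult)
    also have "\<dots> = (\<integral>\<^sup>+x. \<integral>\<^sup>+a. \<integral>\<^sup>+y. q a * ?i n a x y \<partial>\<nu> \<partial>\<Lambda> \<partial>\<nu>)"
      by (rule LN.Fubini'[symmetric]) measurable
    also have "\<dots> = (\<integral>\<^sup>+x. \<integral>\<^sup>+y. \<integral>\<^sup>+a. q a * ?i n a x y \<partial>\<Lambda> \<partial>\<nu> \<partial>\<nu>)"
      by (intro nn_integral_cong LN.Fubini'[symmetric]) measurable
    finally show ?thesis .
  qed
  have "(\<integral>\<^sup>+a. q a * (\<Sum>n. ennreal (2 powr (real n * s)) * (\<integral>\<^sup>+x. \<integral>\<^sup>+y. ?i n a x y \<partial>\<nu> \<partial>\<nu>)) \<partial>\<Lambda>)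
      = (\<integral>\<^sup>+a. (\<Sum>n. ennreal (2 powr (real n * s)) * (q a * (\<integral>\<^sup>+x. \<integral>\<^sup>+y. ?i n a x y \<partial>\<nu> \<partial>\<nu>))) \<partial>\<Lambda>)"
    by (intro nn_integral_cong, subst ennreal_suminf_cmult[symmetric], intro suminf_cong mult.left_commute)
  also have "\<dots> = (\<Sum>n. ennreal (2 powr (real n * s)) * (\<integral>\<^sup>+a. q a * (\<integral>\<^sup>+x. \<integral>\<^sup>+y. ?i n a x y \<partial>\<nu> \<partial>\<nu>) \<partial>\<Lambda>))"
    by (simp add: nn_integral_suminf nn_integral_cmult)
  also have "\<dots> \<le> (\<Sum>n. ennreal (2 powr (real n * s)) * ennreal (K * 2 powr (- real n * t)))"
  proof (intro suminf_le summableI mult_left_mono)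
    fix n
    have "(\<integral>\<^sup>+x. \<integral>\<^sup>+y. \<integral>\<^sup>+a. q a * ?i n a x y \<partial>\<Lambda> \<partial>\<nu> \<partial>\<nu>) \<le> (\<integral>\<^sup>+x. ennreal (K * 2 powr (- real n * t)) \<partial>\<nu>)"
      by (rule nn_integral_mono_AE[OF est])
    then show "(\<integral>\<^sup>+a. q a * (\<integral>\<^sup>+x. \<integral>\<^sup>+y. ?i n a x y \<partial>\<nu> \<partial>\<nu>) \<partial>\<Lambda>) \<le> ennreal (K * 2 powr (- real n * t))"
      by (simp add: swap N.emeasure_space_1)
  qed simp
  also have "\<dots> = (\<Sum>n. ennreal (K * (2 powr (s - t)) ^ n))"
  proof (rule suminf_cong)
    fix n
    have "2 powr (real n * s) * (K * 2 powr (- real n * t)) = K * (2 powr (s - t)) ^ n"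
      by (simp add: powr_realpow[symmetric] powr_powr powr_add[symmetric] algebra_simps)
    then show "ennreal (2 powr (real n * s)) * ennreal (K * 2 powr (- real n * t)) = ennreal (K * (2 powr (s - t)) ^ n)"
      using \<open>0 \<le> K\<close> by (subst ennreal_mult[symmetric]) auto
  qed
  also have "\<dots> < \<infinity>"
  proof -
    have "(2::real) powr (s - t) < 2 powr 0" using \<open>s < t\<close> by (intro powr_less_mono) auto
    then have "summable (\<lambda>n. K * (2 powr (s - t)) ^ n)" by (intro summable_mult summable_geometric) simp
    then have "(\<Sum>n. ennreal (K * (2 powr (s - t)) ^ n)) = ennreal (\<Sum>n. K * (2 powr (s - t)) ^ n)"
      using \<open>0 \<le> K\<close> by (intro suminf_ennreal2) auto
    then show ?thesis by simp
  qed
  finally show "(\<integral>\<^sup>+a. q a * (\<Sum>n. ennreal (2 powr (real n * s)) * (\<integral>\<^sup>+x. \<integral>\<^sup>+y. ?i n a x y \<partial>\<nu> \<partial>\<nu>)) \<partial>\<Lambda>) \<noteq> \<infinity>"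
    by simp
qed

section \<open>Averages over bounded sets of translations\<close>

context translated_tree
begin

abbreviation translation_measure :: "('l, 'a) translation measure" where
  "translation_measure \<equiv> \<Pi>\<^sub>M c\<in>classes. lborel"

lemma measurable_translation: "c \<in> classes \<Longrightarrow> (\<lambda>a. a c) \<in> borel_measurable translation_measure"
  using measurable_component_singleton[of c classes "\<lambda>_. lborel"] by simp

lemma measurable_F:
  "\<tau> \<in> tree_words M \<omega> \<Longrightarrow> (\<lambda>a. F a \<omega> \<tau> 0) \<in> borel_measurable translation_measure"
proof (induction \<tau> arbitrary: \<omega>)
  case (Cons i \<tau>)
  then have i: "i \<in> {1..M (\<omega> [])}" and "\<tau> \<in> tree_words M (subtree \<omega> [i])" by (simp_all only: tree_words_Cons)
  with Cons.IH have IH: "(\<lambda>a. F a (subtree \<omega> [i]) \<tau> 0) \<in> borel_measurable translation_measure" by blast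
  have "T (\<omega> []) i \<in> borel_measurable borel"
    using T_linear[OF i] by (intro borel_measurable_continuous_onI linear_continuous_on linear_conv_bounded_linear[THEN iffD1])
  from measurable_compose[OF IH this] measurable_translation[OF class_in[OF i]]
  show ?case unfolding F_Cons by (rule borel_measurable_add)
qed simp

lemma measurable_projection:
  assumes "u \<in> tree_boundary M \<omega>"
  shows "(\<lambda>a. projection T R a \<omega> u) \<in> borel_measurable translation_measure"
  by (rule borel_measurable_LIMSEQ_metric[OF measurable_F projection_tendsto[OF assms]])
    (use boundary_level[OF assms] in \<open>auto simp: level_def\<close>)

text \<open>Written as a product of functions of single coordinates, so that it factors under the
  product integral.\<close>

definition translation_box :: "real \<Rightarrow> ('l, 'a) translation \<Rightarrow> ennreal" where
  "translation_box \<rho> a = (\<Prod>c\<in>classes. indicator (cball 0 \<rho>) (a c))"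

lemma measurable_translation_box: "translation_box \<rho> \<in> borel_measurable translation_measure"
  unfolding translation_box_def
  by (intro borel_measurable_prod_ennreal measurable_compose[OF measurable_translation borel_measurable_indicator]) auto

text \<open>The first factor is the volume of the box in the coordinates other than the transversal
  one. The second is the bound of \<open>nn_integral_expanding_le\<close>, with the ratio of y to
  the weight split off.\<close>

definition box_const :: "real \<Rightarrow> real \<Rightarrow> real" where
  "box_const \<rho> t = (unit_ball_vol DIM('a) * \<rho> ^ DIM('a)) ^ (card classes - 1) *
     (unit_ball_vol DIM('a) * \<rho> powr (real DIM('a) - t) * (2 / transversality_const) powr t)"

lemma box_const_nonneg: "0 < \<rho> \<Longrightarrow> 0 \<le> box_const \<rho> t"
  by (simp add: box_const_def)

text \<open>The coordinate of the transversal class is integrated first, with the others fixed;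
  there the difference of the projections is expanding with constant
  \<open>transversality_const\<close> times the weight of the common prefix.\<close>

lemma box_integral_le:
  fixes t :: real
  assumes u: "u \<in> tree_boundary M \<omega>" and v: "v \<in> tree_boundary M \<omega>"
    and eq: "\<And>n. n < k \<Longrightarrow> u n = v n" and neq: "u k \<noteq> v k"
    and pos: "0 < y" "0 < \<rho>" and t: "0 < t" "t < real DIM('a)"
  shows "(\<integral>\<^sup>+a. translation_box \<rho> a * indicator {..y} (dist (projection T R a \<omega> u) (projection T R a \<omega> v)) \<partial>translation_measure)
    \<le> ennreal (box_const \<rho> t * (y / weight r \<omega> (map u [0..<k])) powr t)"
proof -
  define w where "w = weight r \<omega> (map u [0..<k])"
  have w: "0 < w" using boundary_level[OF u] weight_pos by (auto simp: w_def level_def)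
  define \<kappa> where "\<kappa> = transversality_const * w"
  have \<kappa>: "0 < \<kappa>" using w transversality_const_pos by (simp add: \<kappa>_def)
  have "\<exists>c\<in>classes. \<forall>a a'. (\<forall>c'\<in>classes. c' \<noteq> c \<longrightarrow> a c' = a' c') \<longrightarrow> \<kappa> * norm (a c - a' c)
      \<le> norm ((projection T R a \<omega> u - projection T R a \<omega> v) - (projection T R a' \<omega> u - projection T R a' \<omega> v))"
    unfolding \<kappa>_def w_def by (rule projection_transversality[OF u v eq neq])
  then obtain c where c: "c \<in> classes" and trans: "\<forall>a a'. (\<forall>c'\<in>classes. c' \<noteq> c \<longrightarrow> a c' = a' c') \<longrightarrow>
    \<kappa> * norm (a c - a' c)
      \<le> norm ((projection T R a \<omega> u - projection T R a \<omega> v) - (projection T R a' \<omega> u - projection T R a' \<omega> v))"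
    by (elim bexE)
  define I where "I = classes - {c}"
  have I: "finite I" "c \<notin> I" "insert c I = classes" using R_finite c by (auto simp: I_def)
  interpret product_sigma_finite "\<lambda>_::('l \<times> nat) set. lborel :: 'a measure" by standard
  define h where "h a = projection T R a \<omega> u - projection T R a \<omega> v" for a
  have h_meas: "h \<in> borel_measurable translation_measure"
    unfolding h_def by (intro borel_measurable_diff measurable_projection u v)
  define f where "f a = translation_box \<rho> a * indicator {..y} (norm (h a))" for a
  have f_meas: "f \<in> borel_measurable translation_measure"
    unfolding f_def by (intro borel_measurable_times_ennreal measurable_translation_box
        measurable_compose[OF measurable_compose[OF h_meas borel_measurable_norm] borel_measurable_indicator]) auto
  have "(\<integral>\<^sup>+a. translation_box \<rho> a * indicator {..y} (dist (projection T R a \<omega> u) (projection T R a \<omega> v)) \<partial>translation_measure)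
      = (\<integral>\<^sup>+a. f a \<partial>PiM (insert c I) (\<lambda>_. lborel))"
    by (simp add: f_def h_def dist_norm I(3))
  \<comment> \<open>The transversal coordinate c becomes the inner integral.\<close>
  also have "\<dots> = (\<integral>\<^sup>+x. (\<integral>\<^sup>+z. f (x(c := z)) \<partial>lborel) \<partial>PiM I (\<lambda>_. lborel))"
    by (rule product_nn_integral_insert[OF I(1,2)]) (use f_meas I(3) in simp)
  also have "\<dots> \<le> (\<integral>\<^sup>+x. (\<Prod>c'\<in>I. indicator (cball (0::'a) \<rho>) (x c')) *
      ennreal (unit_ball_vol DIM('a) * \<rho> powr (real DIM('a) - t) * (2 * y / \<kappa>) powr t) \<partial>PiM I (\<lambda>_. lborel))"
  proof (rule nn_integral_mono)
    fix x :: "('l, 'a) translation" assume x: "x \<in> space (PiM I (\<lambda>_. lborel))"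
    let ?p = "\<Prod>c'\<in>I. indicator (cball (0::'a) \<rho>) (x c') :: ennreal"
    have upd: "(\<lambda>z. x(c := z)) \<in> measurable lborel translation_measure"
      using measurable_component_update[OF x I(2)] I(3) by simp
    have hm: "(\<lambda>z. h (x(c := z))) \<in> borel_measurable borel"
      using measurable_compose[OF upd h_meas] by simp
    have ind: "(\<lambda>z. indicator (cball 0 \<rho>) z * indicator {..y} (norm (h (x(c := z)))) :: ennreal) \<in> borel_measurable lborel"
      using measurable_compose[OF measurable_compose[OF hm borel_measurable_norm] borel_measurable_indicator, of "{..y}"]
      by (intro borel_measurable_times_ennreal borel_measurable_indicator) auto
    have f_upd: "f (x(c := z)) = ?p * (indicator (cball 0 \<rho>) z * indicator {..y} (norm (h (x(c := z)))))" for z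
    proof -
      have "translation_box \<rho> (x(c := z)) = (\<Prod>c'\<in>insert c I. indicator (cball 0 \<rho>) ((x(c := z)) c'))"
        by (simp add: translation_box_def I(3))
      also have "\<dots> = indicator (cball 0 \<rho>) z * (\<Prod>c'\<in>I. indicator (cball 0 \<rho>) ((x(c := z)) c'))"
        by (subst prod.insert[OF I(1,2)]) simp
      also have "(\<Prod>c'\<in>I. indicator (cball 0 \<rho>) ((x(c := z)) c')) = ?p"
        using I(2) by (intro prod.cong) auto
      finally have eq: "translation_box \<rho> (x(c := z)) = indicator (cball 0 \<rho>) z * ?p" .
      show ?thesis unfolding f_def eq by (simp only: mult_ac)
    qed
    have "(\<integral>\<^sup>+z. f (x(c := z)) \<partial>lborel)
        = ?p * (\<integral>\<^sup>+z. indicator (cball 0 \<rho>) z * indicator {..y} (norm (h (x(c := z)))) \<partial>lborel)"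
      unfolding f_upd by (rule nn_integral_cmult[OF ind])
    also have "\<dots> \<le> ?p * ennreal (unit_ball_vol DIM('a) * \<rho> powr (real DIM('a) - t) * (2 * y / \<kappa>) powr t)"
    proof (intro mult_left_mono nn_integral_expanding_le hm \<kappa> pos t)
      fix z z' show "\<kappa> * norm (z - z') \<le> norm (h (x(c := z)) - h (x(c := z')))"
        using trans[rule_format, of "x(c := z)" "x(c := z')"] by (simp add: h_def)
    qed simp
    finally show "(\<integral>\<^sup>+z. f (x(c := z)) \<partial>lborel) \<le> \<dots>" .
  qed
  also have "\<dots> = (\<integral>\<^sup>+x. (\<Prod>c'\<in>I. indicator (cball (0::'a) \<rho>) (x c')) \<partial>PiM I (\<lambda>_. lborel)) *
      ennreal (unit_ball_vol DIM('a) * \<rho> powr (real DIM('a) - t) * (2 * y / \<kappa>) powr t)"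
  proof (rule nn_integral_multc)
    have "(indicator (cball 0 \<rho>) :: 'a \<Rightarrow> ennreal) \<in> borel_measurable lborel"
      by (rule borel_measurable_indicator) simp
    then have "(\<lambda>x. indicator (cball (0::'a) \<rho>) (x c') :: ennreal) \<in> borel_measurable (PiM I (\<lambda>_. lborel))"
      if "c' \<in> I" for c'
      by (rule measurable_compose[OF measurable_component_singleton[OF that, of "\<lambda>_. lborel"]])
    then show "(\<lambda>x. \<Prod>c'\<in>I. indicator (cball (0::'a) \<rho>) (x c') :: ennreal) \<in> borel_measurable (PiM I (\<lambda>_. lborel))"
      by (rule borel_measurable_prod_ennreal)
  qed
  also have "(\<integral>\<^sup>+x. (\<Prod>c'\<in>I. indicator (cball (0::'a) \<rho>) (x c')) \<partial>PiM I (\<lambda>_. lborel))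
      = (\<Prod>c'\<in>I. \<integral>\<^sup>+z. indicator (cball (0::'a) \<rho>) z \<partial>lborel)"
    by (rule product_nn_integral_prod[OF I(1)], rule borel_measurable_indicator) simp
  also have "\<dots> = ennreal ((unit_ball_vol DIM('a) * \<rho> ^ DIM('a)) ^ (card classes - 1))"
    using pos c R_finite by (simp add: emeasure_cball I_def ennreal_power)
  also have "\<dots> * ennreal (unit_ball_vol DIM('a) * \<rho> powr (real DIM('a) - t) * (2 * y / \<kappa>) powr t)
      = ennreal (box_const \<rho> t * (y / w) powr t)"
  proof -
    have "2 * y / \<kappa> = (2 / transversality_const) * (y / w)" by (simp add: \<kappa>_def)
    then have "(2 * y / \<kappa>) powr t = (2 / transversality_const) powr t * (y / w) powr t"
      by (simp only: powr_mult)
    then show ?thesis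
      using pos by (subst ennreal_mult[symmetric]) (auto simp: box_const_def mult.assoc)
  qed
  finally show ?thesis by (simp add: w_def)
qed

end

section \<open>The natural measure on the boundary of a necked tree\<close>

definition block_concat :: "(nat \<Rightarrow> nat list) \<Rightarrow> nat \<Rightarrow> nat list" where
  "block_concat \<xi> m = concat (map \<xi> [0..<m])"

lemma block_concat_0 [simp]: "block_concat \<xi> 0 = []"
  by (simp add: block_concat_def)

lemma block_concat_Suc: "block_concat \<xi> (Suc m) = block_concat \<xi> m @ \<xi> m"
  by (simp add: block_concat_def)

lemma block_concat_prefix: "m \<le> n \<Longrightarrow> \<exists>\<tau>. block_concat \<xi> n = block_concat \<xi> m @ \<tau>"
  by (induction n rule: dec_induct) (auto simp: block_concat_Suc)

lemma block_concat_nth: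
  assumes "n < length (block_concat \<xi> m)" "n < length (block_concat \<xi> m')"
  shows "block_concat \<xi> m ! n = block_concat \<xi> m' ! n"
proof (cases "m \<le> m'")
  case True
  then show ?thesis using block_concat_prefix[OF True, of \<xi>] assms by (auto simp: nth_append)
next
  case False
  then show ?thesis using block_concat_prefix[of m' m \<xi>] assms by (auto simp: nth_append)
qed

text \<open>The index is in range because \<open>n + 1\<close> nonempty blocks have at least \<open>n + 1\<close> letters.\<close>

definition block_path :: "(nat \<Rightarrow> nat list) \<Rightarrow> nat \<Rightarrow> nat" where
  "block_path \<xi> n = block_concat \<xi> (Suc n) ! n"

text \<open>Which words lead from one neck to the next does not depend on the word before. Blocks
  can therefore be chosen freely one after the other, which is what permits a product
  measure.\<close>

definition neck_blocks :: "('l \<Rightarrow> nat) \<Rightarrow> (nat list \<Rightarrow> 'l) \<Rightarrow> (nat \<Rightarrow> nat) \<Rightarrow> nat \<Rightarrow> nat list set" where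
  "neck_blocks M \<omega> N m = level M (neck_tail M \<omega> N m) (N (m + 1) - N m)"

context
  fixes M :: "'l \<Rightarrow> nat" and \<omega> N
  assumes necked: "(\<omega>, N) \<in> necked_trees M"
begin

lemma block_concat_level:
  "(\<And>j. j < m \<Longrightarrow> \<xi> j \<in> neck_blocks M \<omega> N j) \<Longrightarrow> block_concat \<xi> m \<in> level M \<omega> (N m)"
proof (induction m)
  case 0
  then show ?case using necked_N[OF necked] by simp
next
  case (Suc m)
  then have IH: "block_concat \<xi> m \<in> level M \<omega> (N m)" and "\<xi> m \<in> neck_blocks M \<omega> N m" by auto
  then have "\<xi> m \<in> level M (subtree \<omega> (block_concat \<xi> m)) (N (m + 1) - N m)"
    by (simp add: neck_blocks_def subtree_neck[OF necked IH])
  from level_append[OF IH this] show ?case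
    using necked_N_le[OF necked, of m 1] by (simp add: block_concat_Suc)
qed

context
  fixes \<xi>
  assumes \<xi>: "\<And>m. \<xi> m \<in> neck_blocks M \<omega> N m"
begin

lemma length_block_concat: "length (block_concat \<xi> m) = N m"
  using block_concat_level[of m \<xi>] \<xi> by (simp add: level_def)

lemma block_path_prefix: "map (block_path \<xi>) [0..<N m] = block_concat \<xi> m"
proof (rule nth_equalityI)
  fix n assume "n < length (map (block_path \<xi>) [0..<N m])"
  then have n: "n < N m" by simp
  have "n < N (Suc n)" using strict_mono_imp_increasing[OF necked_N(2)[OF necked], of "Suc n"] by linarith
  with n show "map (block_path \<xi>) [0..<N m] ! n = block_concat \<xi> m ! n"
    unfolding block_path_def by (simp add: block_concat_nth[of n \<xi> "Suc n" m] length_block_concat)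
qed (simp add: length_block_concat)

lemma block_path_boundary: "block_path \<xi> \<in> tree_boundary M \<omega>"
  unfolding tree_boundary_def
proof (intro CollectI allI)
  fix n
  have "n \<le> N n" by (rule strict_mono_imp_increasing[OF necked_N(2)[OF necked]])
  then obtain j where j: "N n = n + j" using le_Suc_ex by blast
  have "map (block_path \<xi>) [0..<N n] \<in> tree_words M \<omega>"
    unfolding block_path_prefix using block_concat_level[of n \<xi>] \<xi> by (simp add: level_def)
  then show "map (block_path \<xi>) [0..<n] \<in> tree_words M \<omega>"
    unfolding j prefix_split tree_words_append by blast
qed

end

end

section \<open>The product measure on block sequences\<close>

context similarity_tree
begin

lemma level_sum_nonneg: "0 \<le> level_sum M T \<omega> k \<alpha>"
  using level_sum_pos less_imp_le by blast

definition block_pmf :: "(nat list \<Rightarrow> 'l) \<Rightarrow> (nat \<Rightarrow> nat) \<Rightarrow> real \<Rightarrow> nat \<Rightarrow> nat list pmf" where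
  "block_pmf \<omega> N t m = embed_pmf (\<lambda>\<tau>. if \<tau> \<in> neck_blocks M \<omega> N m
     then weight r (neck_tail M \<omega> N m) \<tau> powr t / level_sum M T (neck_tail M \<omega> N m) (N (m + 1) - N m) t else 0)"

lemma pmf_block_pmf:
  "pmf (block_pmf \<omega> N t m) \<tau> = (if \<tau> \<in> neck_blocks M \<omega> N m
     then weight r (neck_tail M \<omega> N m) \<tau> powr t / level_sum M T (neck_tail M \<omega> N m) (N (m + 1) - N m) t else 0)"
  unfolding block_pmf_def
proof (rule pmf_embed_pmf)
  let ?S = "level_sum M T (neck_tail M \<omega> N m) (N (m + 1) - N m) t"
  let ?f = "\<lambda>\<tau>. if \<tau> \<in> neck_blocks M \<omega> N m then weight r (neck_tail M \<omega> N m) \<tau> powr t / ?S else 0"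
  show nonneg: "0 \<le> ?f \<tau>" for \<tau> by (simp add: level_sum_nonneg)
  have "(\<integral>\<^sup>+\<tau>. ennreal (?f \<tau>) \<partial>count_space UNIV) = (\<Sum>\<tau>\<in>neck_blocks M \<omega> N m. ennreal (?f \<tau>))"
    by (rule nn_integral_count_space') (auto simp: neck_blocks_def)
  also have "\<dots> = ennreal (\<Sum>\<tau>\<in>neck_blocks M \<omega> N m. ?f \<tau>)" by (rule sum_ennreal[OF nonneg])
  also have "(\<Sum>\<tau>\<in>neck_blocks M \<omega> N m. ?f \<tau>) = ?S / ?S"
    by (simp add: level_sum_eq neck_blocks_def sum_divide_distrib[symmetric])
  also have "\<dots> = 1" using level_sum_pos[of "neck_tail M \<omega> N m" "N (m + 1) - N m" t] by simp
  finally show "(\<integral>\<^sup>+\<tau>. ennreal (?f \<tau>) \<partial>count_space UNIV) = 1" by simp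
qed

definition block_measure :: "(nat list \<Rightarrow> 'l) \<Rightarrow> (nat \<Rightarrow> nat) \<Rightarrow> real \<Rightarrow> (nat \<Rightarrow> nat list) measure" where
  "block_measure \<omega> N t = (\<Pi>\<^sub>M m\<in>UNIV. measure_pmf (block_pmf \<omega> N t m))"

lemma prob_space_block_measure: "prob_space (block_measure \<omega> N t)"
  unfolding block_measure_def by (rule prob_space_PiM) (rule measure_pmf.prob_space_axioms)

lemma space_block_measure [simp]: "space (block_measure \<omega> N t) = UNIV"
  by (simp add: block_measure_def space_PiM)

lemma AE_block_measure: "AE \<xi> in block_measure \<omega> N t. \<forall>m. \<xi> m \<in> neck_blocks M \<omega> N m"
  unfolding AE_all_countable block_measure_def
proof (intro allI AE_PiM_component measure_pmf.prob_space_axioms UNIV_I)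
  fix m show "AE \<tau> in measure_pmf (block_pmf \<omega> N t m). \<tau> \<in> neck_blocks M \<omega> N m"
    by (auto simp: AE_measure_pmf_iff set_pmf_iff pmf_block_pmf split: if_splits)
qed

lemma measurable_block_concat:
  "(\<lambda>\<xi>. block_concat \<xi> m) \<in> measurable (block_measure \<omega> N t) (count_space UNIV)"
proof (induction m)
  case (Suc m)
  have comp: "(\<lambda>\<xi>. \<xi> m) \<in> measurable (block_measure \<omega> N t) (measure_pmf (block_pmf \<omega> N t m))"
    unfolding block_measure_def by (rule measurable_component_singleton) simp
  have "(\<lambda>\<xi>. \<tau> @ \<xi> m) \<in> measurable (block_measure \<omega> N t) (count_space UNIV)" for \<tau>
    by (rule measurable_compose[OF comp]) simp
  then show ?case
    unfolding block_concat_Suc by (rule measurable_compose_countable[OF _ Suc])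
qed simp

context
  fixes \<omega> N
  assumes necked: "(\<omega>, N) \<in> necked_trees M"
begin

lemma weight_block_concat:
  assumes \<xi>: "\<And>j. \<xi> j \<in> neck_blocks M \<omega> N j"
  shows "weight r \<omega> (block_concat \<xi> m) = (\<Prod>j<m. weight r (neck_tail M \<omega> N j) (\<xi> j))"
proof (induction m)
  case (Suc m)
  have "subtree \<omega> (block_concat \<xi> m) = neck_tail M \<omega> N m"
    by (intro subtree_neck[OF necked] block_concat_level[OF necked] \<xi>)
  with Suc show ?case by (simp add: block_concat_Suc weight_append)
qed simp

lemma level_sum_neck:
  "level_sum M T \<omega> (N m) t = (\<Prod>j<m. level_sum M T (neck_tail M \<omega> N j) (N (j + 1) - N j) t)"
proof (induction m)
  case 0
  then show ?case using necked_N[OF necked] by (simp add: level_sum_eq)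
next
  case (Suc m)
  then show ?case
    using level_sum_add[of \<omega> "N m" "neck_tail M \<omega> N m" "N (m + 1) - N m" t] subtree_neck[OF necked]
      necked_N_le[OF necked, of m 1] by simp
qed

text \<open>Weights and level sums both factor over blocks, so the product of the block
  probabilities is this quotient exactly, with no distortion constant.\<close>

lemma emeasure_block_cylinder:
  assumes \<xi>: "\<And>j. \<xi> j \<in> neck_blocks M \<omega> N j"
  shows "emeasure (block_measure \<omega> N t) {\<eta>. \<forall>j<m. \<eta> j = \<xi> j}
    = ennreal (weight r \<omega> (block_concat \<xi> m) powr t / level_sum M T \<omega> (N m) t)"
proof -
  interpret product_prob_space "\<lambda>m. measure_pmf (block_pmf \<omega> N t m)" UNIV by standard
  have "emeasure (block_measure \<omega> N t) {\<eta>. \<forall>j<m. \<eta> j = \<xi> j}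
      = (\<Prod>j\<in>{..<m}. emeasure (measure_pmf (block_pmf \<omega> N t j)) {\<xi> j})"
    using emeasure_PiM_Collect[of "{..<m}" "\<lambda>j. {\<xi> j}"] by (simp add: block_measure_def space_PiM Ball_def)
  also have "\<dots> = ennreal (\<Prod>j<m. pmf (block_pmf \<omega> N t j) (\<xi> j))"
    by (simp add: emeasure_pmf_single prod_ennreal)
  also have "(\<Prod>j<m. pmf (block_pmf \<omega> N t j) (\<xi> j)) = weight r \<omega> (block_concat \<xi> m) powr t / level_sum M T \<omega> (N m) t"
    unfolding weight_block_concat[OF \<xi>] level_sum_neck
    using \<xi> by (simp add: pmf_block_pmf prod_dividef prod_powr_distrib)
  finally show ?thesis .
qed

lemma block_concat_weight_pos:
  assumes "\<And>j. \<xi> j \<in> neck_blocks M \<omega> N j"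
  shows "0 < weight r \<omega> (block_concat \<xi> m)" "weight r \<omega> (block_concat \<xi> m) \<le> 1"
  using block_concat_level[OF necked, of m \<xi>] assms weight_pos weight_le_1 by (auto simp: level_def)

text \<open>A set outside the sigma-algebra would have \<open>emeasure\<close> 0 by convention,
  whereas the formula for cylinders is positive.\<close>

lemma sets_block_cylinder:
  assumes \<xi>: "\<And>j. \<xi> j \<in> neck_blocks M \<omega> N j"
  shows "{\<eta>. \<forall>j<m. \<eta> j = \<xi> j} \<in> sets (block_measure \<omega> N t)"
proof (rule ccontr)
  assume "\<not> ?thesis"
  then have "emeasure (block_measure \<omega> N t) {\<eta>. \<forall>j<m. \<eta> j = \<xi> j} = 0" by (rule emeasure_notin_sets)
  then have "weight r \<omega> (block_concat \<xi> m) powr t / level_sum M T \<omega> (N m) t \<le> 0"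
    using emeasure_block_cylinder[OF \<xi>, where m=m and t=t] by (simp add: ennreal_eq_0_iff)
  moreover have "0 < weight r \<omega> (block_concat \<xi> m) powr t / level_sum M T \<omega> (N m) t"
    using block_concat_weight_pos(1)[OF \<xi>, of m] level_sum_pos by (intro divide_pos_pos) auto
  ultimately show False by simp
qed

text \<open>The cylinders around a block sequence have mass at most the inverse level sums, so
  points are not atoms. The diagonal must be excluded because equal sequences have equal projections
  for every translation.\<close>

lemma AE_block_neq:
  assumes \<xi>: "\<And>j. \<xi> j \<in> neck_blocks M \<omega> N j" and "0 \<le> t"
    and lim: "(\<lambda>m. 1 / level_sum M T \<omega> (N m) t) \<longlonglongrightarrow> 0"
  shows "AE \<eta> in block_measure \<omega> N t. \<eta> \<noteq> \<xi>"
proof -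
  let ?\<nu> = "block_measure \<omega> N t"
  let ?C = "\<lambda>m. {\<eta>. \<forall>j<m. \<eta> j = \<xi> j}"
  have D: "(\<Inter>m. ?C m) \<in> sets ?\<nu>" using sets_block_cylinder[OF \<xi>] by (intro sets.countable_INT) auto
  have le: "emeasure ?\<nu> (\<Inter>m. ?C m) \<le> ennreal (1 / level_sum M T \<omega> (N m) t)" for m
  proof -
    have "emeasure ?\<nu> (\<Inter>m. ?C m) \<le> emeasure ?\<nu> (?C m)"
      by (rule emeasure_mono) (use sets_block_cylinder[OF \<xi>] in auto)
    also have "\<dots> \<le> ennreal (1 / level_sum M T \<omega> (N m) t)"
      unfolding emeasure_block_cylinder[OF \<xi>]
      using block_concat_weight_pos[OF \<xi>, of m] level_sum_pos[of \<omega> "N m" t] \<open>0 \<le> t\<close>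
      by (intro ennreal_leI divide_right_mono powr_le1) auto
    finally show ?thesis .
  qed
  have "(\<lambda>m. ennreal (1 / level_sum M T \<omega> (N m) t)) \<longlonglongrightarrow> ennreal 0" by (rule tendsto_ennrealI[OF lim])
  then have "emeasure ?\<nu> (\<Inter>m. ?C m) \<le> ennreal 0" by (rule LIMSEQ_le_const) (use le in blast)
  then have "(\<Inter>m. ?C m) \<in> null_sets ?\<nu>" using D by (simp add: null_sets_def)
  then have "AE \<eta> in ?\<nu>. \<eta> \<notin> (\<Inter>m. ?C m)" by (rule AE_not_in)
  then show ?thesis by eventually_elim auto
qed

end

end

section \<open>Energy of the projected measure\<close>

context translated_tree
begin

text \<open>Off the support of the block measure the concatenation may leave the tree; the value \<open>0\<close> there
  keeps the function measurable.\<close>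

definition block_projection :: "(nat list \<Rightarrow> 'l) \<Rightarrow> ('l, 'a) translation \<Rightarrow> (nat \<Rightarrow> nat list) \<Rightarrow> 'a" where
  "block_projection \<omega> a \<xi> = lim (\<lambda>m. if block_concat \<xi> m \<in> tree_words M \<omega> then F a \<omega> (block_concat \<xi> m) 0 else 0)"

text \<open>At each stage only countably many finite words can occur, and for a fixed word the map
  depends measurably on the translation alone.\<close>

lemma measurable_block_projection:
  "(\<lambda>(a, \<xi>). block_projection \<omega> a \<xi>) \<in> borel_measurable (translation_measure \<Otimes>\<^sub>M block_measure \<omega> N t)"
  unfolding block_projection_def case_prod_unfold
proof (intro borel_measurable_lim_metric)
  fix m
  let ?L = "translation_measure \<Otimes>\<^sub>M block_measure \<omega> N t"
  have "(\<lambda>x. if \<tau> \<in> tree_words M \<omega> then F (fst x) \<omega> \<tau> 0 else 0) \<in> borel_measurable ?L" for \<tau>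
    using measurable_compose[OF measurable_fst measurable_F, of \<tau> \<omega>]
    by (cases "\<tau> \<in> tree_words M \<omega>") auto
  from measurable_compose_countable[OF this measurable_compose[OF measurable_snd measurable_block_concat]]
  show "(\<lambda>x. if block_concat (snd x) m \<in> tree_words M \<omega> then F (fst x) \<omega> (block_concat (snd x) m) 0 else 0)
      \<in> borel_measurable ?L" .
qed

context
  fixes \<omega> N
  assumes necked: "(\<omega>, N) \<in> necked_trees M"
begin

lemma block_projection_eq:
  assumes \<xi>: "\<And>m. \<xi> m \<in> neck_blocks M \<omega> N m"
  shows "block_projection \<omega> a \<xi> = projection T R a \<omega> (block_path \<xi>)"
proof -
  have tw: "block_concat \<xi> m \<in> tree_words M \<omega>" for m
    using block_concat_level[OF necked, of m \<xi>] \<xi> by (simp add: level_def)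
  have "(\<lambda>m. F a \<omega> (map (block_path \<xi>) [0..<N m]) 0) \<longlonglongrightarrow> projection T R a \<omega> (block_path \<xi>)"
    using LIMSEQ_subseq_LIMSEQ[OF projection_tendsto[OF block_path_boundary[OF necked \<xi>]] necked_N(2)[OF necked]]
    by (simp add: o_def)
  then show ?thesis
    unfolding block_projection_def block_path_prefix[OF necked \<xi>] by (simp add: tw limI)
qed

text \<open>The first differing letter lies somewhere inside block m. The weight of the common
  prefix is thus compared with its weight at the m-th neck, and at most the full block length in
  powers of \<open>lo\<close> is lost.\<close>

lemma block_pair_integral_le:
  assumes \<xi>: "\<And>m. \<xi> m \<in> neck_blocks M \<omega> N m" and \<eta>: "\<And>m. \<eta> m \<in> neck_blocks M \<omega> N m"
    and eq: "\<And>j. j < m \<Longrightarrow> \<eta> j = \<xi> j" and neq: "\<eta> m \<noteq> \<xi> m"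
    and pos: "0 < y" "0 < \<rho>" and t: "0 < t" "t < real DIM('a)"
  shows "(\<integral>\<^sup>+a. translation_box \<rho> a * indicator {..y} (dist (block_projection \<omega> a \<xi>) (block_projection \<omega> a \<eta>)) \<partial>translation_measure)
    \<le> ennreal (box_const \<rho> t * (y / (weight r \<omega> (block_concat \<xi> m) * lo ^ (N (m + 1) - N m))) powr t)"
proof -
  define u v where "u = block_path \<xi>" and "v = block_path \<eta>"
  have u: "u \<in> tree_boundary M \<omega>" and v: "v \<in> tree_boundary M \<omega>"
    unfolding u_def v_def by (intro block_path_boundary[OF necked] \<xi> \<eta>)+
  have "block_concat \<xi> m = block_concat \<eta> m"
    unfolding block_concat_def using eq by (intro arg_cong[where f=concat] map_cong) auto
  then have pre: "map u [0..<N m] = map v [0..<N m]"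
    unfolding u_def v_def block_path_prefix[OF necked \<xi>] block_path_prefix[OF necked \<eta>] .
  have "block_concat \<xi> (Suc m) \<noteq> block_concat \<eta> (Suc m)"
    using neq \<open>block_concat \<xi> m = block_concat \<eta> m\<close> by (simp add: block_concat_Suc)
  then have "map u [0..<N (Suc m)] \<noteq> map v [0..<N (Suc m)]"
    unfolding u_def v_def block_path_prefix[OF necked \<xi>] block_path_prefix[OF necked \<eta>] .
  then obtain n where n: "n < N (Suc m)" "u n \<noteq> v n" by (auto simp: list_eq_iff_nth_eq)
  define k where "k = (LEAST n. u n \<noteq> v n)"
  have k: "u k \<noteq> v k" unfolding k_def by (rule LeastI[of "\<lambda>n. u n \<noteq> v n", OF n(2)])
  have k_least: "u n = v n" if "n < k" for n using not_less_Least[OF that[unfolded k_def]] by simp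
  have "k \<le> n" unfolding k_def by (rule Least_le[of "\<lambda>n. u n \<noteq> v n", OF n(2)])
  with n(1) have kS: "k < N (m + 1)" by simp
  have kN: "N m \<le> k"
  proof (rule ccontr)
    assume "\<not> N m \<le> k"
    then have "k < N m" by simp
    then have "map u [0..<N m] ! k = map v [0..<N m] ! k" using pre by simp
    with \<open>k < N m\<close> k show False by simp
  qed
  define \<tau> where "\<tau> = map (\<lambda>n. u (n + N m)) [0..<k - N m]"
  have split: "map u [0..<k] = block_concat \<xi> m @ \<tau>"
    using prefix_split[of u "N m" "k - N m"] kN block_path_prefix[OF necked \<xi>, of m] by (simp add: \<tau>_def u_def)
  have "map u [0..<k] \<in> tree_words M \<omega>" using boundary_level[OF u] by (simp add: level_def)
  then have \<tau>: "\<tau> \<in> tree_words M (subtree \<omega> (block_concat \<xi> m))" unfolding split tree_words_append by simp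
  have "lo ^ (N (m + 1) - N m) \<le> lo ^ (k - N m)"
    using lo_pos lo_le_hi hi_less kS by (intro power_decreasing) auto
  also have "\<dots> \<le> weight r (subtree \<omega> (block_concat \<xi> m)) \<tau>" using weight_bounds[OF \<tau>] by (simp add: \<tau>_def)
  finally have le: "weight r \<omega> (block_concat \<xi> m) * lo ^ (N (m + 1) - N m) \<le> weight r \<omega> (map u [0..<k])"
    unfolding split weight_append using block_concat_weight_pos(1)[OF necked \<xi>, of m] by simp
  have d: "0 < weight r \<omega> (block_concat \<xi> m) * lo ^ (N (m + 1) - N m)"
    using block_concat_weight_pos(1)[OF necked \<xi>, of m] lo_pos by simp
  then have W: "0 < weight r \<omega> (map u [0..<k])" using le by linarith
  have "0 \<le> y / weight r \<omega> (map u [0..<k])" using pos(1) W by simp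
  moreover have "y / weight r \<omega> (map u [0..<k]) \<le> y / (weight r \<omega> (block_concat \<xi> m) * lo ^ (N (m + 1) - N m))"
    by (rule divide_left_mono[OF le less_imp_le[OF pos(1)] mult_pos_pos[OF W d]])
  ultimately have "(y / weight r \<omega> (map u [0..<k])) powr t \<le> (y / (weight r \<omega> (block_concat \<xi> m) * lo ^ (N (m + 1) - N m))) powr t"
    using t(1) by (intro powr_mono2) auto
  then have "ennreal (box_const \<rho> t * (y / weight r \<omega> (map u [0..<k])) powr t)
      \<le> ennreal (box_const \<rho> t * (y / (weight r \<omega> (block_concat \<xi> m) * lo ^ (N (m + 1) - N m))) powr t)"
    using box_const_nonneg[OF pos(2)] by (intro ennreal_leI mult_left_mono)
  with box_integral_le[OF u v k_least k pos t] show ?thesis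
    unfolding block_projection_eq[OF \<xi>] block_projection_eq[OF \<eta>] u_def[symmetric] v_def[symmetric]
    by (rule order_trans)
qed

text \<open>Splits according to the first block in which the sequences differ, and bounds the mass
  of each case by that of the cylinder around \<open>\<xi>\<close>. The result is uniform in
  \<open>\<xi>\<close>.\<close>

lemma block_potential_le:
  assumes \<xi>: "\<And>m. \<xi> m \<in> neck_blocks M \<omega> N m"
    and pos: "0 < y" "0 < \<rho>" and t: "0 < t" "t < real DIM('a)"
    and sum: "summable (\<lambda>m. (lo ^ (N (m + 1) - N m)) powr (- t) / level_sum M T \<omega> (N m) t)" (is "summable ?s")
  shows "(\<integral>\<^sup>+\<eta>. \<integral>\<^sup>+a. translation_box \<rho> a * indicator {..y} (dist (block_projection \<omega> a \<xi>) (block_projection \<omega> a \<eta>))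
      \<partial>translation_measure \<partial>block_measure \<omega> N t) \<le> ennreal (box_const \<rho> t * (\<Sum>m. ?s m) * y powr t)"
proof -
  let ?\<nu> = "block_measure \<omega> N t"
  let ?I = "\<lambda>\<eta>. \<integral>\<^sup>+a. translation_box \<rho> a * indicator {..y} (dist (block_projection \<omega> a \<xi>) (block_projection \<omega> a \<eta>))
      \<partial>translation_measure"
  let ?C = "\<lambda>m. {\<eta>. \<forall>j<m. \<eta> j = \<xi> j}"
  define w where "w m = weight r \<omega> (block_concat \<xi> m)" for m
  define l where "l m = lo ^ (N (m + 1) - N m)" for m
  have w: "0 < w m" for m unfolding w_def by (rule block_concat_weight_pos(1)[OF necked \<xi>])
  have l: "0 < l m" "l m \<le> 1" for m
    unfolding l_def using lo_pos lo_le_hi hi_less by (auto intro!: power_le_one)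
  have s_nonneg: "0 \<le> ?s m" for m by (simp add: level_sum_nonneg)
  \<comment> \<open>The loss factors are at least 1, so the summable terms dominate the inverse
    level sums, which rules out atoms.\<close>
  have "(\<lambda>m. 1 / level_sum M T \<omega> (N m) t) \<longlonglongrightarrow> 0"
  proof (rule tendsto_sandwich[OF _ _ tendsto_const summable_LIMSEQ_zero[OF sum]])
    have "1 \<le> l m powr (- t)" for m
      using powr_mono2'[of "- t" "l m" 1] l[of m] t by (simp add: powr_minus one_le_inverse powr_le1)
    then have "1 / level_sum M T \<omega> (N m) t \<le> ?s m" for m
      unfolding l_def by (rule divide_right_mono[OF _ level_sum_nonneg])
    then show "\<forall>\<^sub>F m in sequentially. 1 / level_sum M T \<omega> (N m) t \<le> ?s m" by (rule always_eventually[OF allI])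
    show "\<forall>\<^sub>F m in sequentially. 0 \<le> 1 / level_sum M T \<omega> (N m) t"
      by (simp add: level_sum_nonneg)
  qed
  with \<xi> t have neq: "AE \<eta> in ?\<nu>. \<eta> \<noteq> \<xi>" by (intro AE_block_neq[OF necked]) auto
  have "(\<integral>\<^sup>+\<eta>. ?I \<eta> \<partial>?\<nu>) \<le> (\<integral>\<^sup>+\<eta>. (\<Sum>m. ennreal (box_const \<rho> t * (y / (w m * l m)) powr t) * indicator (?C m) \<eta>) \<partial>?\<nu>)"
  proof (rule nn_integral_mono_AE)
    show "AE \<eta> in ?\<nu>. ?I \<eta> \<le> (\<Sum>m. ennreal (box_const \<rho> t * (y / (w m * l m)) powr t) * indicator (?C m) \<eta>)"
      using neq AE_block_measure
    proof eventually_elim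
      case (elim \<eta>)
      then have ex: "\<exists>m. \<eta> m \<noteq> \<xi> m" by auto
      define m where "m = (LEAST m. \<eta> m \<noteq> \<xi> m)"
      have m: "\<eta> m \<noteq> \<xi> m" unfolding m_def by (rule LeastI_ex[OF ex])
      have m_least: "\<eta> j = \<xi> j" if "j < m" for j using not_less_Least[OF that[unfolded m_def]] by simp
      have "?I \<eta> \<le> ennreal (box_const \<rho> t * (y / (w m * l m)) powr t)"
        unfolding w_def l_def using elim(2) by (intro block_pair_integral_le \<xi> m m_least pos t) auto
      also have "\<dots> = (\<Sum>m\<in>{m}. ennreal (box_const \<rho> t * (y / (w m * l m)) powr t) * indicator (?C m) \<eta>)"
        using m_least by simp
      also have "\<dots> \<le> (\<Sum>m. ennreal (box_const \<rho> t * (y / (w m * l m)) powr t) * indicator (?C m) \<eta>)"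
        by (rule sum_le_suminf) auto
      finally show ?case .
    qed
  qed
  also have "\<dots> = (\<Sum>m. ennreal (box_const \<rho> t * (y / (w m * l m)) powr t) * emeasure ?\<nu> (?C m))"
    using sets_block_cylinder[OF necked \<xi>]
    by (subst nn_integral_suminf) (auto simp: nn_integral_cmult)
  also have "\<dots> = (\<Sum>m. ennreal (box_const \<rho> t * y powr t * ?s m))"
  proof (rule suminf_cong)
    fix m
    \<comment> \<open>The t-th power of the weight in the mass of the cylinder cancels that of the
      transversality estimate. For this reason the measure is built with the exponent t of the
      estimate.\<close>
    have "(y / (w m * l m)) powr t * (w m powr t / level_sum M T \<omega> (N m) t) = y powr t * ?s m"
      unfolding l_def[symmetric] using w[of m] l[of m] pos
      by (simp add: powr_divide powr_mult powr_minus field_simps)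
    then have "box_const \<rho> t * (y / (w m * l m)) powr t * (w m powr t / level_sum M T \<omega> (N m) t) = box_const \<rho> t * y powr t * ?s m"
      by (simp only: mult.assoc)
    then show "ennreal (box_const \<rho> t * (y / (w m * l m)) powr t) * emeasure ?\<nu> (?C m) = ennreal (box_const \<rho> t * y powr t * ?s m)"
      unfolding emeasure_block_cylinder[OF necked \<xi>] w_def[symmetric]
      using box_const_nonneg[OF pos(2)] level_sum_pos[of \<omega> "N m" t] by (subst ennreal_mult[symmetric]) auto
  qed
  also have "\<dots> = ennreal (\<Sum>m. box_const \<rho> t * y powr t * ?s m)"
    using box_const_nonneg[OF pos(2)] s_nonneg sum by (intro suminf_ennreal2 mult_nonneg_nonneg summable_mult) auto
  also have "(\<Sum>m. box_const \<rho> t * y powr t * ?s m) = box_const \<rho> t * (\<Sum>m. ?s m) * y powr t"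
    by (subst suminf_mult[OF sum]) (simp only: mult_ac)
  finally show ?thesis .
qed

text \<open>The energy is almost surely finite in each box of the sequence, and the boxes exhaust
  the translations. For a single translation in a box the energy criterion then applies to the
  projected block measure.\<close>

lemma AE_hausdorff_dim_attractor_ge:
  assumes s: "0 < s" "s < t" and t: "t < real DIM('a)"
    and sum: "summable (\<lambda>m. (lo ^ (N (m + 1) - N m)) powr (- t) / level_sum M T \<omega> (N m) t)" (is "summable ?s")
  shows "AE a in translation_measure. ereal s \<le> hausdorff_dim (attractor M T R a \<omega>)"
proof -
  let ?\<nu> = "block_measure \<omega> N t"
  let ?E = "\<lambda>a. \<Sum>n. ennreal (2 powr (real n * s)) *
      (\<integral>\<^sup>+\<xi>. \<integral>\<^sup>+\<eta>. indicator {..(1/2)^n} (dist (block_projection \<omega> a \<xi>) (block_projection \<omega> a \<eta>)) \<partial>?\<nu> \<partial>?\<nu>)"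
  interpret product_sigma_finite "\<lambda>_::('l \<times> nat) set. lborel :: 'a measure" by standard
  have "AE a in translation_measure. translation_box (real (Suc k)) a * ?E a \<noteq> \<infinity>" for k
  proof (rule AE_dyadic_energy_finite[where K="box_const (real (Suc k)) t * (\<Sum>m. ?s m)"])
    show "sigma_finite_measure translation_measure" by (rule sigma_finite[OF R_finite])
    show "prob_space ?\<nu>" by (rule prob_space_block_measure)
    show "(\<lambda>(a, \<xi>). block_projection \<omega> a \<xi>) \<in> borel_measurable (translation_measure \<Otimes>\<^sub>M ?\<nu>)"
      by (rule measurable_block_projection)
    show "translation_box (real (Suc k)) \<in> borel_measurable translation_measure" by (rule measurable_translation_box)
    show "0 \<le> box_const (real (Suc k)) t * (\<Sum>m. ?s m)"
      using sum level_sum_pos[of \<omega> _ t] by (intro mult_nonneg_nonneg box_const_nonneg suminf_nonneg) (auto simp: less_imp_le)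
    fix n
    have half: "((1/2)^n) powr t = 2 powr (- real n * t)"
      by (simp add: powr_realpow[symmetric] powr_powr powr_divide powr_minus_divide power_one_over)
    show "AE \<xi> in ?\<nu>. (\<integral>\<^sup>+\<eta>. \<integral>\<^sup>+a. translation_box (real (Suc k)) a *
        indicator {..(1/2)^n} (dist (block_projection \<omega> a \<xi>) (block_projection \<omega> a \<eta>)) \<partial>translation_measure \<partial>?\<nu>)
        \<le> ennreal (box_const (real (Suc k)) t * (\<Sum>m. ?s m) * 2 powr (- real n * t))"
      using AE_block_measure
    proof eventually_elim
      case (elim \<xi>)
      show ?case
        unfolding half[symmetric] using elim s t by (intro block_potential_le[OF _ _ _ _ _ sum]) auto
    qed
  qed (rule s)
  then have "AE a in translation_measure. \<forall>k. translation_box (real (Suc k)) a * ?E a \<noteq> \<infinity>"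
    by (simp add: AE_all_countable)
  then show ?thesis
    using AE_space
  proof eventually_elim
    case (elim a)
    obtain k :: nat where k: "trans_bound a \<le> real k" using real_arch_simple by blast
    \<comment> \<open>In a large enough box the cutoff is 1 and disappears from the energy bound.
      The successor keeps every radius positive.\<close>
    have "translation_box (real (Suc k)) a = 1"
      unfolding translation_box_def using trans_bound(1)[of _ a] k
      by (intro prod.neutral) (force simp: indicator_def)
    with elim(1) have "?E a \<noteq> \<infinity>" by (metis mult_1)
    then have E: "?E a < \<infinity>" by (simp add: less_top[symmetric])
    show ?case
    proof (rule hausdorff_dim_ge_energy[OF prob_space_block_measure _ _ s(1) E])
      show "block_projection \<omega> a \<in> borel_measurable ?\<nu>"
        using measurable_compose[OF measurable_Pair1'[OF elim(2)] measurable_block_projection] by simp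
      show "AE \<xi> in ?\<nu>. block_projection \<omega> a \<xi> \<in> attractor M T R a \<omega>"
        using AE_block_measure
      proof eventually_elim
        case (elim \<xi>)
        then show ?case
          using block_projection_eq[of \<xi> a] block_path_boundary[OF necked, of \<xi>] by (auto simp: attractor_def)
      qed
    qed
  qed
qed

end

end

section \<open>Dimension of the attractor\<close>

context translated_tree
begin

text \<open>Per neck, the loss factor contributes nothing to the logarithm in the limit because the
  gaps are o(m), and the level sum contributes \<open>- g t\<close>. Half of this rate already gives
  a convergent geometric series.\<close>

lemma regular_tree_summable:
  assumes reg: "regular_tree \<nu> g \<omega> N" and "0 < t" "0 < g t"
  shows "summable (\<lambda>m. (lo ^ (N (m + 1) - N m)) powr (- t) / level_sum M T \<omega> (N m) t)" (is "summable ?s")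
proof -
  have nt: "(\<omega>, N) \<in> necked_trees M" and lim_N: "(\<lambda>m. real (N m) / real m) \<longlonglongrightarrow> \<nu>"
    and lim: "(\<lambda>m. ln (level_sum M T \<omega> (N m) t) / real m) \<longlonglongrightarrow> g t"
    using reg \<open>0 < t\<close> by (auto simp: regular_tree_def)
  let ?d = "\<lambda>m. (real (N (m + 1)) - real (N m)) / real m"
  have "(\<lambda>m. t * - ln lo * ?d m - ln (level_sum M T \<omega> (N m) t) / real m) \<longlonglongrightarrow> t * - ln lo * 0 - g t"
    by (intro tendsto_diff tendsto_mult tendsto_const gap_tendsto_0[OF lim_N] lim)
  then have "\<forall>\<^sub>F m in sequentially. t * - ln lo * ?d m - ln (level_sum M T \<omega> (N m) t) / real m < - (g t / 2)"
    using \<open>0 < g t\<close> by (intro order_tendstoD(2)) auto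
  moreover have "\<forall>\<^sub>F m in sequentially. 1 \<le> m" by (rule eventually_ge_at_top)
  ultimately have "\<forall>\<^sub>F m in sequentially. norm (?s m) \<le> exp (- (g t / 2)) ^ m"
  proof eventually_elim
    case (elim m)
    have pos: "0 < ?s m" using lo_pos level_sum_pos[of \<omega> "N m" t] by simp
    have "ln (?s m) = t * - ln lo * (real (N (m + 1)) - real (N m)) - ln (level_sum M T \<omega> (N m) t)"
      using lo_pos level_sum_pos[of \<omega> "N m" t] necked_N_le[OF nt, of m 1]
      by (simp add: ln_div ln_powr ln_realpow of_nat_diff)
    also have "\<dots> = real m * (t * - ln lo * ?d m - ln (level_sum M T \<omega> (N m) t) / real m)"
      using elim(2) by (simp add: field_simps)
    also have "\<dots> \<le> real m * - (g t / 2)"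
      using elim by (intro mult_left_mono) auto
    finally have "ln (?s m) \<le> real m * - (g t / 2)" .
    then have "exp (ln (?s m)) \<le> exp (real m * - (g t / 2))" by simp
    then show ?case unfolding exp_ln[OF pos] exp_of_nat_mult real_norm_def abs_of_pos[OF pos] .
  qed
  then show ?thesis
    by (rule summable_comparison_test_ev) (use \<open>0 < g t\<close> in \<open>simp add: summable_geometric\<close>)
qed

lemma level_sum_tendsto_0:
  assumes "(\<lambda>k. ln (level_sum M T \<omega> k s) / real k) \<longlonglongrightarrow> c" "c < 0"
  shows "(\<lambda>k. level_sum M T \<omega> k s) \<longlonglongrightarrow> 0"
proof -
  have "filterlim (\<lambda>k. ln (level_sum M T \<omega> k s) / real k * real k) at_bot sequentially"
    by (rule filterlim_tendsto_neg_mult_at_bot[OF assms filterlim_real_sequentially])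
  then have "filterlim (\<lambda>k. ln (level_sum M T \<omega> k s)) at_bot sequentially"
    by (rule filterlim_cong[THEN iffD1, OF refl refl, rotated])
      (auto simp: eventually_sequentially intro!: exI[of _ 1])
  from filterlim_compose[OF exp_at_bot this] show ?thesis
    by (simp add: level_sum_pos)
qed

lemma hausdorff_dim_attractor_le:
  assumes reg: "regular_tree \<nu> g \<omega> N" and "1 \<le> \<nu>" "0 \<le> \<alpha>\<^sub>0"
    and neg: "\<And>\<alpha>. \<alpha>\<^sub>0 < \<alpha> \<Longrightarrow> g \<alpha> < 0"
  shows "hausdorff_dim (attractor M T R a \<omega>) \<le> ereal (min \<alpha>\<^sub>0 (real DIM('a)))"
proof (rule hausdorff_dim_leI)
  fix s assume s: "min \<alpha>\<^sub>0 (real DIM('a)) < s"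
  show "hausdorff_measure s (attractor M T R a \<omega>) = 0"
  proof (cases "real DIM('a) < s")
    case True
    then show ?thesis by (rule hausdorff_measure_bounded_eq_0[OF bounded_attractor])
  next
    case False
    then have "\<alpha>\<^sub>0 < s" using s by simp
    moreover from this have "0 < s" using \<open>0 \<le> \<alpha>\<^sub>0\<close> by simp
    ultimately show ?thesis
      using regular_tree_pressure[OF reg \<open>1 \<le> \<nu>\<close>, of s] neg[of s] \<open>1 \<le> \<nu>\<close>
      by (intro attractor_hausdorff_measure_eq_0 level_sum_tendsto_0[where c="g s / \<nu>"])
        (auto simp: divide_neg_pos)
  qed
qed (use \<open>0 \<le> \<alpha>\<^sub>0\<close> in simp)

text \<open>Each lower bound s has its own null set of translations. Rational s suffice, being dense
  below the minimum.\<close>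

lemma AE_hausdorff_dim_attractor:
  assumes reg: "regular_tree \<nu> g \<omega> N" and "1 \<le> \<nu>" "0 \<le> \<alpha>\<^sub>0"
    and pos: "\<And>\<alpha>. \<alpha> < \<alpha>\<^sub>0 \<Longrightarrow> 0 < g \<alpha>" and neg: "\<And>\<alpha>. \<alpha>\<^sub>0 < \<alpha> \<Longrightarrow> g \<alpha> < 0"
  shows "AE a in translation_measure. hausdorff_dim (attractor M T R a \<omega>) = ereal (min \<alpha>\<^sub>0 (real DIM('a)))"
proof -
  let ?m = "min \<alpha>\<^sub>0 (real DIM('a))"
  have nt: "(\<omega>, N) \<in> necked_trees M" using reg by (simp add: regular_tree_def)
  have "AE a in translation_measure. \<forall>s\<in>\<rat> \<inter> {0<..<?m}. ereal s \<le> hausdorff_dim (attractor M T R a \<omega>)"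
  proof (subst AE_ball_countable)
    show "countable (\<rat> \<inter> {0<..<?m})" by (intro countable_Int1 countable_rat)
    show "\<forall>s\<in>\<rat> \<inter> {0<..<?m}. AE a in translation_measure. ereal s \<le> hausdorff_dim (attractor M T R a \<omega>)"
    proof
      fix s assume s: "s \<in> \<rat> \<inter> {0<..<?m}"
      then obtain t where "s < t" "t < ?m" using dense[of s ?m] by auto
      with s show "AE a in translation_measure. ereal s \<le> hausdorff_dim (attractor M T R a \<omega>)"
        by (intro AE_hausdorff_dim_attractor_ge[OF nt, of s t] regular_tree_summable[OF reg] pos) auto
    qed
  qed
  then show ?thesis
  proof eventually_elim
    case (elim a)
    let ?h = "hausdorff_dim (attractor M T R a \<omega>)"
    have "0 \<le> ?h" unfolding hausdorff_dim_def by (rule Inf_greatest) auto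
    have "ereal ?m \<le> ?h"
    proof (rule ccontr)
      assume "\<not> ereal ?m \<le> ?h"
      then have lt: "?h < ereal ?m" by (simp only: not_le)
      with \<open>0 \<le> ?h\<close> obtain d where d: "?h = ereal d" by (cases ?h) auto
      with lt \<open>0 \<le> ?h\<close> have "0 \<le> d" "d < ?m" by auto
      then obtain q where "q \<in> \<rat>" "d < q" "q < ?m" using Rats_dense_in_real[of d ?m] by auto
      with elim \<open>0 \<le> d\<close> have "ereal q \<le> ?h" by auto
      with d \<open>d < q\<close> show False by simp
    qed
    moreover have "?h \<le> ereal ?m"
      by (rule hausdorff_dim_attractor_le[OF reg \<open>1 \<le> \<nu>\<close> \<open>0 \<le> \<alpha>\<^sub>0\<close>]) (rule neg)
    ultimately show ?case by (rule antisym[rotated])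
  qed
qed

end

theorem proposition5p7:
  fixes M :: "'l \<Rightarrow> nat"
    and T :: "'l \<Rightarrow> nat \<Rightarrow> real^'d \<Rightarrow> real^'d"
    and R :: "('l \<times> nat) rel"
    and \<sigma>lo \<sigma>hi :: real
    and P :: "'l necked measure"
  assumes M_pos: "\<And>l. 1 \<le> M l"
    and M_bdd: "bdd_above (range M)"
    and T_linear: "\<And>l i. i \<in> {1..M l} \<Longrightarrow> linear (T l i)"
    and T_nonsingular: "\<And>l i. i \<in> {1..M l} \<Longrightarrow> bij (T l i)"
    and sv_bounds: "\<And>l i. i \<in> {1..M l} \<Longrightarrow>
          \<sigma>lo \<le> singular_value CARD('d) (T l i) \<and> singular_value 1 (T l i) \<le> \<sigma>hi"
    and R_equiv: "equiv (map_indices M) R"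
    and R_finite: "finite (map_indices M // R)"
    and R_separates: "\<And>l i j. i \<in> {1..M l} \<Longrightarrow> j \<in> {1..M l} \<Longrightarrow>
          ((l, i), (l, j)) \<in> R \<longleftrightarrow> i = j"
    and P_prob: "prob_space P"
    and P_sets: "sets P = sets (neck_borel M)"
    and P_invariant: "invariant_measure P (neck_shift M)"
    and P_ergodic: "ergodic_measure P (neck_shift M)"
    and N1_integrable: "(\<integral>\<^sup>+ (\<omega>, N). ennreal (real (N 1)) \<partial>P) < \<infinity>"
    and similarities: "\<And>a l i. i \<in> {1..M l} \<Longrightarrow> similarity (ifs_map T R a l i)"
    and \<sigma>_bounds: "0 < \<sigma>lo" "\<sigma>lo \<le> \<sigma>hi" "\<sigma>hi < 1 / 2"
  shows "\<exists>\<alpha>\<^sub>0\<ge>0. AE (\<omega>, N) in P.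
           (\<forall>\<alpha>\<ge>0. pressure_exists M T \<omega> \<alpha>) \<and>
           (\<forall>\<alpha>\<ge>0. pressure M T \<omega> \<alpha> = 0 \<longleftrightarrow> \<alpha> = \<alpha>\<^sub>0) \<and>
           (AE a in translation_lebesgue M R.
              hausdorff_dim (attractor M T R a \<omega>) = ereal (min \<alpha>\<^sub>0 (real CARD('d))))"
proof -
  have "\<exists>c>0. \<forall>x. norm (T l i x) = c * norm x" if i: "i \<in> {1..M l}" for l i
  proof -
    \<comment> \<open>The zero translation makes the affine map equal to its linear part.\<close>
    obtain c where c: "0 < c" "\<And>x y. dist (T l i x) (T l i y) = c * dist x y"
      using similarities[OF i, of "\<lambda>_. 0"] by (auto simp: similarity_def ifs_map_def)
    have "norm (T l i x) = c * norm x" for x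
      using c(2)[of x 0] linear_0[OF T_linear[OF i]] by simp
    with c(1) show ?thesis by blast
  qed
  note ex = this
  define r where "r l i = (SOME c. 0 < c \<and> (\<forall>x. norm (T l i x) = c * norm x))" for l i
  have "0 < r l i \<and> (\<forall>x. norm (T l i x) = r l i * norm x)" if "i \<in> {1..M l}" for l i
    unfolding r_def by (rule someI_ex) (use ex[OF that] in blast)
  then have r: "\<And>l i. i \<in> {1..M l} \<Longrightarrow> 0 < r l i"
      "\<And>l i x. i \<in> {1..M l} \<Longrightarrow> norm (T l i x) = r l i * norm x"
    by blast+
  have sv: "singular_value j (T l i) = r l i" if i: "i \<in> {1..M l}" and "1 \<le> j" "j \<le> CARD('d)" for l i j
    using singular_value_similarity[OF T_linear[OF i] r(2)[OF i] r(1)[OF i]] that by simp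
  have r_bounds: "\<sigma>lo \<le> r l i" "r l i \<le> \<sigma>hi" if i: "i \<in> {1..M l}" for l i
    using sv_bounds[OF i] sv[OF i, of 1] sv[OF i, of "CARD('d)"] by (auto simp: Suc_le_eq)
  obtain B where B: "\<And>l. M l \<le> B" using M_bdd by (auto simp: bdd_above_def)
  interpret translated_tree M T r B \<sigma>lo \<sigma>hi R
    by (intro translated_tree.intro similarity_tree.intro translated_tree_axioms.intro)
      (fact M_pos B T_linear r(2) r_bounds \<sigma>_bounds R_equiv R_finite R_separates)+
  obtain \<nu> g where \<nu>: "1 \<le> \<nu>" and g0: "0 \<le> g 0"
    and g: "\<And>\<alpha> \<beta>. \<alpha> \<le> \<beta> \<Longrightarrow> \<nu> * ((\<beta> - \<alpha>) * ln \<sigma>lo) \<le> g \<beta> - g \<alpha> \<and> g \<beta> - g \<alpha> \<le> \<nu> * ((\<beta> - \<alpha>) * ln \<sigma>hi)"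
    and AE_reg: "AE (\<omega>, N) in P. regular_tree \<nu> g \<omega> N"
    by (rule AE_regular_tree[OF P_prob P_sets P_invariant P_ergodic N1_integrable]) (rule that; assumption)
  obtain \<alpha>\<^sub>0 where \<alpha>\<^sub>0: "0 \<le> \<alpha>\<^sub>0" "g \<alpha>\<^sub>0 = 0" and pos: "\<And>\<alpha>. \<alpha> < \<alpha>\<^sub>0 \<Longrightarrow> 0 < g \<alpha>" and neg: "\<And>\<alpha>. \<alpha>\<^sub>0 < \<alpha> \<Longrightarrow> g \<alpha> < 0"
    by (rule zero_of_growth_rate[of \<nu> g, OF \<nu> g0], erule g) (rule that; assumption)
  show ?thesis
  proof (intro exI[of _ \<alpha>\<^sub>0] conjI)
    show "0 \<le> \<alpha>\<^sub>0" by (rule \<alpha>\<^sub>0(1))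
    show "AE (\<omega>, N) in P. (\<forall>\<alpha>\<ge>0. pressure_exists M T \<omega> \<alpha>) \<and>
           (\<forall>\<alpha>\<ge>0. pressure M T \<omega> \<alpha> = 0 \<longleftrightarrow> \<alpha> = \<alpha>\<^sub>0) \<and>
           (AE a in translation_lebesgue M R.
              hausdorff_dim (attractor M T R a \<omega>) = ereal (min \<alpha>\<^sub>0 (real CARD('d))))"
      using AE_reg
    proof eventually_elim
      case (elim x)
      obtain \<omega> N where x: "x = (\<omega>, N)" by (cases x)
      with elim have reg: "regular_tree \<nu> g \<omega> N" by simp
      note lim = regular_tree_pressure[OF reg \<nu>]
      have "pressure_exists M T \<omega> \<alpha>" if "0 \<le> \<alpha>" for \<alpha>
        unfolding pressure_exists_def using lim[OF that] by (rule convergentI)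
      moreover have "pressure M T \<omega> \<alpha> = 0 \<longleftrightarrow> \<alpha> = \<alpha>\<^sub>0" if "0 \<le> \<alpha>" for \<alpha>
      proof -
        have "pressure M T \<omega> \<alpha> = g \<alpha> / \<nu>" unfolding pressure_def using lim[OF that] by (rule limI)
        moreover have "g \<alpha> = 0 \<longleftrightarrow> \<alpha> = \<alpha>\<^sub>0" using pos[of \<alpha>] neg[of \<alpha>] \<alpha>\<^sub>0(2) by (cases \<alpha> \<alpha>\<^sub>0 rule: linorder_cases) auto
        ultimately show ?thesis using \<nu> by simp
      qed
      moreover have "AE a in translation_measure. hausdorff_dim (attractor M T R a \<omega>) = ereal (min \<alpha>\<^sub>0 (real DIM(real^'d)))"
        by (rule AE_hausdorff_dim_attractor[OF reg \<nu> \<alpha>\<^sub>0(1)]) (erule pos, erule neg)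
      then have "AE a in translation_lebesgue M R.
          hausdorff_dim (attractor M T R a \<omega>) = ereal (min \<alpha>\<^sub>0 (real CARD('d)))"
        unfolding translation_lebesgue_def by (intro AE_completion) simp
      ultimately show ?case by (simp add: x)
    qed
  qed
qed

end
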